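(* Let $H$ be a fixed graph with $3k+j$ vertices, where $k\ge 0$ is an integer and $j \in \{0,1,2\}$. If $G=(V,E)$ is a graph with $n$ vertices and $c : E \rightarrow C$ is an edge-coloring (with an arbitrary color set $C$), then a rainbow $H$-subgraph of $G$ (if one exists) can be found in $O(n^{\omega k +j}\log n)$ time.
   Context: $\omega$ denotes the exponent of square matrix multiplication ($n\times n$ matrices can be multiplied in $O(n^\omega)$ arithmetic operations). An $H$-subgraph of an edge-colored graph is rainbow if all of its edges have distinct colors. *)

theory Defs
  imports "HOL-Library.Landau_Symbols" "Jordan_Normal_Form.Matrix"
begin

section \<open>Graphs and rainbow subgraphs\<close>

record 'a graph =
  verts :: "'a set"
  edges :: "'a set set"

definition simple_graph :: "'a graph \<Rightarrow> bool" where
  "simple_graph G \<longleftrightarrow> finite (verts G) \<and> (\<forall>e\<in>edges G. e \<subseteq> verts G \<and> card e = 2)"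

definition subgraph_of :: "'a graph \<Rightarrow> 'a graph \<Rightarrow> bool" where
  "subgraph_of S G \<longleftrightarrow> simple_graph S \<and> verts S \<subseteq> verts G \<and> edges S \<subseteq> edges G"

definition graph_iso :: "('a \<Rightarrow> 'b) \<Rightarrow> 'a graph \<Rightarrow> 'b graph \<Rightarrow> bool" where
  "graph_iso f H S \<longleftrightarrow> bij_betw f (verts H) (verts S) \<and> (\<lambda>e. f ` e) ` edges H = edges S"

text \<open>An \<open>H\<close>-subgraph is a subgraph isomorphic to \<open>H\<close>; it need not be induced.\<close>

definition H_subgraph :: "'h graph \<Rightarrow> 'v graph \<Rightarrow> 'v graph \<Rightarrow> bool" where
  "H_subgraph H G S \<longleftrightarrow> subgraph_of S G \<and> (\<exists>f. graph_iso f H S)"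

definition rainbow :: "('v set \<Rightarrow> 'c) \<Rightarrow> 'v graph \<Rightarrow> bool" where
  "rainbow c S \<longleftrightarrow> inj_on c (edges S)"


section \<open>The word RAM\<close>

text \<open>
  A program is a fixed text in a while language over finitely many arrays of machine words; the
  memory maps an array name and an index to the word stored there. Scalars are cells at index 0.
  Subtraction is truncated, and a test succeeds iff its value is nonzero.
\<close>

type_synonym memory = "nat \<Rightarrow> nat \<Rightarrow> nat"

datatype expr =
    Num nat
  | Get nat expr
  | Plus expr expr
  | Minus expr expr
  | Times expr expr
  | Div expr expr
  | Mod expr expr

datatype com =
    Skip
  | Assign nat expr expr
  | Seq com com
  | If expr com com
  | While expr com

primrec val :: "expr \<Rightarrow> memory \<Rightarrow> nat" where
  "val (Num k) s = k"
| "val (Get a e) s = s a (val e s)"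
| "val (Plus e f) s = val e s + val f s"
| "val (Minus e f) s = val e s - val f s"
| "val (Times e f) s = val e s * val f s"
| "val (Div e f) s = val e s div val f s"
| "val (Mod e f) s = val e s mod val f s"

text \<open>
  \<open>fits W e s\<close>: no number larger than \<open>W\<close> occurs while evaluating \<open>e\<close>. Without such a bound,
  unit-cost arithmetic would be unrealistically powerful.
\<close>

primrec fits :: "nat \<Rightarrow> expr \<Rightarrow> memory \<Rightarrow> bool" where
  "fits W (Num k) s \<longleftrightarrow> k \<le> W"
| "fits W (Get a e) s \<longleftrightarrow> fits W e s \<and> s a (val e s) \<le> W"
| "fits W (Plus e f) s \<longleftrightarrow> fits W e s \<and> fits W f s \<and> val e s + val f s \<le> W"
| "fits W (Minus e f) s \<longleftrightarrow> fits W e s \<and> fits W f s"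
| "fits W (Times e f) s \<longleftrightarrow> fits W e s \<and> fits W f s \<and> val e s * val f s \<le> W"
| "fits W (Div e f) s \<longleftrightarrow> fits W e s \<and> fits W f s"
| "fits W (Mod e f) s \<longleftrightarrow> fits W e s \<and> fits W f s"

text \<open>
  \<open>exec W c s t s'\<close>: on words with values \<open>0..W\<close>, program \<open>c\<close> started in \<open>s\<close> halts in \<open>s'\<close> after \<open>t\<close>
  steps; a computation that exceeds the word size is stuck. Assignments and tests cost one step each
  whatever the size of their expressions: that size is a constant of the program text.
\<close>

inductive exec :: "nat \<Rightarrow> com \<Rightarrow> memory \<Rightarrow> nat \<Rightarrow> memory \<Rightarrow> bool" for W where
  Skip: "exec W Skip s 1 s"
| Assign: "fits W e s \<Longrightarrow> fits W f s \<Longrightarrow>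
    exec W (Assign a e f) s 1 (s(a := (s a)(val e s := val f s)))"
| Seq: "exec W c s t s' \<Longrightarrow> exec W d s' u s'' \<Longrightarrow> exec W (Seq c d) s (t + u) s''"
| If_True: "fits W e s \<Longrightarrow> val e s \<noteq> 0 \<Longrightarrow> exec W c s t s' \<Longrightarrow>
    exec W (If e c d) s (1 + t) s'"
| If_False: "fits W e s \<Longrightarrow> val e s = 0 \<Longrightarrow> exec W d s t s' \<Longrightarrow>
    exec W (If e c d) s (1 + t) s'"
| While_False: "fits W e s \<Longrightarrow> val e s = 0 \<Longrightarrow> exec W (While e c) s 1 s"
| While_True: "fits W e s \<Longrightarrow> val e s \<noteq> 0 \<Longrightarrow> exec W c s t s' \<Longrightarrow>
    exec W (While e c) s' u s'' \<Longrightarrow> exec W (While e c) s (1 + t + u) s''"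


section \<open>The exponent of matrix multiplication\<close>

text \<open>
  Straight-line arithmetic programs over the rationals. Cells are numbered consecutively: first the
  inputs, then one new cell per instruction. The length is the number of arithmetic operations.
\<close>

datatype instr = Const rat | Add nat nat | Sub nat nat | Mul nat nat

primrec refs :: "instr \<Rightarrow> nat set" where
  "refs (Const r) = {}"
| "refs (Add x y) = {x, y}"
| "refs (Sub x y) = {x, y}"
| "refs (Mul x y) = {x, y}"

primrec instr_val :: "rat list \<Rightarrow> instr \<Rightarrow> rat" where
  "instr_val vs (Const r) = r"
| "instr_val vs (Add x y) = vs ! x + vs ! y"
| "instr_val vs (Sub x y) = vs ! x - vs ! y"
| "instr_val vs (Mul x y) = vs ! x * vs ! y"

primrec slp_wf :: "nat \<Rightarrow> instr list \<Rightarrow> bool" where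
  "slp_wf m [] \<longleftrightarrow> True"
| "slp_wf m (i # is) \<longleftrightarrow> refs i \<subseteq> {..<m} \<and> slp_wf (Suc m) is"

primrec slp_run :: "rat list \<Rightarrow> instr list \<Rightarrow> rat list" where
  "slp_run vs [] = vs"
| "slp_run vs (i # is) = slp_run (vs @ [instr_val vs i]) is"

definition row_major :: "nat \<Rightarrow> rat mat \<Rightarrow> rat list" where
  "row_major n A = map (\<lambda>l. A $$ (l div n, l mod n)) [0..<n * n]"

text \<open>\<open>out ! (i * n + j)\<close> is the cell that holds entry \<open>(i, j)\<close> of the product.\<close>

definition slp_multiplies :: "nat \<Rightarrow> instr list \<Rightarrow> nat list \<Rightarrow> bool" where
  "slp_multiplies n is out \<longleftrightarrow>
     slp_wf (2 * n * n) is \<and> length out = n * n \<and> (\<forall>x\<in>set out. x < 2 * n * n + length is) \<and>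
     (\<forall>A\<in>carrier_mat n n. \<forall>B\<in>carrier_mat n n. \<forall>i<n. \<forall>j<n.
        slp_run (row_major n A @ row_major n B) is ! (out ! (i * n + j)) = (A * B) $$ (i, j))"

text \<open>Representation of a straight-line program in memory, with constants drawn from the list \<open>cs\<close>.\<close>

fun instr_code :: "rat list \<Rightarrow> instr \<Rightarrow> nat \<times> nat \<times> nat \<Rightarrow> bool" where
  "instr_code cs (Const r) (p, x, y) \<longleftrightarrow> p = 0 \<and> x < length cs \<and> r = cs ! x"
| "instr_code cs (Add u v) (p, x, y) \<longleftrightarrow> p = 1 \<and> x = u \<and> y = v"
| "instr_code cs (Sub u v) (p, x, y) \<longleftrightarrow> p = 2 \<and> x = u \<and> y = v"
| "instr_code cs (Mul u v) (p, x, y) \<longleftrightarrow> p = 3 \<and> x = u \<and> y = v"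

definition slp_stored :: "rat list \<Rightarrow> memory \<Rightarrow> instr list \<Rightarrow> nat list \<Rightarrow> bool" where
  "slp_stored cs s is out \<longleftrightarrow>
     s 1 0 = length is \<and>
     (\<forall>l<length is. instr_code cs (is ! l) (s 2 l, s 3 l, s 4 l)) \<and>
     (\<forall>l<length out. s 5 l = out ! l)"

definition size_input :: "nat \<Rightarrow> memory" where
  "size_input n = (\<lambda>a i. if a = 0 \<and> i = 0 then n else 0)"

text \<open>
  \<open>\<omega>\<close> is admissible if there is an algorithm that multiplies \<open>n \<times> n\<close> matrices in \<open>O(n\<^sup>\<omega>)\<close>
  arithmetic operations. Being an algorithm means that one finite program, with one finite list of
  constants, serves all \<open>n\<close>: it lists the arithmetic operations to be performed, in \<open>O(n\<^sup>\<omega>)\<close> steps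
  on words of \<open>O(log n)\<close> bits. The exponent of matrix multiplication is the infimum of the admissible
  \<open>\<omega>\<close>, by the usual convention treated as being itself admissible.
\<close>

definition admissible_matmul_exponent :: "real \<Rightarrow> bool" where
  "admissible_matmul_exponent \<omega> \<longleftrightarrow>
     (\<exists>(P :: com) (cs :: rat list) (b :: nat) (T :: nat \<Rightarrow> real).
        T \<in> O(\<lambda>n. real n powr \<omega>) \<and>
        (\<forall>n. \<exists>is out t s.
           slp_multiplies n is out \<and> real (length is) \<le> T n \<and>
           exec ((n + 2) ^ b) P (size_input n) t s \<and> real t \<le> T n \<and>
           slp_stored cs s is out))"


section \<open>Input and output of the search problem\<close>

text \<open>
  \<open>vs\<close> numbers the vertices and \<open>code\<close> names the colours by numbers. Array 0 holds the number \<open>n\<close>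
  of vertices, array 1 the adjacency matrix and array 2 the colours of the edges, both in row-major
  order; all other cells are 0.
\<close>

definition graph_input ::
    "'v list \<Rightarrow> ('c \<Rightarrow> nat) \<Rightarrow> 'v graph \<Rightarrow> ('v set \<Rightarrow> 'c) \<Rightarrow> memory" where
  "graph_input vs code G c = (\<lambda>a i.
     let n = length vs; e = {vs ! (i div n), vs ! (i mod n)} in
     if a = 0 \<and> i = 0 then n
     else if a = 1 \<and> i < n * n \<and> e \<in> edges G then 1
     else if a = 2 \<and> i < n * n \<and> e \<in> edges G then code (c e)
     else 0)"

text \<open>
  Cell 0 of array 3 tells whether a rainbow \<open>H\<close>-subgraph exists. If so, array 4 describes one of
  them by an isomorphism from \<open>H\<close>: the vertex \<open>hs ! i\<close> corresponds to the vertex of \<open>G\<close> whose number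
  is in cell \<open>i\<close>.
\<close>

definition finds_rainbow_H_subgraph ::
    "'h graph \<Rightarrow> 'h list \<Rightarrow> 'v graph \<Rightarrow> ('v set \<Rightarrow> 'c) \<Rightarrow> 'v list \<Rightarrow> memory \<Rightarrow> bool" where
  "finds_rainbow_H_subgraph H hs G c vs s \<longleftrightarrow>
     (if \<exists>S. H_subgraph H G S \<and> rainbow c S
      then s 3 0 = 1 \<and>
        (\<exists>S f. H_subgraph H G S \<and> rainbow c S \<and> graph_iso f H S \<and>
           (\<forall>i<length hs. s 4 i < length vs \<and> f (hs ! i) = vs ! (s 4 i)))
      else s 3 0 = 0)"

end

theory Submission
  imports Defs
begin

text \<open>
  A map \<open>\<phi>\<close> from the vertices of \<open>H\<close> to those of \<open>G\<close> gets the weight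
  \<open>\<Prod>\<^sub>u\<^sub><\<^sub>v \<bar>\<phi> u - \<phi> v\<bar>\<close> times \<open>\<Prod>\<^sub>u\<^sub>v adj (\<phi> u) (\<phi> v)\<close> times \<open>\<Prod> (c e - c e')\<^sup>2\<close>, the last product
  over the pairs of edges of \<open>H\<close>. It is nonnegative, and nonzero iff \<open>\<phi>\<close> is a rainbow copy of \<open>H\<close>.
  Expanding the squares gives a constant number of monomials, each of which is a product of functions
  of two vertices. Fix the images of \<open>j\<close> vertices and split the others into blocks \<open>A\<close>, \<open>B\<close>, \<open>C\<close>
  of size \<open>k\<close>: for one monomial, the sum over the images of \<open>B\<close> is an entry of a product of two
  matrices of size \<open>N = n\<^sup>k\<close>. Adding up the monomials there is no cancellation between different
  \<open>\<phi>\<close>, so the total for \<open>A\<close> and \<open>C\<close> is nonzero iff some image of \<open>B\<close> completes a rainbow copy, which is then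
  found by trying all of them.

  The straight-line program for matrix multiplication is evaluated modulo \<open>M = D X + 1\<close>, where \<open>D\<close> is a
  common denominator of its constants (so that \<open>D\<close> is invertible, with inverse \<open>M - X\<close>) and \<open>X\<close> bounds the
  totals. As the program that lists the operations has to write \<open>N\<^sup>2 - 1\<close> nonzero cells, \<open>N\<^sup>2\<close> is
  within the time bound for matrix multiplication.
\<close>

text \<open>The obstacle is size. Rational cells of a straight-line program can outgrow every word
  although its inputs and outputs are small integers, so it is run in the image of Z[1/D] modulo
  \<open>M\<close>. Of all its cells only the integral ones, such as the product entries, are
  determined modulo \<open>M\<close> by their residues. A single monomial may contribute a negative
  sum; the completed sum over all monomials lies between 0 and \<open>M - 1\<close> and can be read
  off. Nonnegativity of the weight is thus used twice. The modulus has to exceed the totals and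
  hence depends on the largest colour, but the program is not told the bound \<open>m\<close>. It
  computes the maximum itself, reading n^(j + 2k) cells instead of n^2: for a pattern with at most
  one vertex n^2 would exceed the time bound, and for a pattern with an edge n^(j + 2k) is at least
  n^2. Expressions depend on H and on the constants of the multiplication program only, so each is
  evaluated in one step, and every number is bounded by a fixed power of m + 2.\<close>

text \<open>Keeps the literal cost \<open>1\<close> in the rules of \<^const>\<open>exec\<close> from being rewritten to \<open>Suc 0\<close>.\<close>

declare One_nat_def [simp del]

section \<open>The word RAM\<close>

lemma fits_mono: "fits W e s \<Longrightarrow> W \<le> W' \<Longrightarrow> fits W' e s"
  by (induction e) auto

lemma exec_mono: "exec W c s t s' \<Longrightarrow> W \<le> W' \<Longrightarrow> exec W' c s t s'"
  by (induction rule: exec.induct) (use exec.intros fits_mono in \<open>metis+\<close>)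

lemma fits_imp_val_le: "fits W e s \<Longrightarrow> val e s \<le> W"
proof (induction e)
  case (Div e1 e2)
  then show ?case using le_trans[OF div_le_dividend, of "val e1 s" W "val e2 s"] by simp
next
  case (Mod e1 e2)
  then show ?case using le_trans[OF mod_less_eq_dividend, of "val e1 s" W "val e2 s"] by simp
qed auto

lemma exec_bounded:
  "exec W c s t s' \<Longrightarrow> \<forall>a i. s a i \<le> W \<Longrightarrow> \<forall>a i. s' a i \<le> W"
  by (induction rule: exec.induct) (auto simp: fits_imp_val_le)

section \<open>Counting the cells that a run changes\<close>

definition changed :: "memory \<Rightarrow> memory \<Rightarrow> (nat \<times> nat) set" where
  "changed s s' = {(a, i). s' a i \<noteq> s a i}"

lemma changed_trans: "changed s s'' \<subseteq> changed s s' \<union> changed s' s''"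
  by (auto simp: changed_def)

text \<open>Only assignments write, one cell per step. This turns an amount of output into a lower
  bound on the time.\<close>

lemma exec_changed:
  "exec W c s t s' \<Longrightarrow> finite (changed s s') \<and> card (changed s s') \<le> t"
proof (induction rule: exec.induct)
  case (Assign e s f a)
  have *: "changed s (s(a := (s a)(val e s := val f s))) \<subseteq> {(a, val e s)}"
    by (auto simp: changed_def split: if_splits)
  then show ?case
    using card_mono[OF _ *] finite_subset[OF *] by (simp add: fun_upd_def One_nat_def)
next
  case (Seq c s t s' d u s'')
  then have "finite (changed s s' \<union> changed s' s'')"
    "card (changed s s' \<union> changed s' s'') \<le> t + u"
    using card_Un_le[of "changed s s'" "changed s' s''"] by auto
  then show ?case
    using changed_trans[of s s'' s'] by (meson card_mono finite_subset le_trans)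
next
  case (While_True e s c t s' u s'')
  then have "finite (changed s s' \<union> changed s' s'')"
    "card (changed s s' \<union> changed s' s'') \<le> 1 + t + u"
    using card_Un_le[of "changed s s'" "changed s' s''"] by auto
  then show ?case
    using changed_trans[of s s'' s'] by (meson card_mono finite_subset le_trans)
qed (auto simp: changed_def)

section \<open>Relocating a program to other arrays\<close>

primrec shift_expr :: "nat \<Rightarrow> expr \<Rightarrow> expr" where
  "shift_expr K (Num k) = Num k"
| "shift_expr K (Get a e) = Get (K + a) (shift_expr K e)"
| "shift_expr K (Plus e f) = Plus (shift_expr K e) (shift_expr K f)"
| "shift_expr K (Minus e f) = Minus (shift_expr K e) (shift_expr K f)"
| "shift_expr K (Times e f) = Times (shift_expr K e) (shift_expr K f)"
| "shift_expr K (Div e f) = Div (shift_expr K e) (shift_expr K f)"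
| "shift_expr K (Mod e f) = Mod (shift_expr K e) (shift_expr K f)"

primrec shift_com :: "nat \<Rightarrow> com \<Rightarrow> com" where
  "shift_com K Skip = Skip"
| "shift_com K (Assign a e f) = Assign (K + a) (shift_expr K e) (shift_expr K f)"
| "shift_com K (Seq c d) = Seq (shift_com K c) (shift_com K d)"
| "shift_com K (If e c d) = If (shift_expr K e) (shift_com K c) (shift_com K d)"
| "shift_com K (While e c) = While (shift_expr K e) (shift_com K c)"

lemma val_shift: "(\<And>a. m (K + a) = s a) \<Longrightarrow> val (shift_expr K e) m = val e s"
  by (induction e) auto

lemma fits_shift: "(\<And>a. m (K + a) = s a) \<Longrightarrow> fits W (shift_expr K e) m = fits W e s"
  by (induction e) (auto simp: val_shift)

text \<open>The program that lists the straight-line program expects a memory with nothing but the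
  matrix size in it. Moved up by \<open>K\<close> arrays it finds such a memory there, while the
  data of the search below \<open>K\<close> survive.\<close>

lemma exec_shift:
  "exec W c s t s' \<Longrightarrow> (\<And>a. m (K + a) = s a) \<Longrightarrow>
    \<exists>m'. exec W (shift_com K c) m t m' \<and> (\<forall>a. m' (K + a) = s' a) \<and> (\<forall>a<K. m' a = m a)"
proof (induction arbitrary: m rule: exec.induct)
  case (Skip s)
  then show ?case by (auto intro: exec.Skip)
next
  case (Assign e s f a)
  then show ?case
    by (intro exI[of _ "m(K + a := (m (K + a))(val e s := val f s))"])
      (use exec.Assign[of W "shift_expr K e" m "shift_expr K f" "K + a"]
       in \<open>auto simp: val_shift[of m K s] fits_shift[of m K s] fun_upd_def\<close>)
next
  case (Seq c s t s' d u s'')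
  obtain m' where m': "exec W (shift_com K c) m t m'" "\<forall>a. m' (K + a) = s' a" "\<forall>a<K. m' a = m a"
    using Seq.IH(1)[OF Seq.prems] by auto
  obtain m'' where m'': "exec W (shift_com K d) m' u m''"
    "\<forall>a. m'' (K + a) = s'' a" "\<forall>a<K. m'' a = m' a"
    using Seq.IH(2)[of m'] m'(2) by auto
  show ?case
    by (rule exI[of _ m'']) (use m' m'' in \<open>auto intro: exec.Seq\<close>)
next
  case (If_True e s c t s' d)
  then obtain m' where "exec W (shift_com K c) m t m'"
    "\<forall>a. m' (K + a) = s' a" "\<forall>a<K. m' a = m a" by metis
  then show ?case
    using If_True(1,2,5) by (auto intro!: exI[of _ m'] exec.If_True simp: val_shift[of m K s] fits_shift[of m K s])
next
  case (If_False e s d t s' c)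
  then obtain m' where "exec W (shift_com K d) m t m'"
    "\<forall>a. m' (K + a) = s' a" "\<forall>a<K. m' a = m a" by metis
  then show ?case
    using If_False(1,2,5) by (auto intro!: exI[of _ m'] exec.If_False simp: val_shift[of m K s] fits_shift[of m K s])
next
  case (While_False e s c)
  then show ?case
    by (auto intro!: exI[of _ m] exec.While_False simp: val_shift[of m K s] fits_shift[of m K s])
next
  case (While_True e s c t s' u s'')
  obtain m' where m': "exec W (shift_com K c) m t m'" "\<forall>a. m' (K + a) = s' a" "\<forall>a<K. m' a = m a"
    using While_True.IH(1)[OF While_True.prems] by auto
  obtain m'' where m'': "exec W (shift_com K (While e c)) m' u m''"
    "\<forall>a. m'' (K + a) = s'' a" "\<forall>a<K. m'' a = m' a"
    using While_True.IH(2)[of m'] m'(2) by auto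
  show ?case
    apply (rule exI[of _ m''])
    using m' m'' While_True(1,2) While_True.prems
    by (auto intro!: exec.While_True simp: val_shift[of m K s] fits_shift[of m K s])
qed

section \<open>Hoare logic for total correctness with a step bound\<close>

definition triple :: "nat \<Rightarrow> (memory \<Rightarrow> bool) \<Rightarrow> com \<Rightarrow> nat \<Rightarrow> (memory \<Rightarrow> bool) \<Rightarrow> bool" where
  "triple W P c t Q \<longleftrightarrow> (\<forall>s. P s \<longrightarrow> (\<exists>t' s'. t' \<le> t \<and> exec W c s t' s' \<and> Q s'))"

lemma triple_conseq:
  assumes "triple W P c t Q" and "\<And>s. P' s \<Longrightarrow> P s" and "\<And>s. Q s \<Longrightarrow> Q' s" and "t \<le> t'"
  shows "triple W P' c t' Q'"
  using assms unfolding triple_def by (meson le_trans)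

lemma triple_Skip: "(\<And>s. P s \<Longrightarrow> Q s) \<Longrightarrow> triple W P Skip 1 Q"
  unfolding triple_def by (auto intro: exec.Skip)

lemma triple_Assign:
  assumes "\<And>s. P s \<Longrightarrow> fits W e s \<and> fits W f s \<and> Q (s(a := (s a)(val e s := val f s)))"
  shows "triple W P (Assign a e f) 1 Q"
  unfolding triple_def using assms by (meson exec.Assign order_refl)

lemma triple_Seq:
  assumes "triple W P c t Q" and "triple W Q d u R"
  shows "triple W P (Seq c d) (t + u) R"
  unfolding triple_def
proof (intro allI impI)
  fix s assume "P s"
  then obtain t' s' where 1: "t' \<le> t" "exec W c s t' s'" "Q s'"
    using assms(1) unfolding triple_def by blast
  then obtain u' s'' where 2: "u' \<le> u" "exec W d s' u' s''" "R s''"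
    using assms(2) unfolding triple_def by blast
  show "\<exists>t' s'. t' \<le> t + u \<and> exec W (Seq c d) s t' s' \<and> R s'"
    using exec.Seq[OF 1(2) 2(2)] 1(1) 2(1,3) add_mono by blast
qed

lemma triple_If:
  assumes "\<And>s. P s \<Longrightarrow> fits W e s"
    and "triple W (\<lambda>s. P s \<and> val e s \<noteq> 0) c t Q" and "triple W (\<lambda>s. P s \<and> val e s = 0) d t Q"
  shows "triple W P (If e c d) (Suc t) Q"
  unfolding triple_def
proof (intro allI impI)
  fix s assume s: "P s"
  show "\<exists>t' s'. t' \<le> Suc t \<and> exec W (If e c d) s t' s' \<and> Q s'"
  proof (cases "val e s = 0")
    case True
    then obtain t' s' where "t' \<le> t" "exec W d s t' s'" "Q s'"
      using assms(3) s unfolding triple_def by blast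
    then show ?thesis
      using exec.If_False[OF assms(1)[OF s] True, of d t' s' c]
      by (intro exI[of _ "1 + t'"] exI[of _ s']) auto
  next
    case False
    then obtain t' s' where "t' \<le> t" "exec W c s t' s'" "Q s'"
      using assms(2) s unfolding triple_def by blast
    then show ?thesis
      using exec.If_True[OF assms(1)[OF s] False, of c t' s' d]
      by (intro exI[of _ "1 + t'"] exI[of _ s']) auto
  qed
qed

lemma triple_ex: "(\<And>x. triple W (P x) c t Q) \<Longrightarrow> triple W (\<lambda>s. \<exists>x. P x s) c t Q"
  unfolding triple_def by blast

lemma triple_time: "triple W P c t Q \<Longrightarrow> t \<le> t' \<Longrightarrow> triple W P c t' Q"
  unfolding triple_def by (meson le_trans)

text \<open>For tests that the precondition decides, such as an opcode test on a known instruction: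
  the other branch needs no triple.\<close>

lemma triple_If_nonzero:
  assumes "triple W P c t Q" and "\<And>s. P s \<Longrightarrow> fits W e s \<and> val e s \<noteq> 0"
  shows "triple W P (If e c d) (Suc t) Q"
  unfolding triple_def
proof (intro allI impI)
  fix s assume P: "P s"
  then obtain t' s' where "t' \<le> t" "exec W c s t' s'" "Q s'"
    using assms(1) unfolding triple_def by blast
  then show "\<exists>t' s'. t' \<le> Suc t \<and> exec W (If e c d) s t' s' \<and> Q s'"
    using assms(2)[OF P] exec.If_True[of W e s c t' s' d]
    by (intro exI[of _ "1 + t'"] exI[of _ s']) auto
qed

lemma triple_If_zero:
  assumes "triple W P d t Q" and "\<And>s. P s \<Longrightarrow> fits W e s \<and> val e s = 0"
  shows "triple W P (If e c d) (Suc t) Q"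
  unfolding triple_def
proof (intro allI impI)
  fix s assume P: "P s"
  then obtain t' s' where "t' \<le> t" "exec W d s t' s'" "Q s'"
    using assms(1) unfolding triple_def by blast
  then show "\<exists>t' s'. t' \<le> Suc t \<and> exec W (If e c d) s t' s' \<and> Q s'"
    using assms(2)[OF P] exec.If_False[of W e s d t' s' c]
    by (intro exI[of _ "1 + t'"] exI[of _ s']) auto
qed

abbreviation reg :: "nat \<Rightarrow> expr" where
  "reg r \<equiv> Get r (Num 0)"

text \<open>Subtraction is truncated, so the test is nonzero exactly while the counter is below the
  bound.\<close>

definition For :: "nat \<Rightarrow> expr \<Rightarrow> com \<Rightarrow> com" where
  "For r e c = Seq (Assign r (Num 0) (Num 0))
     (While (Minus e (reg r)) (Seq c (Assign r (Num 0) (Plus (reg r) (Num 1)))))"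

text \<open>Test and increment account for the 2 added to \<open>t\<close>, the first assignment and
  the last test for the 2 in front. The body must restore the counter, and the invariant is demanded
  of the memory after the increment, which is the one the next round sees.\<close>

lemma triple_For:
  assumes init: "\<And>s. P s \<Longrightarrow> I 0 (s(r := (s r)(0 := 0)))"
    and bound: "\<And>i s. I i s \<Longrightarrow> i \<le> L \<Longrightarrow> s r 0 = i \<Longrightarrow> fits W e s \<and> val e s = L"
    and body: "\<And>i. i < L \<Longrightarrow> triple W (\<lambda>s. I i s \<and> s r 0 = i) c t
        (\<lambda>s. s r 0 = i \<and> I (Suc i) (s(r := (s r)(0 := Suc i))))"
    and fin: "\<And>s. I L s \<Longrightarrow> s r 0 = L \<Longrightarrow> Q s"
    and W: "Suc L \<le> W"
  shows "triple W P (For r e c) (2 + L * (t + 2)) Q"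
  unfolding triple_def
proof (intro allI impI)
  fix s assume s: "P s"
  let ?w = "While (Minus e (reg r)) (Seq c (Assign r (Num 0) (Plus (reg r) (Num 1))))"
  have loop: "\<exists>u s''. u \<le> 1 + (L - i) * (t + 2) \<and> exec W ?w s' u s'' \<and> Q s''"
    if "I i s'" "s' r 0 = i" "i \<le> L" for i s'
    using that
  proof (induction "L - i" arbitrary: i s')
    case 0
    then have "i = L" by simp
    with 0 have "exec W ?w s' 1 s'" and "Q s'"
      using exec.While_False[of W "Minus e (reg r)" s'] bound[of i s'] fin W by auto
    then show ?case by (meson le_add1)
  next
    case (Suc d)
    then have iL: "i < L" by simp
    obtain u' s1 where u': "u' \<le> t" "exec W c s' u' s1" "s1 r 0 = i"
      "I (Suc i) (s1(r := (s1 r)(0 := Suc i)))"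
      using body[OF iL] Suc.prems unfolding triple_def by blast
    let ?s2 = "s1(r := (s1 r)(0 := Suc i))"
    have ass: "exec W (Assign r (Num 0) (Plus (reg r) (Num 1))) s1 1 ?s2"
      using exec.Assign[of W "Num 0" s1 "Plus (reg r) (Num 1)" r] u'(3) iL W by (simp add: Suc_eq_plus1)
    have "\<exists>u s''. u \<le> 1 + (L - Suc i) * (t + 2) \<and> exec W ?w ?s2 u s'' \<and> Q s''"
      by (rule Suc.hyps(1)) (use u'(4) Suc.hyps(2) iL in auto)
    then obtain u s'' where u: "u \<le> 1 + (L - Suc i) * (t + 2)" "exec W ?w ?s2 u s''" "Q s''"
      by blast
    have "exec W ?w s' (1 + (u' + 1) + u) s''"
      using bound[of i s'] Suc.prems iL W
      by (intro exec.While_True[OF _ _ exec.Seq[OF u'(2) ass] u(2)]) auto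
    moreover have "1 + (u' + 1) + u \<le> 1 + (L - i) * (t + 2)"
    proof -
      have "L - i = Suc (L - Suc i)" using iL by simp
      then show ?thesis using u u'(1) by simp
    qed
    ultimately show ?case using u(3) by blast
  qed
  let ?s0 = "s(r := (s r)(0 := 0))"
  obtain u s'' where u: "u \<le> 1 + L * (t + 2)" "exec W ?w ?s0 u s''" "Q s''"
    using loop[of 0 ?s0] init[OF s] by auto
  have "exec W (Assign r (Num 0) (Num 0)) s 1 ?s0"
    using exec.Assign[of W "Num 0" s "Num 0" r] by simp
  then have "exec W (For r e c) s (1 + u) s''"
    unfolding For_def by (rule exec.Seq) (rule u(2))
  then show "\<exists>t' s'. t' \<le> 2 + L * (t + 2) \<and> exec W (For r e c) s t' s' \<and> Q s'"
    using u by (intro exI[of _ "1 + u"] exI[of _ s'']) auto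
qed

section \<open>Powers and products as expressions\<close>

primrec epow :: "expr \<Rightarrow> nat \<Rightarrow> expr" where
  "epow e 0 = Num 1"
| "epow e (Suc m) = Times e (epow e m)"

primrec eprod :: "expr list \<Rightarrow> expr" where
  "eprod [] = Num 1"
| "eprod (e # es) = Times e (eprod es)"

lemma val_epow [simp]: "val (epow e m) s = val e s ^ m"
  by (induction m) auto

lemma val_eprod [simp]: "val (eprod es) s = (\<Prod>e\<leftarrow>es. val e s)"
  by (induction es) auto

text \<open>As \<open>1 \<le> B\<close>, the powers of \<open>B\<close> increase, and a bound on the
  last intermediate product bounds all of them.\<close>

lemma fits_epow:
  assumes "fits W e s" and "val e s \<le> B" and "B ^ m \<le> W" and "1 \<le> B"
  shows "fits W (epow e m) s"
proof -
  have "fits W (epow e l) s" if "l \<le> m" for l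
    using that
  proof (induction l)
    case 0
    have "1 \<le> B ^ m" using assms(4) by (rule one_le_power)
    then have "1 \<le> W" using assms(3) by linarith
    then show ?case by simp
  next
    case (Suc l)
    have "val e s ^ Suc l \<le> B ^ Suc l" using assms power_mono by blast
    also have "\<dots> \<le> B ^ m" using Suc assms by (intro power_increasing) auto
    finally show ?case using Suc assms by auto
  qed
  then show ?thesis by simp
qed

lemma prod_list_le_power:
  fixes f :: "'a \<Rightarrow> nat"
  shows "(\<And>x. x \<in> set xs \<Longrightarrow> f x \<le> B) \<Longrightarrow> (\<Prod>x\<leftarrow>xs. f x) \<le> B ^ length xs"
  by (induction xs) (auto intro: mult_le_mono)

lemma fits_eprod:
  assumes "\<And>e. e \<in> set es \<Longrightarrow> fits W e s \<and> val e s \<le> B" and "B ^ length es \<le> W" and "1 \<le> B"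
  shows "fits W (eprod es) s"
  using assms
proof (induction es)
  case (Cons e es)
  have "B ^ length es \<le> B ^ length (e # es)" using Cons.prems(3) by (simp add: power_increasing)
  then have "fits W (eprod es) s" using Cons by (meson le_trans list.set_intros(2))
  moreover have "(\<Prod>x\<leftarrow>e # es. val x s) \<le> B ^ length (e # es)"
    using Cons.prems(1) by (intro prod_list_le_power) auto
  ultimately show ?case using Cons.prems(1)[of e] Cons.prems(2) by auto
qed simp

primrec seqs :: "com list \<Rightarrow> com" where
  "seqs [] = Skip"
| "seqs (c # cs) = Seq c (seqs cs)"

lemma triple_seqs:
  assumes "\<And>i. i < length cs \<Longrightarrow> triple W (I i) (cs ! i) t (I (Suc i))"
  shows "triple W (I 0) (seqs cs) (length cs * t + 1) (I (length cs))"
  using assms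
proof (induction cs arbitrary: I)
  case Nil
  then show ?case using triple_Skip[of "I 0" "I 0" W] by simp
next
  case (Cons c cs)
  have "triple W (I 0) c t (I (Suc 0))" using Cons.prems[of 0] by simp
  moreover have "triple W (I (Suc 0)) (seqs cs) (length cs * t + 1) (I (Suc (length cs)))"
    using Cons.IH[of "\<lambda>i. I (Suc i)"] Cons.prems by fastforce
  ultimately have "triple W (I 0) (Seq c (seqs cs)) (t + (length cs * t + 1)) (I (Suc (length cs)))"
    by (intro triple_Seq) auto
  moreover have "t + (length cs * t + 1) = length (c # cs) * t + 1" by simp
  ultimately show ?case by (simp only: seqs.simps length_Cons)
qed

section \<open>Straight-line programs modulo M\<close>

lemma slp_run_append: "\<exists>ws. slp_run vs is = vs @ ws \<and> length ws = length is"
proof (induction "is" arbitrary: vs)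
  case (Cons i "is")
  obtain ws where "slp_run (vs @ [instr_val vs i]) is = (vs @ [instr_val vs i]) @ ws"
    "length ws = length is"
    using Cons.IH by blast
  then show ?case by (intro exI[of _ "instr_val vs i # ws"]) auto
qed simp

lemma length_slp_run [simp]: "length (slp_run vs is) = length vs + length is"
  using slp_run_append[of vs "is"] by auto

lemma slp_run_nth: "l < length vs \<Longrightarrow> slp_run vs is ! l = vs ! l"
  using slp_run_append[of vs "is"] by (auto simp: nth_append)

lemma instr_val_cong:
  "(\<And>x. x \<in> refs i \<Longrightarrow> vs ! x = ws ! x) \<Longrightarrow> instr_val vs i = instr_val ws i"
  by (cases i) auto

text \<open>Cells are appended and never overwritten, so an instruction may be evaluated in the
  finished list instead of in the prefix known at its time. A simulation can therefore be compared
  with one fixed list.\<close>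

lemma slp_run_step:
  assumes "slp_wf (length vs) is" and "l < length is"
  shows "refs (is ! l) \<subseteq> {..<length vs + l} \<and>
    slp_run vs is ! (length vs + l) = instr_val (slp_run vs is) (is ! l)"
  using assms
proof (induction "is" arbitrary: vs l)
  case (Cons i "is")
  let ?vs = "vs @ [instr_val vs i]"
  show ?case
  proof (cases l)
    case 0
    have "slp_run ?vs is ! length vs = instr_val vs i"
      by (simp add: slp_run_nth)
    also have "\<dots> = instr_val (slp_run ?vs is) i"
      using Cons.prems by (intro instr_val_cong) (auto simp: slp_run_nth nth_append)
    finally show ?thesis using 0 Cons.prems by auto
  next
    case (Suc l')
    then show ?thesis using Cons.IH[of ?vs l'] Cons.prems by auto
  qed
qed simp

text \<open>
  \<open>w\<close> is the image of \<open>v\<close> under the ring homomorphism from the rationals whose denominator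
  divides a power of \<open>D\<close> to the residues modulo \<open>M\<close>.
\<close>

definition residue_of :: "int \<Rightarrow> int \<Rightarrow> rat \<Rightarrow> int \<Rightarrow> bool" where
  "residue_of D M v w \<longleftrightarrow> (\<exists>e a. v * of_int D ^ e = of_int a \<and> M dvd w * D ^ e - a)"

lemma residue_of_int: "residue_of D M (of_int a) a"
  unfolding residue_of_def by (intro exI[of _ 0] exI[of _ a]) simp

lemma residue_of_cong:
  assumes "residue_of D M v w" and "M dvd w' - w"
  shows "residue_of D M v w'"
proof -
  obtain e a where "v * of_int D ^ e = of_int a" and *: "M dvd w * D ^ e - a"
    using assms unfolding residue_of_def by blast
  moreover have "M dvd (w' - w) * D ^ e + (w * D ^ e - a)"
    using assms(2) * by (intro dvd_add) auto
  then have "M dvd w' * D ^ e - a" by (simp add: algebra_simps)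
  ultimately show ?thesis unfolding residue_of_def by blast
qed

lemma residue_of_add:
  assumes "residue_of D M v w" and "residue_of D M v' w'"
  shows "residue_of D M (v + v') (w + w')"
proof -
  obtain e a where 1: "v * of_int D ^ e = of_int a" "M dvd w * D ^ e - a"
    using assms(1) unfolding residue_of_def by blast
  obtain e' a' where 2: "v' * of_int D ^ e' = of_int a'" "M dvd w' * D ^ e' - a'"
    using assms(2) unfolding residue_of_def by blast
  have "(v + v') * of_int D ^ (e + e')
      = (v * of_int D ^ e) * of_int D ^ e' + (v' * of_int D ^ e') * of_int D ^ e"
    by (simp add: power_add algebra_simps)
  then have "(v + v') * of_int D ^ (e + e') = of_int (a * D ^ e' + a' * D ^ e)"
    using 1 2 by simp
  moreover have "M dvd (w * D ^ e - a) * D ^ e' + (w' * D ^ e' - a') * D ^ e"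
    using 1 2 by (intro dvd_add) auto
  then have "M dvd (w + w') * D ^ (e + e') - (a * D ^ e' + a' * D ^ e)"
    by (simp add: power_add algebra_simps)
  ultimately show ?thesis unfolding residue_of_def by blast
qed

lemma residue_of_mult:
  assumes "residue_of D M v w" and "residue_of D M v' w'"
  shows "residue_of D M (v * v') (w * w')"
proof -
  obtain e a where 1: "v * of_int D ^ e = of_int a" "M dvd w * D ^ e - a"
    using assms(1) unfolding residue_of_def by blast
  obtain e' a' where 2: "v' * of_int D ^ e' = of_int a'" "M dvd w' * D ^ e' - a'"
    using assms(2) unfolding residue_of_def by blast
  have "(v * v') * of_int D ^ (e + e') = (v * of_int D ^ e) * (v' * of_int D ^ e')"
    by (simp add: power_add algebra_simps)
  then have "(v * v') * of_int D ^ (e + e') = of_int (a * a')"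
    using 1 2 by simp
  moreover have "M dvd (w * D ^ e - a) * (w' * D ^ e') + (w' * D ^ e' - a') * a"
    using 1 2 by (intro dvd_add) auto
  then have "M dvd (w * w') * D ^ (e + e') - a * a'"
    by (simp add: power_add algebra_simps)
  ultimately show ?thesis unfolding residue_of_def by blast
qed

lemma residue_of_diff:
  assumes "residue_of D M v w" and "residue_of D M v' w'"
  shows "residue_of D M (v - v') (w - w')"
  using residue_of_add[OF assms(1) residue_of_mult[OF residue_of_int[of D M "-1"] assms(2)]] by simp

text \<open>A power of \<open>D\<close> can be cancelled modulo \<open>M\<close>. Intermediate cells
  may be proper fractions, but an integral result is recovered modulo \<open>M\<close>.\<close>

lemma residue_of_integer:
  assumes "residue_of D M (of_int b) w" and "coprime D M"
  shows "M dvd w - b"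
proof -
  obtain e a where 1: "(of_int b :: rat) * of_int D ^ e = of_int a" "M dvd w * D ^ e - a"
    using assms(1) unfolding residue_of_def by blast
  from 1(1) have "of_int (b * D ^ e) = (of_int a :: rat)" by simp
  then have "a = b * D ^ e" using of_int_eq_iff by metis
  then have "M dvd (w - b) * D ^ e" using 1(2) by (simp add: algebra_simps)
  then show ?thesis using assms(2)
    by (simp add: coprime_commute coprime_dvd_mult_left_iff)
qed

section \<open>Residues of the constants\<close>

definition common_denom :: "rat list \<Rightarrow> nat" where
  "common_denom cs = (\<Prod>r\<leftarrow>cs. nat (snd (quotient_of r)))"

lemma common_denom_pos: "common_denom cs > 0"
  unfolding common_denom_def
  by (induction cs) (auto simp: quotient_of_denom_pos')

lemma common_denom: "r \<in> set cs \<Longrightarrow> \<exists>a::int. r * of_nat (common_denom cs) = of_int a"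
proof (induction cs)
  case (Cons r' cs)
  let ?d = "snd (quotient_of r')"
  have d: "?d > 0" by (rule quotient_of_denom_pos')
  have eq: "common_denom (r' # cs) = nat ?d * common_denom cs"
    by (simp add: common_denom_def)
  show ?case
  proof (cases "r = r'")
    case True
    have "r' = of_int (fst (quotient_of r')) / of_int ?d"
      using quotient_of_div[of r' "fst (quotient_of r')" ?d] by simp
    moreover have "(of_int ?d :: rat) \<noteq> 0" using d by simp
    ultimately have "r' * of_int ?d = of_int (fst (quotient_of r'))"
      by (metis nonzero_eq_divide_eq)
    then have "r * of_nat (common_denom (r' # cs)) = of_int (fst (quotient_of r') * int (common_denom cs))"
      using d True unfolding eq by (simp flip: mult.assoc)
    then show ?thesis by blast
  next
    case False
    then obtain a where "r * of_nat (common_denom cs) = of_int a" using Cons by auto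
    then have "r * of_nat (common_denom (r' # cs)) = of_int (?d * a)"
      using d unfolding eq by (simp add: algebra_simps)
    then show ?thesis by blast
  qed
qed simp

text \<open>Here r = a / D, and D * (-X) = 1 - M shows that -X is inverse to \<open>D\<close>; so
  -aX is a residue of \<open>r\<close>.\<close>

lemma residue_of_const:
  assumes "r * of_int D = of_int a" and "M = D * X + 1" and "M dvd w + a * X"
  shows "residue_of D M r w"
proof -
  have "M dvd (w + a * X) * D - a * M" using assms(3) by auto
  then have "M dvd w * D - a" unfolding assms(2) by (simp add: algebra_simps)
  then show ?thesis unfolding residue_of_def
    using assms(1) by (intro exI[of _ 1] exI[of _ a]) simp
qed

section \<open>Expansion of a product of squared differences\<close>

type_synonym 'e monomial = "bool \<times> ('e \<Rightarrow> nat)"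

definition monomial_val :: "'e set \<Rightarrow> ('e \<Rightarrow> int) \<Rightarrow> 'e monomial \<Rightarrow> int" where
  "monomial_val E x = (\<lambda>(sg, ex). (if sg then 1 else - 1) * (\<Prod>e\<in>E. x e ^ ex e))"

definition times_var :: "'e \<Rightarrow> ('e \<Rightarrow> nat) \<Rightarrow> 'e \<Rightarrow> nat" where
  "times_var e ex = ex(e := Suc (ex e))"

text \<open>A monomial carries only a sign, so the mixed term of (x - y)^2 = x^2 + y^2 - xy - xy is
  listed twice. Each pair multiplies the number of monomials by 4.\<close>

primrec square_diffs :: "('e \<times> 'e) list \<Rightarrow> 'e monomial list" where
  "square_diffs [] = [(True, \<lambda>_. 0)]"
| "square_diffs (d # ds) = concat (map (\<lambda>(sg, ex). let e = fst d; e' = snd d in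
     [(sg, times_var e (times_var e ex)), (sg, times_var e' (times_var e' ex)),
      (\<not> sg, times_var e (times_var e' ex)), (\<not> sg, times_var e (times_var e' ex))])
     (square_diffs ds))"

lemma prod_times_var:
  "finite E \<Longrightarrow> e \<in> E \<Longrightarrow> (\<Prod>f\<in>E. (x f :: int) ^ times_var e ex f) = x e * (\<Prod>f\<in>E. x f ^ ex f)"
  by (simp add: prod.remove[of E e] times_var_def)

lemma square_diffs:
  assumes "finite E" and "\<And>e e'. (e, e') \<in> set ds \<Longrightarrow> e \<in> E \<and> e' \<in> E"
  shows "(\<Sum>mo\<leftarrow>square_diffs ds. monomial_val E x mo) = (\<Prod>(e, e')\<leftarrow>ds. (x e - x e')\<^sup>2)"
  using assms(2)
proof (induction ds)
  case Nil
  then show ?case by (simp add: monomial_val_def)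
next
  case (Cons d ds)
  obtain e e' where d: "d = (e, e')" by fastforce
  have ee: "e \<in> E" "e' \<in> E" using Cons.prems d by auto
  have step: "(\<Sum>mo\<leftarrow>concat (map (\<lambda>(sg, ex). [(sg, times_var e (times_var e ex)),
      (sg, times_var e' (times_var e' ex)), (\<not> sg, times_var e (times_var e' ex)),
      (\<not> sg, times_var e (times_var e' ex))]) ml). monomial_val E x mo)
      = (x e - x e')\<^sup>2 * (\<Sum>mo\<leftarrow>ml. monomial_val E x mo)" for ml
  proof (induction ml)
    case (Cons mo ml)
    then show ?case
      by (cases mo) (auto simp: monomial_val_def prod_times_var[OF assms(1) ee(1)]
          prod_times_var[OF assms(1) ee(2)] power2_eq_square algebra_simps)
  qed simp
  have "(\<Sum>mo\<leftarrow>square_diffs ds. monomial_val E x mo) = (\<Prod>(e, e')\<leftarrow>ds. (x e - x e')\<^sup>2)"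
    using Cons by auto
  then show ?case using step[of "square_diffs ds"] d by (simp add: Let_def)
qed

section \<open>The weight of a vertex assignment\<close>

definition pairs :: "nat \<Rightarrow> (nat \<times> nat) list" where
  "pairs h = filter (\<lambda>(u, v). u < v) (List.product [0..<h] [0..<h])"

lemma set_pairs: "set (pairs h) = {(u, v). u < v \<and> v < h}"
  by (auto simp: pairs_def)

lemma length_pairs: "length (pairs h) \<le> h * h"
  unfolding pairs_def using length_filter_le[of _ "List.product [0..<h] [0..<h]"] by simp

lemma prod_square_diffs_nonzero:
  "(\<Prod>(e, e')\<leftarrow>ds. (int (f e) - int (f e'))\<^sup>2) \<noteq> 0 \<longleftrightarrow> (\<forall>(e, e')\<in>set ds. f e \<noteq> f e')"
  by (induction ds) auto

lemma prod_list_filter_split: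
  "(\<Prod>x\<leftarrow>xs. f x :: 'b::comm_monoid_mult) =
     (\<Prod>x\<leftarrow>filter P xs. f x) * (\<Prod>x\<leftarrow>filter (\<lambda>x. \<not> P x) xs. f x)"
  by (induction xs) (auto simp: ac_simps)

lemma digits_surj:
  "(\<forall>i<k. \<phi> i < (n::nat)) \<Longrightarrow> \<exists>a<n ^ k. \<forall>i<k. a div n ^ i mod n = \<phi> i"
proof (induction k)
  case (Suc k)
  then obtain a where a: "a < n ^ k" "\<forall>i<k. a div n ^ i mod n = \<phi> i" by auto
  have n: "\<phi> k < n" using Suc.prems by auto
  let ?a = "a + \<phi> k * n ^ k"
  have "?a < n ^ k + \<phi> k * n ^ k" using a by simp
  also have "\<dots> = Suc (\<phi> k) * n ^ k" by simp
  also have "\<dots> \<le> n * n ^ k" using n by (intro mult_right_mono) auto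
  finally have "?a < n ^ Suc k" by simp
  moreover have "?a div n ^ i mod n = \<phi> i" if "i < Suc k" for i
  proof (cases "i = k")
    case True
    then show ?thesis using a(1) n by simp
  next
    case False
    then have i: "i < k" using that by simp
    \<comment> \<open>The new top digit, divided by n^i, still has a factor \<open>n\<close> and
      vanishes modulo \<open>n\<close>.\<close>
    then obtain d where d: "k = i + Suc d" using less_imp_Suc_add by (metis add_Suc_right)
    have "\<phi> k * n ^ k = (\<phi> k * n ^ d * n) * n ^ i"
      unfolding d by (simp add: power_add algebra_simps)
    then have "?a div n ^ i = (a + (\<phi> k * n ^ d * n) * n ^ i) div n ^ i" by (simp only:)
    also have "\<dots> = \<phi> k * n ^ d * n + a div n ^ i"
      using n by (intro div_mult_self1) simp
    finally show ?thesis using a(2) i by simp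
  qed
  ultimately show ?case by blast
qed simp

locale pattern =
  fixes k j :: nat and EH :: "(nat \<times> nat) list"
  assumes EH_pairs: "set EH \<subseteq> set (pairs (3 * k + j))" and distinct_EH: "distinct EH"
begin

abbreviation h :: nat where "h \<equiv> 3 * k + j"

text \<open>Both orders of a pair are listed, so each difference enters the weight to the fourth
  power; only its sign and its vanishing matter.\<close>

definition edge_pairs :: "((nat \<times> nat) \<times> (nat \<times> nat)) list" where
  "edge_pairs = filter (\<lambda>(e, e'). e \<noteq> e') (List.product EH EH)"

definition monomials :: "(nat \<times> nat) monomial list" where
  "monomials = square_diffs edge_pairs"

definition in_B :: "nat \<Rightarrow> bool" where "in_B i \<longleftrightarrow> j + k \<le> i \<and> i < j + 2 * k"
definition in_C :: "nat \<Rightarrow> bool" where "in_C i \<longleftrightarrow> j + 2 * k \<le> i"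

text \<open>Since each matrix may depend on two of the blocks only, pairs between B and C form
  \<open>pairs_Y\<close>, all other pairs that meet B form \<open>pairs_X\<close>, and pairs that
  avoid B, including those between A and C, form \<open>pairs_Z\<close>. The block of
  \<open>j\<close> vertices is fixed and may occur anywhere.\<close>

definition pairs_X :: "(nat \<times> nat) list" where
  "pairs_X = filter (\<lambda>(u, v). (in_B u \<or> in_B v) \<and> \<not> (in_C u \<or> in_C v)) (pairs h)"
definition pairs_Y :: "(nat \<times> nat) list" where
  "pairs_Y = filter (\<lambda>(u, v). (in_B u \<or> in_B v) \<and> (in_C u \<or> in_C v)) (pairs h)"
definition pairs_Z :: "(nat \<times> nat) list" where
  "pairs_Z = filter (\<lambda>(u, v). \<not> (in_B u \<or> in_B v)) (pairs h)"

lemma prod_pairs_split: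
  "(\<Prod>p\<leftarrow>pairs h. f p :: 'b::comm_monoid_mult) =
     (\<Prod>p\<leftarrow>pairs_X. f p) * (\<Prod>p\<leftarrow>pairs_Y. f p) * (\<Prod>p\<leftarrow>pairs_Z. f p)"
proof -
  let ?B = "\<lambda>(u, v). in_B u \<or> in_B v" and ?C = "\<lambda>(u, v). in_C u \<or> in_C v"
  have "(\<Prod>p\<leftarrow>pairs h. f p) = (\<Prod>p\<leftarrow>filter ?B (pairs h). f p) * (\<Prod>p\<leftarrow>filter (\<lambda>p. \<not> ?B p) (pairs h). f p)"
    by (rule prod_list_filter_split)
  also have "(\<Prod>p\<leftarrow>filter ?B (pairs h). f p) = (\<Prod>p\<leftarrow>filter (\<lambda>p. \<not> ?C p) (filter ?B (pairs h)). f p)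
      * (\<Prod>p\<leftarrow>filter (\<lambda>p. \<not> \<not> ?C p) (filter ?B (pairs h)). f p)"
    by (rule prod_list_filter_split)
  finally show ?thesis
    unfolding pairs_X_def pairs_Y_def pairs_Z_def
    by (simp add: filter_filter case_prod_unfold)
qed

text \<open>
  The vertices of the pattern fall into a block of \<open>j\<close> vertices and three blocks of \<open>k\<close> vertices;
  the four arguments encode the images of the blocks in base \<open>n\<close>.
\<close>

definition assignment :: "nat \<Rightarrow> nat \<Rightarrow> nat \<Rightarrow> nat \<Rightarrow> nat \<Rightarrow> nat \<Rightarrow> nat" where
  "assignment n z a b c i =
     (if i < j then z div n ^ i mod n
      else if i < j + k then a div n ^ (i - j) mod n
      else if i < j + 2 * k then b div n ^ (i - j - k) mod n
      else c div n ^ (i - j - 2 * k) mod n)"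

lemma assignment_less: "0 < n \<Longrightarrow> assignment n z a b c i < n"
  by (simp add: assignment_def)

lemma assignment_surj:
  assumes "\<forall>i<h. \<phi> i < n"
  shows "\<exists>z<n ^ j. \<exists>a<n ^ k. \<exists>b<n ^ k. \<exists>c<n ^ k. \<forall>i<h. assignment n z a b c i = \<phi> i"
proof -
  obtain z where z: "z < n ^ j" "\<forall>i<j. z div n ^ i mod n = \<phi> i"
    using digits_surj[of j \<phi> n] assms by auto
  obtain a where a: "a < n ^ k" "\<forall>i<k. a div n ^ i mod n = \<phi> (j + i)"
    using digits_surj[of k "\<lambda>i. \<phi> (j + i)" n] assms by auto
  obtain b where b: "b < n ^ k" "\<forall>i<k. b div n ^ i mod n = \<phi> (j + k + i)"
    using digits_surj[of k "\<lambda>i. \<phi> (j + k + i)" n] assms by auto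
  obtain c where c: "c < n ^ k" "\<forall>i<k. c div n ^ i mod n = \<phi> (j + 2 * k + i)"
    using digits_surj[of k "\<lambda>i. \<phi> (j + 2 * k + i)" n] assms by auto
  have "assignment n z a b c i = \<phi> i" if "i < h" for i
  proof -
    consider "i < j" | "j \<le> i" "i < j + k" | "j + k \<le> i" "i < j + 2 * k" | "j + 2 * k \<le> i"
      by linarith
    then show ?thesis
    proof cases
      case 1
      then show ?thesis using z by (simp add: assignment_def)
    next
      case 2
      then show ?thesis using a(2)[rule_format, of "i - j"] by (simp add: assignment_def)
    next
      case 3
      then have "j + k + (i - j - k) = i" "i - j - k < k" by auto
      then show ?thesis using 3 b(2)[rule_format, of "i - j - k"] by (simp add: assignment_def)
    next
      case 4
      then have "j + 2 * k + (i - j - 2 * k) = i" "i - j - 2 * k < k" using that by auto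
      then show ?thesis using 4 c(2)[rule_format, of "i - j - 2 * k"] by (simp add: assignment_def)
    qed
  qed
  then show ?thesis using z(1) a(1) b(1) c(1) by blast
qed

end

section \<open>Weights and their expansion into monomials\<close>

locale coloured_pattern = pattern +
  fixes n :: nat and adj col :: "nat \<Rightarrow> nat"
begin

definition colour :: "(nat \<Rightarrow> nat) \<Rightarrow> nat \<times> nat \<Rightarrow> nat" where
  "colour \<phi> = (\<lambda>(u, v). col (\<phi> u * n + \<phi> v))"

text \<open>The two truncated differences add up to the absolute difference. Attaching the colour
  power of an edge to its own pair makes every monomial a product over pairs.\<close>

definition pair_factor :: "(nat \<times> nat \<Rightarrow> nat) \<Rightarrow> (nat \<Rightarrow> nat) \<Rightarrow> nat \<times> nat \<Rightarrow> nat" where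
  "pair_factor ex \<phi> = (\<lambda>(u, v). ((\<phi> u - \<phi> v) + (\<phi> v - \<phi> u)) *
     (if (u, v) \<in> set EH then adj (\<phi> u * n + \<phi> v) * col (\<phi> u * n + \<phi> v) ^ ex (u, v) else 1))"

definition weight :: "(nat \<Rightarrow> nat) \<Rightarrow> int" where
  "weight \<phi> = int (\<Prod>p\<leftarrow>pairs h. pair_factor (\<lambda>_. 0) \<phi> p) *
     (\<Prod>(e, e')\<leftarrow>edge_pairs. (int (colour \<phi> e) - int (colour \<phi> e'))\<^sup>2)"

definition rainbow_copy :: "(nat \<Rightarrow> nat) \<Rightarrow> bool" where
  "rainbow_copy \<phi> \<longleftrightarrow> inj_on \<phi> {..<h} \<and> (\<forall>(u, v)\<in>set EH. adj (\<phi> u * n + \<phi> v) \<noteq> 0) \<and>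
     inj_on (colour \<phi>) (set EH)"

lemma inj_on_pairs: "inj_on \<phi> {..<m} \<longleftrightarrow> (\<forall>(u, v)\<in>set (pairs m). \<phi> u \<noteq> (\<phi> v :: nat))"
  unfolding inj_on_def set_pairs by (auto, metis lessThan_iff linorder_neqE_nat)

lemma inj_on_edge_pairs:
  "inj_on f (set EH) \<longleftrightarrow> (\<forall>(e, e')\<in>set edge_pairs. f e \<noteq> f e')"
  unfolding inj_on_def edge_pairs_def by auto

lemma prod_pair_factor_nonzero:
  "(\<Prod>p\<leftarrow>pairs h. pair_factor (\<lambda>_. 0) \<phi> p) \<noteq> 0 \<longleftrightarrow>
     inj_on \<phi> {..<h} \<and> (\<forall>(u, v)\<in>set EH. adj (\<phi> u * n + \<phi> v) \<noteq> 0)"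
proof -
  have "(\<Prod>p\<leftarrow>pairs h. pair_factor (\<lambda>_. 0) \<phi> p) \<noteq> 0 \<longleftrightarrow>
      (\<forall>p\<in>set (pairs h). pair_factor (\<lambda>_. 0) \<phi> p \<noteq> 0)"
    by (auto simp: prod_list_zero_iff)
  also have "\<dots> \<longleftrightarrow> (\<forall>(u, v)\<in>set (pairs h). \<phi> u \<noteq> \<phi> v) \<and>
      (\<forall>(u, v)\<in>set EH. adj (\<phi> u * n + \<phi> v) \<noteq> 0)"
    using EH_pairs by (fastforce simp: pair_factor_def)
  finally show ?thesis by (simp only: inj_on_pairs)
qed

lemma weight_nonzero: "weight \<phi> \<noteq> 0 \<longleftrightarrow> rainbow_copy \<phi>"
proof -
  have "(\<Prod>(e, e')\<leftarrow>edge_pairs. (int (colour \<phi> e) - int (colour \<phi> e'))\<^sup>2) \<noteq> 0 \<longleftrightarrow>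
      inj_on (colour \<phi>) (set EH)"
    unfolding inj_on_edge_pairs by (rule prod_square_diffs_nonzero)
  then show ?thesis
    unfolding weight_def rainbow_copy_def using prod_pair_factor_nonzero[of \<phi>] by auto
qed

lemma weight_nonneg: "weight \<phi> \<ge> 0"
proof -
  have "(\<Prod>(e, e')\<leftarrow>ds. (int (colour \<phi> e) - int (colour \<phi> e'))\<^sup>2) \<ge> 0" for ds
    by (induction ds) auto
  then show ?thesis unfolding weight_def by simp
qed

text \<open>A difference of two colours involves up to four vertices and fits into no matrix, but
  each monomial of the expanded product is a product of powers of single edge colours, which the
  pair factors absorb.\<close>

lemma weight_expand:
  "(\<Sum>(sg, ex)\<leftarrow>monomials. (if sg then 1 else - 1) * int (\<Prod>p\<leftarrow>pairs h. pair_factor ex \<phi> p)) = weight \<phi>"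
proof -
  let ?c = "\<lambda>e. int (colour \<phi> e)"
  have dist: "distinct (pairs h)"
    unfolding pairs_def by (intro distinct_filter distinct_product) auto
  have split: "int (\<Prod>p\<leftarrow>pairs h. pair_factor ex \<phi> p) =
      int (\<Prod>p\<leftarrow>pairs h. pair_factor (\<lambda>_. 0) \<phi> p) * (\<Prod>e\<in>set EH. ?c e ^ ex e)" for ex
  proof -
    \<comment> \<open>Pairs that are not edges contribute the factor 1.\<close>
    have "(\<Prod>e\<in>set EH. ?c e ^ ex e) = (\<Prod>p\<in>set (pairs h). if p \<in> set EH then ?c p ^ ex p else 1)"
      using EH_pairs by (intro prod.mono_neutral_cong_left) auto
    moreover have "(\<Prod>p\<leftarrow>pairs h. f p :: nat) = (\<Prod>p\<in>set (pairs h). f p)" for f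
      using dist by (simp add: prod.distinct_set_conv_list)
    moreover have "int (pair_factor ex \<phi> p) =
        int (pair_factor (\<lambda>_. 0) \<phi> p) * (if p \<in> set EH then ?c p ^ ex p else 1)" for p
      by (cases p) (simp add: pair_factor_def colour_def)
    ultimately show ?thesis by (simp add: prod.distrib)
  qed
  have "(\<Sum>(sg, ex)\<leftarrow>ml. (if sg then 1 else - 1) * int (\<Prod>p\<leftarrow>pairs h. pair_factor ex \<phi> p))
      = int (\<Prod>p\<leftarrow>pairs h. pair_factor (\<lambda>_. 0) \<phi> p) * (\<Sum>mo\<leftarrow>ml. monomial_val (set EH) ?c mo)" for ml
  proof (induction ml)
    case (Cons mo ml)
    obtain sg ex where mo: "mo = (sg, ex)" by fastforce
    show ?case
      unfolding mo list.map sum_list.Cons Cons.IH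
      by (simp only: prod.case split[of ex] monomial_val_def distrib_left mult.left_commute)
  qed simp
  then have "(\<Sum>(sg, ex)\<leftarrow>monomials. (if sg then 1 else - 1) * int (\<Prod>p\<leftarrow>pairs h. pair_factor ex \<phi> p))
      = int (\<Prod>p\<leftarrow>pairs h. pair_factor (\<lambda>_. 0) \<phi> p) * (\<Sum>mo\<leftarrow>monomials. monomial_val (set EH) ?c mo)" .
  also have "(\<Sum>mo\<leftarrow>monomials. monomial_val (set EH) ?c mo) = (\<Prod>(e, e')\<leftarrow>edge_pairs. (?c e - ?c e')\<^sup>2)"
    unfolding monomials_def by (rule square_diffs) (auto simp: edge_pairs_def)
  finally show ?thesis unfolding weight_def .
qed

lemma pair_factor_cong:
  "\<phi> (fst p) = \<psi> (fst p) \<Longrightarrow> \<phi> (snd p) = \<psi> (snd p) \<Longrightarrow> pair_factor ex \<phi> p = pair_factor ex \<psi> p"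
  by (auto simp: pair_factor_def case_prod_unfold)

section \<open>Factorisation into matrix entries\<close>

definition entry_X :: "(nat \<times> nat \<Rightarrow> nat) \<Rightarrow> nat \<Rightarrow> nat \<Rightarrow> nat \<Rightarrow> nat" where
  "entry_X ex z a b = (\<Prod>p\<leftarrow>pairs_X. pair_factor ex (assignment n z a b 0) p)"
definition entry_Y :: "(nat \<times> nat \<Rightarrow> nat) \<Rightarrow> nat \<Rightarrow> nat \<Rightarrow> nat \<Rightarrow> nat" where
  "entry_Y ex z b c = (\<Prod>p\<leftarrow>pairs_Y. pair_factor ex (assignment n z 0 b c) p)"
definition entry_Z :: "(nat \<times> nat \<Rightarrow> nat) \<Rightarrow> nat \<Rightarrow> nat \<Rightarrow> nat \<Rightarrow> nat" where
  "entry_Z ex z a c = (\<Prod>p\<leftarrow>pairs_Z. pair_factor ex (assignment n z a 0 c) p)"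

text \<open>Each of the three lists of pairs avoids one of the blocks A, B, C or depends on it
  trivially, so the image of that block can be replaced by the default 0.\<close>

lemma prod_pairs_entries:
  "(\<Prod>p\<leftarrow>pairs h. pair_factor ex (assignment n z a b c) p) =
     entry_X ex z a b * entry_Y ex z b c * entry_Z ex z a c"
proof -
  have "(\<Prod>p\<leftarrow>pairs_X. pair_factor ex (assignment n z a b c) p) = entry_X ex z a b"
    unfolding entry_X_def
    by (intro arg_cong[where f = prod_list] map_cong pair_factor_cong)
      (auto simp: pairs_X_def in_C_def assignment_def)
  moreover have "(\<Prod>p\<leftarrow>pairs_Y. pair_factor ex (assignment n z a b c) p) = entry_Y ex z b c"
    unfolding entry_Y_def
    by (intro arg_cong[where f = prod_list] map_cong pair_factor_cong)
      (auto simp: pairs_Y_def in_B_def in_C_def assignment_def)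
  moreover have "(\<Prod>p\<leftarrow>pairs_Z. pair_factor ex (assignment n z a b c) p) = entry_Z ex z a c"
    unfolding entry_Z_def
    by (intro arg_cong[where f = prod_list] map_cong pair_factor_cong)
      (auto simp: pairs_Z_def in_B_def assignment_def)
  ultimately show ?thesis unfolding prod_pairs_split by simp
qed

definition total :: "nat \<Rightarrow> nat \<Rightarrow> nat \<Rightarrow> int" where
  "total z a c = (\<Sum>b<n ^ k. weight (assignment n z a b c))"

definition monomial_total :: "nat \<Rightarrow> nat \<Rightarrow> nat \<Rightarrow> (nat \<times> nat) monomial \<Rightarrow> int" where
  "monomial_total z a c = (\<lambda>(sg, ex). (if sg then 1 else - 1) * (int (entry_Z ex z a c) *
     (\<Sum>b<n ^ k. int (entry_X ex z a b) * int (entry_Y ex z b c))))"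

text \<open>\<open>entry_Z\<close> is constant in \<open>b\<close>, and what remains of the sum over
  \<open>b\<close> is row \<open>a\<close> of one matrix times column \<open>c\<close> of
  another.\<close>

lemma total_expand: "(\<Sum>mo\<leftarrow>monomials. monomial_total z a c mo) = total z a c"
proof -
  have step: "(\<Sum>b<n ^ k. \<Sum>(sg, ex)\<leftarrow>ml. (if sg then 1 else - 1) *
      int (entry_X ex z a b * entry_Y ex z b c * entry_Z ex z a c)) =
    (\<Sum>mo\<leftarrow>ml. monomial_total z a c mo)" for ml
  proof (induction ml)
    case (Cons mo ml)
    then show ?case
      by (cases mo) (simp add: sum.distrib monomial_total_def sum_distrib_left sum_negf ac_simps)
  qed simp
  show ?thesis
    unfolding total_def weight_expand[symmetric] prod_pairs_entries step ..
qed

lemma total_nonneg: "total z a c \<ge> 0"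
  unfolding total_def by (intro sum_nonneg weight_nonneg)

lemma total_nonzero:
  "total z a c \<noteq> 0 \<longleftrightarrow> (\<exists>b<n ^ k. rainbow_copy (assignment n z a b c))"
  unfolding total_def using sum_nonneg_eq_0_iff[of "{..<n ^ k}" "\<lambda>b. weight (assignment n z a b c)"]
  by (auto simp: weight_nonneg weight_nonzero)

end

section \<open>Evaluating the weights in a single assignment\<close>

text \<open>Every squared difference multiplies by two variables, possibly the same one twice. The
  bound keeps the colour powers within a word.\<close>

lemma square_diffs_exponent: "(sg, ex) \<in> set (square_diffs ds) \<Longrightarrow> ex e \<le> 2 * length ds"
proof (induction ds arbitrary: sg ex)
  case (Cons d ds)
  then obtain sg' ex' where "(sg', ex') \<in> set (square_diffs ds)"
    and "\<exists>f f'. ex = times_var f (times_var f' ex')"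
    by (auto simp: Let_def)
  moreover from this have "ex' e \<le> 2 * length ds" using Cons.IH by blast
  ultimately show ?case by (auto simp: times_var_def)
qed simp

lemma power_le_trans: "(B::nat) ^ b \<le> W \<Longrightarrow> a \<le> b \<Longrightarrow> 2 \<le> B \<Longrightarrow> B ^ a \<le> W"
  using power_increasing[of a b B] by linarith

context pattern
begin

text \<open>The vertex difference takes one factor \<open>B\<close>, the colour power 2 for each
  edge pair. The constant is 2 rather than 1 so that a squared colour difference and an index into
  the adjacency matrix are covered as well.\<close>

definition factor_exponent :: nat where
  "factor_exponent = 2 + 2 * length edge_pairs"

text \<open>At most \<open>h * h\<close> pairs and all edge pairs contribute a factor each; the
  added 1 keeps the exponent at least \<open>factor_exponent\<close> even without any
  factors.\<close>

definition weight_exponent :: nat where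
  "weight_exponent = factor_exponent * (h * h + length edge_pairs + 1)"

lemma exponent_le: "(sg, ex) \<in> set monomials \<Longrightarrow> ex e \<le> 2 * length edge_pairs"
  unfolding monomials_def by (rule square_diffs_exponent)

lemma h_le_weight_exponent: "h \<le> weight_exponent"
proof -
  have "h \<le> h * h + length edge_pairs + 1"
    by (metis Suc_eq_plus1 le_SucI le_square trans_le_add1)
  also have "\<dots> \<le> weight_exponent"
    unfolding weight_exponent_def factor_exponent_def by simp
  finally show ?thesis .
qed

lemma factor_exponent_le: "factor_exponent \<le> weight_exponent"
  unfolding weight_exponent_def by simp

lemma two_le_weight_exponent: "2 \<le> weight_exponent"
  using factor_exponent_le unfolding factor_exponent_def by linarith

text \<open>The expression evaluates \<open>assignment\<close> with the block codes given as
  expressions. Its size depends on the pattern only, so decoding a vertex costs no extra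
  step.\<close>

definition eassignment :: "expr \<Rightarrow> expr \<Rightarrow> expr \<Rightarrow> expr \<Rightarrow> nat \<Rightarrow> expr" where
  "eassignment z a b c i = (let digit = (\<lambda>x l. Mod (Div x (epow (reg 0) l)) (reg 0)) in
     if i < j then digit z i
     else if i < j + k then digit a (i - j)
     else if i < j + 2 * k then digit b (i - j - k)
     else digit c (i - j - 2 * k))"

definition eindex :: "(nat \<Rightarrow> expr) \<Rightarrow> nat \<times> nat \<Rightarrow> expr" where
  "eindex \<epsilon> p = Plus (Times (\<epsilon> (fst p)) (reg 0)) (\<epsilon> (snd p))"

definition epair_factor :: "(nat \<times> nat \<Rightarrow> nat) \<Rightarrow> (nat \<Rightarrow> expr) \<Rightarrow> nat \<times> nat \<Rightarrow> expr" where
  "epair_factor ex \<epsilon> p = Times (Plus (Minus (\<epsilon> (fst p)) (\<epsilon> (snd p))) (Minus (\<epsilon> (snd p)) (\<epsilon> (fst p))))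
     (if p \<in> set EH then Times (Get 1 (eindex \<epsilon> p)) (epow (Get 2 (eindex \<epsilon> p)) (ex p)) else Num 1)"

definition ecolour_diff :: "(nat \<Rightarrow> expr) \<Rightarrow> (nat \<times> nat) \<times> (nat \<times> nat) \<Rightarrow> expr" where
  "ecolour_diff \<epsilon> = (\<lambda>(e, e'). Plus (Minus (Get 2 (eindex \<epsilon> e)) (Get 2 (eindex \<epsilon> e')))
     (Minus (Get 2 (eindex \<epsilon> e')) (Get 2 (eindex \<epsilon> e))))"

text \<open>Absolute colour differences vanish exactly when the squares do. No expansion is used
  here, because a single assignment is tested.\<close>

definition erainbow :: "(nat \<Rightarrow> expr) \<Rightarrow> expr" where
  "erainbow \<epsilon> = eprod (map (epair_factor (\<lambda>_. 0) \<epsilon>) (pairs h) @ map (ecolour_diff \<epsilon>) edge_pairs)"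

end

context coloured_pattern
begin

lemma pair_factor_le:
  assumes "n \<le> B" "2 \<le> B" "\<And>i. adj i \<le> 1" "EH \<noteq> [] \<Longrightarrow> \<forall>i. col i \<le> B"
    and "\<phi> (fst p) < n" "\<phi> (snd p) < n" "ex p \<le> 2 * length edge_pairs"
  shows "pair_factor ex \<phi> p \<le> B ^ factor_exponent"
proof -
  obtain u v where p: "p = (u, v)" by fastforce
  have "(if (u, v) \<in> set EH then adj (\<phi> u * n + \<phi> v) * col (\<phi> u * n + \<phi> v) ^ ex (u, v) else 1)
      \<le> B ^ (2 * length edge_pairs)"
  proof (cases "(u, v) \<in> set EH")
    case True
    then have "EH \<noteq> []" by auto
    then have "col (\<phi> u * n + \<phi> v) ^ ex p \<le> B ^ ex p" using assms(4) by (intro power_mono) auto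
    also have "\<dots> \<le> B ^ (2 * length edge_pairs)"
      using assms(2,7) by (intro power_increasing) auto
    finally show ?thesis
      using assms(3)[of "\<phi> u * n + \<phi> v"] True p mult_le_mono[of "adj (\<phi> u * n + \<phi> v)" 1] by simp
  next
    case False
    then show ?thesis using assms(2) by simp
  qed
  moreover have "(\<phi> u - \<phi> v) + (\<phi> v - \<phi> u) \<le> B" using assms p by auto
  ultimately have "pair_factor ex \<phi> p \<le> B * B ^ (2 * length edge_pairs)"
    unfolding p pair_factor_def prod.case by (rule mult_le_mono[rotated])
  also have "\<dots> \<le> B ^ factor_exponent"
    unfolding factor_exponent_def using assms(2) by simp
  finally show ?thesis .
qed

lemma fst_snd_pairs: "p \<in> set (pairs h) \<Longrightarrow> fst p < h \<and> snd p < h"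
  by (auto simp: set_pairs)

lemma fst_snd_EH: "p \<in> set EH \<Longrightarrow> fst p < h \<and> snd p < h"
  using EH_pairs fst_snd_pairs[of p] by blast

lemma prod_pair_factor_le:
  assumes "n \<le> B" "2 \<le> B" "\<And>i. adj i \<le> 1" "EH \<noteq> [] \<Longrightarrow> \<forall>i. col i \<le> B"
    and "\<And>i. i < h \<Longrightarrow> \<phi> i < n" "\<And>p. ex p \<le> 2 * length edge_pairs"
  shows "(\<Prod>p\<leftarrow>pairs h. pair_factor ex \<phi> p) \<le> (B ^ factor_exponent) ^ (h * h)"
proof -
  have "(\<Prod>p\<leftarrow>pairs h. pair_factor ex \<phi> p) \<le> (B ^ factor_exponent) ^ length (pairs h)"
    using fst_snd_pairs by (intro prod_list_le_power pair_factor_le) (use assms in auto)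
  also have "\<dots> \<le> (B ^ factor_exponent) ^ (h * h)"
    using assms(2) length_pairs[of h] by (intro power_increasing) auto
  finally show ?thesis .
qed

lemma weight_le:
  assumes "n \<le> B" "2 \<le> B" "\<And>i. adj i \<le> 1" "EH \<noteq> [] \<Longrightarrow> \<forall>i. col i \<le> B"
    and "\<And>i. i < h \<Longrightarrow> \<phi> i < n"
  shows "weight \<phi> \<le> int (B ^ weight_exponent)"
proof -
  have "(\<Prod>(e, e')\<leftarrow>ds. (int (colour \<phi> e) - int (colour \<phi> e'))\<^sup>2) \<le> int ((B ^ factor_exponent) ^ length ds)"
    if "set ds \<subseteq> set edge_pairs" for ds
    using that
  proof (induction ds)
    case (Cons d ds)
    obtain e e' where d: "d = (e, e')" by (cases d) auto
    have "EH \<noteq> []" using Cons.prems d by (auto simp: edge_pairs_def)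
    then have c: "colour \<phi> e \<le> B" "colour \<phi> e' \<le> B"
      using assms(4) by (auto simp: colour_def split: prod.splits)
    have "(int (colour \<phi> e) - int (colour \<phi> e'))\<^sup>2 \<le> (int B)\<^sup>2"
      using c by (intro power2_le_iff_abs_le[THEN iffD2]) auto
    also have "\<dots> \<le> int B ^ factor_exponent"
      using assms(2) unfolding factor_exponent_def by (intro power_increasing) auto
    finally have "(int (colour \<phi> e) - int (colour \<phi> e'))\<^sup>2 \<le> int (B ^ factor_exponent)" by simp
    moreover have "0 \<le> (\<Prod>(e, e')\<leftarrow>ds. (int (colour \<phi> e) - int (colour \<phi> e'))\<^sup>2)"
      by (induction ds) auto
    ultimately show ?case
      unfolding d using Cons by (auto intro: mult_mono simp del: of_nat_power)
  qed simp
  from this[OF order_refl]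
  have "weight \<phi> \<le> int ((B ^ factor_exponent) ^ (h * h)) * int ((B ^ factor_exponent) ^ length edge_pairs)"
    unfolding weight_def using prod_pair_factor_le[of B \<phi> "\<lambda>_. 0"] assms
    by (intro mult_mono) (auto simp del: of_nat_power simp: case_prod_unfold intro!: prod_list_nonneg)
  also have "\<dots> = int (B ^ (factor_exponent * (h * h + length edge_pairs)))"
    by (simp only: power_add power_mult of_nat_mult distrib_left)
  also have "\<dots> \<le> int (B ^ weight_exponent)"
    unfolding weight_exponent_def using assms(2) by (simp del: of_nat_power add: power_increasing)
  finally show ?thesis .
qed

lemma total_le:
  assumes "n \<le> B" "2 \<le> B" "\<And>i. adj i \<le> 1" "EH \<noteq> [] \<Longrightarrow> \<forall>i. col i \<le> B"
    and "z < n ^ j"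
  shows "total z a c \<le> int (B ^ (k + weight_exponent))"
proof -
  have "total z a c \<le> (\<Sum>b<n ^ k. int (B ^ weight_exponent))"
    unfolding total_def
  proof (rule sum_mono)
    fix b assume b: "b \<in> {..<n ^ k}"
    \<comment> \<open>For \<open>n = 0\<close> the powers bounding \<open>b\<close> and
      \<open>z\<close> are positive only if \<open>k = j = 0\<close>.\<close>
    have "h = 0 \<or> 0 < n" using b assms(5) by (cases "n = 0") (auto simp: power_0_left split: if_splits)
    then show "weight (assignment n z a b c) \<le> int (B ^ weight_exponent)"
      using assms assignment_less by (intro weight_le) auto
  qed
  also have "\<dots> = int (n ^ k * B ^ weight_exponent)" by simp
  also have "n ^ k * B ^ weight_exponent \<le> B ^ k * B ^ weight_exponent"
    using assms(1) by (intro mult_right_mono power_mono) auto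
  finally show ?thesis by (simp add: power_add)
qed

end


section \<open>Evaluating the expressions within the word size\<close>

locale bounded_pattern = coloured_pattern +
  fixes B W :: nat
  assumes n_le: "n \<le> B" and two_le: "2 \<le> B" and adj_le: "\<And>i. adj i \<le> 1"
    and col_le: "EH \<noteq> [] \<Longrightarrow> \<forall>i. col i \<le> B" and W: "B ^ weight_exponent \<le> W"
begin

definition input :: "memory \<Rightarrow> bool" where
  "input s \<longleftrightarrow> s 0 0 = n \<and> s 1 = adj \<and> s 2 = col"

lemma B_le_W: "B \<le> W"
  using power_le_trans[OF W, of 1] two_le two_le_weight_exponent by auto

lemma fits_num: "m \<le> 2 \<Longrightarrow> fits W (Num m) s"
  using B_le_W two_le by auto

lemma fits_n: "input s \<Longrightarrow> fits W (reg 0) s"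
  using B_le_W n_le fits_num[of 0] by (auto simp: input_def)

lemma eassignment:
  assumes "input s" "fits W z s" "fits W a s" "fits W b s" "fits W c s" "i < h"
  shows "fits W (eassignment z a b c i) s \<and>
    val (eassignment z a b c i) s = assignment n (val z s) (val a s) (val b s) (val c s) i"
proof -
  have "fits W (epow (reg 0) l) s" if "l \<le> h" for l
    using assms(1) that n_le two_le h_le_weight_exponent
    by (intro fits_epow[where B = B] fits_n power_le_trans[OF W]) (auto simp: input_def)
  then have "fits W (epow (reg 0) i) s" "fits W (epow (reg 0) (i - j)) s"
    "fits W (epow (reg 0) (i - j - k)) s" "fits W (epow (reg 0) (i - j - 2 * k)) s"
    using assms(6) by auto
  moreover have "s 0 0 = n" "n \<le> W" using assms(1) n_le B_le_W by (auto simp: input_def)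
  ultimately show ?thesis
    using assms by (simp add: eassignment_def assignment_def Let_def)
qed

lemma eindex:
  assumes "input s" "p \<in> set EH"
    and "\<And>i. i < h \<Longrightarrow> fits W (\<epsilon> i) s \<and> val (\<epsilon> i) s = \<phi> i \<and> \<phi> i < n"
  shows "fits W (eindex \<epsilon> p) s \<and> val (eindex \<epsilon> p) s = \<phi> (fst p) * n + \<phi> (snd p)"
proof -
  note p = fst_snd_EH[OF assms(2)]
  have "Suc (\<phi> (fst p)) * n \<le> n * n" using assms(3) p by (intro mult_right_mono) (simp_all add: Suc_leI)
  then have "\<phi> (fst p) * n + \<phi> (snd p) \<le> n * n" using assms(3)[of "snd p"] p by simp
  also have "\<dots> \<le> B * B" using n_le by (intro mult_le_mono)
  also have "\<dots> = B ^ 2" by (simp add: power2_eq_square)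
  also have "\<dots> \<le> W" by (rule power_le_trans[OF W two_le_weight_exponent two_le])
  finally have "\<phi> (fst p) * n + \<phi> (snd p) \<le> W" .
  then show ?thesis
    using assms(1,3) p fits_n[OF assms(1)] by (auto simp: eindex_def input_def)
qed

lemma epair_factor:
  assumes "input s" "p \<in> set (pairs h)" "ex p \<le> 2 * length edge_pairs"
    and "\<And>i. i < h \<Longrightarrow> fits W (\<epsilon> i) s \<and> val (\<epsilon> i) s = \<phi> i \<and> \<phi> i < n"
  shows "fits W (epair_factor ex \<epsilon> p) s \<and> val (epair_factor ex \<epsilon> p) s = pair_factor ex \<phi> p"
proof -
  note p = fst_snd_pairs[OF assms(2)]
  have le: "pair_factor ex \<phi> p \<le> W"
    using pair_factor_le[OF n_le two_le adj_le col_le, of \<phi> p ex] assms(3,4) p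
      power_le_trans[OF W factor_exponent_le two_le] by auto
  have diff: "(\<phi> (fst p) - \<phi> (snd p)) + (\<phi> (snd p) - \<phi> (fst p)) \<le> W"
    using assms(4)[of "fst p"] assms(4)[of "snd p"] p n_le B_le_W by auto
  show ?thesis
  proof (cases "p \<in> set EH")
    case False
    then show ?thesis
      using assms(4) p le diff fits_num[of 1] by (auto simp: epair_factor_def pair_factor_def case_prod_unfold)
  next
    case True
    have ne: "EH \<noteq> []" using True by auto
    let ?i = "\<phi> (fst p) * n + \<phi> (snd p)"
    note ix = eindex[OF assms(1) True assms(4)]
    have mem: "s 1 = adj" "s 2 = col" using assms(1) by (auto simp: input_def)
    have col: "fits W (Get 2 (eindex \<epsilon> p)) s" "val (Get 2 (eindex \<epsilon> p)) s \<le> B"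
      using ix mem col_le[OF ne] le_trans[OF col_le[OF ne, rule_format] B_le_W] by simp_all
    have pow: "B ^ ex p \<le> W"
      using assms(3) factor_exponent_le
      by (intro power_le_trans[OF W _ two_le]) (simp add: factor_exponent_def)
    have ep: "fits W (epow (Get 2 (eindex \<epsilon> p)) (ex p)) s"
      using col pow two_le by (intro fits_epow[where B = B]) auto
    have "adj ?i * col ?i ^ ex p \<le> 1 * B ^ ex p"
      using adj_le col_le[OF ne] by (intro mult_le_mono power_mono) auto
    then have "adj ?i * col ?i ^ ex p \<le> W" using pow by simp
    moreover have "adj ?i \<le> W" using adj_le[of ?i] B_le_W two_le by linarith
    ultimately show ?thesis
      using assms(4) p True ep ix le diff mem col
      by (auto simp: epair_factor_def pair_factor_def case_prod_unfold)
  qed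
qed

lemma eprod_pair_factors:
  assumes "input s" "set ps \<subseteq> set (pairs h)" "length ps \<le> h * h" "\<And>p. ex p \<le> 2 * length edge_pairs"
    and "\<And>i. i < h \<Longrightarrow> fits W (\<epsilon> i) s \<and> val (\<epsilon> i) s = \<phi> i \<and> \<phi> i < n"
  shows "fits W (eprod (map (epair_factor ex \<epsilon>) ps)) s \<and>
    val (eprod (map (epair_factor ex \<epsilon>) ps)) s = (\<Prod>p\<leftarrow>ps. pair_factor ex \<phi> p)"
proof
  have pf: "fits W (epair_factor ex \<epsilon> p) s \<and> val (epair_factor ex \<epsilon> p) s = pair_factor ex \<phi> p"
    if "p \<in> set ps" for p
    using assms that by (intro epair_factor) auto
  have pf_le: "pair_factor ex \<phi> p \<le> B ^ factor_exponent" if "p \<in> set ps" for p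
    using that fst_snd_pairs[of p] assms(2,4,5)
    by (intro pair_factor_le n_le two_le adj_le col_le) auto
  have "(B ^ factor_exponent) ^ length ps \<le> W"
    unfolding power_mult[symmetric]
    by (intro power_le_trans[OF W _ two_le])
      (use assms(3) in \<open>simp add: weight_exponent_def\<close>)
  then show "fits W (eprod (map (epair_factor ex \<epsilon>) ps)) s"
    using pf pf_le two_le by (intro fits_eprod[where B = "B ^ factor_exponent"]) auto
  show "val (eprod (map (epair_factor ex \<epsilon>) ps)) s = (\<Prod>p\<leftarrow>ps. pair_factor ex \<phi> p)"
    using pf by (auto intro!: arg_cong[where f = prod_list] simp: comp_def)
qed

lemma erainbow:
  assumes "input s"
    and \<epsilon>: "\<And>i. i < h \<Longrightarrow> fits W (\<epsilon> i) s \<and> val (\<epsilon> i) s = \<phi> i \<and> \<phi> i < n"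
  shows "fits W (erainbow \<epsilon>) s \<and> (val (erainbow \<epsilon>) s \<noteq> 0 \<longleftrightarrow> rainbow_copy \<phi>)"
proof -
  have pf: "fits W (epair_factor (\<lambda>_. 0) \<epsilon> p) s \<and> val (epair_factor (\<lambda>_. 0) \<epsilon> p) s = pair_factor (\<lambda>_. 0) \<phi> p"
    if "p \<in> set (pairs h)" for p
    using assms that by (intro epair_factor) auto
  have pf_le: "pair_factor (\<lambda>_. 0) \<phi> p \<le> B ^ factor_exponent" if "p \<in> set (pairs h)" for p
    using that fst_snd_pairs[OF that] \<epsilon> by (intro pair_factor_le n_le two_le adj_le col_le) auto
  have cd: "fits W (ecolour_diff \<epsilon> d) s \<and> val (ecolour_diff \<epsilon> d) s \<le> B \<and>
      (val (ecolour_diff \<epsilon> d) s \<noteq> 0 \<longleftrightarrow> colour \<phi> (fst d) \<noteq> colour \<phi> (snd d))"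
    if "d \<in> set edge_pairs" for d
  proof -
    have d: "fst d \<in> set EH" "snd d \<in> set EH" using that by (auto simp: edge_pairs_def)
    then have ne: "EH \<noteq> []" by auto
    have mem: "s 2 = col" using assms(1) by (auto simp: input_def)
    have c: "fits W (Get 2 (eindex \<epsilon> e)) s \<and> val (Get 2 (eindex \<epsilon> e)) s = colour \<phi> e \<and> colour \<phi> e \<le> B"
      if "e \<in> set EH" for e
      using eindex[OF assms(1) that \<epsilon>] mem col_le[OF ne] le_trans[OF col_le[OF ne, rule_format] B_le_W]
      by (simp add: colour_def case_prod_unfold)
    have "(colour \<phi> (fst d) - colour \<phi> (snd d)) + (colour \<phi> (snd d) - colour \<phi> (fst d)) \<le> B"
      using c[OF d(1)] c[OF d(2)] by auto
    then show ?thesis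
      using c[OF d(1)] c[OF d(2)] B_le_W
      by (auto simp: ecolour_diff_def case_prod_unfold simp del: val.simps(2) fits.simps(2))
  qed
  \<comment> \<open>Gives pair factors and colour differences one common bound, so that the whole
    product is bounded by a power.\<close>
  have BF: "B \<le> B ^ factor_exponent"
    using two_le self_le_power[of B factor_exponent] by (simp add: factor_exponent_def)
  have "length (pairs h) + length edge_pairs \<le> h * h + length edge_pairs + 1"
    using length_pairs[of h] by simp
  then have "(B ^ factor_exponent) ^ (length (pairs h) + length edge_pairs) \<le> W"
    unfolding power_mult[symmetric] weight_exponent_def
    by (intro power_le_trans[OF W _ two_le]) (simp add: weight_exponent_def del: add_mult_distrib2)
  moreover have "val (ecolour_diff \<epsilon> d) s \<le> B ^ factor_exponent" if "d \<in> set edge_pairs" for d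
    using cd[OF that] BF le_trans by blast
  ultimately have "fits W (erainbow \<epsilon>) s"
    unfolding erainbow_def using pf pf_le cd two_le
    by (intro fits_eprod[where B = "B ^ factor_exponent"]) auto
  moreover have "val (erainbow \<epsilon>) s \<noteq> 0 \<longleftrightarrow>
      (\<Prod>p\<leftarrow>pairs h. pair_factor (\<lambda>_. 0) \<phi> p) \<noteq> 0 \<and> (\<forall>d\<in>set edge_pairs. val (ecolour_diff \<epsilon> d) s \<noteq> 0)"
  proof -
    have "(\<Prod>p\<leftarrow>pairs h. val (epair_factor (\<lambda>_. 0) \<epsilon> p) s) = (\<Prod>p\<leftarrow>pairs h. pair_factor (\<lambda>_. 0) \<phi> p)"
      using pf by (intro arg_cong[where f = prod_list] map_cong) auto
    moreover have "(\<Prod>d\<leftarrow>ds. f d :: nat) \<noteq> 0 \<longleftrightarrow> (\<forall>d\<in>set ds. f d \<noteq> 0)" for f and ds :: "((nat \<times> nat) \<times> (nat \<times> nat)) list"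
      by (induction ds) auto
    ultimately show ?thesis by (simp add: erainbow_def comp_def)
  qed
  moreover have "(\<forall>d\<in>set edge_pairs. val (ecolour_diff \<epsilon> d) s \<noteq> 0) \<longleftrightarrow> inj_on (colour \<phi>) (set EH)"
    unfolding inj_on_edge_pairs using cd by (auto simp: case_prod_unfold)
  ultimately show ?thesis
    unfolding rainbow_copy_def prod_pair_factor_nonzero by blast
qed

end

section \<open>The search program\<close>

text \<open>
  Memory layout. Scalars: 5 holds \<open>N = n\<^sup>k\<close>, 6 holds \<open>n\<^sup>j\<close>, 7 the largest colour, 8 and 9 the numbers
  \<open>X\<close> and \<open>M = D X + 1\<close>, 18 holds \<open>N\<^sup>2\<close>; 10, 11, 14 are the loop counters for matrix entries, for the
  block of \<open>j\<close> vertices and for block \<open>B\<close>; 12 and 13 record where a nonzero total was found. Arrays: 15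
  contains the constants of the straight-line program modulo \<open>M\<close>, 16 its cells, 17 the totals. The
  arrays of the program that lists the straight-line program are shifted by 20, so that 21 to 25
  correspond to 1 to 5 in \<^const>\<open>slp_stored\<close>.
\<close>

definition simulate :: com where
  "simulate = For 10 (reg 21)
     (let arg = (\<lambda>a. Get 16 (Get a (reg 10)));
          store = (\<lambda>e. Assign 16 (Plus (Times (Num 2) (reg 18)) (reg 10)) e)
      in If (Get 22 (reg 10))
        (If (Minus (Get 22 (reg 10)) (Num 1))
          (If (Minus (Get 22 (reg 10)) (Num 2))
            (store (Mod (Times (arg 23) (arg 24)) (reg 9)))
            (store (Mod (Plus (arg 23) (Minus (reg 9) (arg 24))) (reg 9))))
          (store (Mod (Plus (arg 23) (arg 24)) (reg 9))))
        (store (Get 15 (Get 23 (reg 10)))))"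

context pattern
begin

definition load :: "(nat \<times> nat \<Rightarrow> nat) \<Rightarrow> com" where
  "load ex = (let l = Div (reg 10) (reg 5); r = Mod (reg 10) (reg 5);
       entry = (\<lambda>ps \<epsilon>. Mod (eprod (map (epair_factor ex \<epsilon>) ps)) (reg 9))
     in For 10 (reg 18)
       (Seq (Assign 16 (reg 10) (entry pairs_X (eassignment (reg 11) l r (Num 0))))
         (Assign 16 (Plus (reg 18) (reg 10)) (entry pairs_Y (eassignment (reg 11) (Num 0) l r)))))"

text \<open>Words are nonnegative and subtraction truncates, so a negative monomial is added as
  \<open>M\<close> minus its reduced value.\<close>

definition accumulate :: "(nat \<times> nat) monomial \<Rightarrow> com" where
  "accumulate = (\<lambda>(sg, ex).
     let l = Div (reg 10) (reg 5); r = Mod (reg 10) (reg 5);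
       entry = Mod (eprod (map (epair_factor ex (eassignment (reg 11) l (Num 0) r)) pairs_Z)) (reg 9);
       product = Times entry (Get 16 (Get 25 (reg 10)))
     in For 10 (reg 18) (Assign 17 (reg 10)
       (Mod (Plus (Get 17 (reg 10)) (if sg then product else Minus (reg 9) (Mod product (reg 9)))) (reg 9))))"

definition add_monomial :: "(nat \<times> nat) monomial \<Rightarrow> com" where
  "add_monomial mo = Seq (load (snd mo)) (Seq simulate (accumulate mo))"

text \<open>There is no early exit: a later hit overwrites an earlier one, which keeps the time
  bound the same for all inputs.\<close>

definition search_block :: com where
  "search_block = Seq (For 10 (reg 18) (Assign 17 (reg 10) (Num 0)))
     (Seq (seqs (map add_monomial monomials))
       (For 10 (reg 18) (If (Get 17 (reg 10))
         (Seq (Assign 3 (Num 0) (Num 1)) (Seq (Assign 12 (Num 0) (reg 11)) (Assign 13 (Num 0) (reg 10))))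
         Skip)))"

definition write_copy :: com where
  "write_copy = (let \<epsilon> = eassignment (reg 12) (Div (reg 13) (reg 5)) (reg 14) (Mod (reg 13) (reg 5)) in
     If (reg 3)
       (For 14 (reg 5) (If (erainbow \<epsilon>) (seqs (map (\<lambda>i. Assign 4 (Num i) (\<epsilon> i)) [0..<h])) Skip))
       Skip)"

definition search :: com where
  "search = Seq (For 11 (reg 6) search_block) write_copy"

end

text \<open>The arithmetic of the search for one fixed input. \<open>total_less\<close> lets a total
  be recovered from its residue; \<open>word_M\<close> covers the largest intermediate number, a
  product of two residues plus one more summand of at most \<open>M\<close>.\<close>

locale matmul_run = bounded_pattern +
  fixes M D :: nat and "is" :: "instr list" and out :: "nat list" and cs :: "rat list"
    and cst ops xs ys outs :: "nat \<Rightarrow> nat"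
  assumes slp: "slp_multiplies (n ^ k) is out"
    and code: "\<And>l. l < length is \<Longrightarrow> instr_code cs (is ! l) (ops l, xs l, ys l)"
    and outs: "\<And>l. l < n ^ k * n ^ k \<Longrightarrow> outs l = out ! l"
    and cst: "\<And>x. x < length cs \<Longrightarrow> cst x < M \<and> residue_of (int D) (int M) (cs ! x) (int (cst x))"
    and coprime: "coprime (int D) (int M)" and M_pos: "0 < M"
    and total_less: "\<And>z a c. z < n ^ j \<Longrightarrow> total z a c < int M"
    and word_M: "M + M * M \<le> W" and word_cells: "2 * n ^ k * n ^ k + length is < W"
    and word_code: "\<And>l. ops l \<le> W \<and> xs l \<le> W \<and> ys l \<le> W \<and> outs l \<le> W"
    and word_z: "n ^ j < W"
begin

definition N :: nat where "N = n ^ k"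

text \<open>The frame common to the invariants: what the inner loops only read. The parameters are
  the images of the block of \<open>j\<close> vertices and the record of a hit, namely its flag and
  where it occurred.\<close>

definition env :: "nat \<Rightarrow> nat \<Rightarrow> nat \<Rightarrow> nat \<Rightarrow> memory \<Rightarrow> bool" where
  "env z fl zf jf s \<longleftrightarrow> input s \<and> s 5 0 = N \<and> s 6 0 = n ^ j \<and> s 18 0 = N * N \<and> s 9 0 = M \<and> s 15 = cst \<and>
     s 21 0 = length is \<and> s 22 = ops \<and> s 23 = xs \<and> s 24 = ys \<and> s 25 = outs \<and>
     s 11 0 = z \<and> s 3 0 = fl \<and> s 12 0 = zf \<and> s 13 0 = jf"

lemma env_update [simp]:
  "a \<in> {4, 10, 14, 16, 17} \<Longrightarrow> env z fl zf jf (s(a := x)) = env z fl zf jf s"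
  by (auto simp: env_def input_def)

lemma env_simps:
  assumes "env z fl zf jf s"
  shows "input s" "s 5 0 = N" "s 6 0 = n ^ j" "s 18 0 = N * N" "s 9 0 = M" "s 15 = cst"
    "s 21 0 = length is" "s 22 = ops" "s 23 = xs" "s 24 = ys" "s 25 = outs"
    "s 11 0 = z" "s 3 0 = fl" "s 12 0 = zf" "s 13 0 = jf"
  using assms by (auto simp: env_def)

definition mat_X :: "nat \<Rightarrow> (nat \<times> nat \<Rightarrow> nat) \<Rightarrow> rat mat" where
  "mat_X z ex = mat N N (\<lambda>(a, b). of_nat (entry_X ex z a b))"
definition mat_Y :: "nat \<Rightarrow> (nat \<times> nat \<Rightarrow> nat) \<Rightarrow> rat mat" where
  "mat_Y z ex = mat N N (\<lambda>(b, c). of_nat (entry_Y ex z b c))"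

definition slp_inputs :: "nat \<Rightarrow> (nat \<times> nat \<Rightarrow> nat) \<Rightarrow> rat list" where
  "slp_inputs z ex = row_major N (mat_X z ex) @ row_major N (mat_Y z ex)"

definition slp_cells :: "nat \<Rightarrow> (nat \<times> nat \<Rightarrow> nat) \<Rightarrow> rat list" where
  "slp_cells z ex = slp_run (slp_inputs z ex) is"

text \<open>Array 16 is compared with the finished rational run, of which the first \<open>m\<close>
  cells have been imitated.\<close>

definition holds_cells :: "nat \<Rightarrow> (nat \<times> nat \<Rightarrow> nat) \<Rightarrow> nat \<Rightarrow> memory \<Rightarrow> bool" where
  "holds_cells z ex m s \<longleftrightarrow>
     (\<forall>l<m. s 16 l < M \<and> residue_of (int D) (int M) (slp_cells z ex ! l) (int (s 16 l)))"

lemma length_slp_inputs: "length (slp_inputs z ex) = 2 * N * N"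
  by (simp add: slp_inputs_def row_major_def)

lemma W_facts: "M \<le> W" "2 * N * N + length is < W" "N * N < W" "2 \<le> W" "N \<le> W" "2 * N * N \<le> W"
proof -
  show "M \<le> W" using word_M by simp
  show w: "2 * N * N + length is < W" using word_cells unfolding N_def by simp
  then show "N * N < W" "2 * N * N \<le> W" by auto
  then show "N \<le> W" using le_square[of N] by linarith
  show "2 \<le> W" using B_le_W two_le by linarith
qed

text \<open>For \<open>n = 0\<close> the hypotheses force \<open>k = j = 0\<close>, which leaves no
  vertex \<open>i\<close>.\<close>

lemma assignment_less': "z < n ^ j \<Longrightarrow> 0 < N \<Longrightarrow> i < h \<Longrightarrow> assignment n z a b c i < n"
  by (rule assignment_less, rule ccontr) (auto simp: N_def power_0_left split: if_splits)

lemma eprod_entry: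
  assumes "input s" "s 9 0 = M" "z < n ^ j" "0 < N" "set ps \<subseteq> set (pairs h)" "length ps \<le> h * h"
    and "\<And>p. ex p \<le> 2 * length edge_pairs"
    and "fits W ez s" "val ez s = z" "fits W ea s" "val ea s = a" "fits W eb s" "val eb s = b"
    and "fits W ec s" "val ec s = c"
  shows "fits W (Mod (eprod (map (epair_factor ex (eassignment ez ea eb ec)) ps)) (reg 9)) s \<and>
    val (Mod (eprod (map (epair_factor ex (eassignment ez ea eb ec)) ps)) (reg 9)) s =
      (\<Prod>p\<leftarrow>ps. pair_factor ex (assignment n z a b c) p) mod M"
proof -
  have "fits W (eprod (map (epair_factor ex (eassignment ez ea eb ec)) ps)) s \<and>
    val (eprod (map (epair_factor ex (eassignment ez ea eb ec)) ps)) s =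
      (\<Prod>p\<leftarrow>ps. pair_factor ex (assignment n z a b c) p)"
    using assms eassignment[of s ez ea eb ec] assignment_less'
    by (intro eprod_pair_factors) auto
  then show ?thesis using assms(2) W_facts by simp
qed

lemma length_pairs_XYZ: "length pairs_X \<le> h * h" "length pairs_Y \<le> h * h" "length pairs_Z \<le> h * h"
  unfolding pairs_X_def pairs_Y_def pairs_Z_def
  using length_pairs[of h] length_filter_le le_trans by blast+

lemma set_pairs_XYZ:
  "set pairs_X \<subseteq> set (pairs h)" "set pairs_Y \<subseteq> set (pairs h)" "set pairs_Z \<subseteq> set (pairs h)"
  unfolding pairs_X_def pairs_Y_def pairs_Z_def by auto

text \<open>\<open>R\<close> carries through what is known about the totals in array 17, which
  loading does not touch.\<close>

lemma load:
  assumes z: "z < n ^ j" and ex: "\<And>p. ex p \<le> 2 * length edge_pairs"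
  shows "triple W (\<lambda>s. env z fl zf jf s \<and> R (s 17)) (load ex) (2 + N * N * 4)
    (\<lambda>s. env z fl zf jf s \<and> R (s 17) \<and> holds_cells z ex (2 * N * N) s)"
proof -
  let ?X = "\<lambda>l. entry_X ex z (l div N) (l mod N) mod M"
  let ?Y = "\<lambda>l. entry_Y ex z (l div N) (l mod N) mod M"
  let ?I = "\<lambda>i s. env z fl zf jf s \<and> R (s 17) \<and> (\<forall>l<i. s 16 l = ?X l \<and> s 16 (N * N + l) = ?Y l)"
  have "triple W (\<lambda>s. env z fl zf jf s \<and> R (s 17)) (load ex) (2 + N * N * (1 + 1 + 2))
    (\<lambda>s. env z fl zf jf s \<and> R (s 17) \<and> holds_cells z ex (2 * N * N) s)"
    unfolding load_def Let_def
  proof (rule triple_For[where I = ?I and L = "N * N"])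
    fix i assume i: "i < N * N"
    then have N: "0 < N" by (cases N) auto
    let ?l = "Div (reg 10) (reg 5)" and ?r = "Mod (reg 10) (reg 5)"
    show "triple W (\<lambda>s. ?I i s \<and> s 10 0 = i)
      (Seq (Assign 16 (reg 10) (Mod (eprod (map (epair_factor ex (eassignment (reg 11) ?l ?r (Num 0))) pairs_X)) (reg 9)))
         (Assign 16 (Plus (reg 18) (reg 10)) (Mod (eprod (map (epair_factor ex (eassignment (reg 11) (Num 0) ?l ?r)) pairs_Y)) (reg 9))))
      (1 + 1) (\<lambda>s. s 10 0 = i \<and> ?I (Suc i) (s(10 := (s 10)(0 := Suc i))))"
    proof (rule triple_Seq[where Q = "\<lambda>s. ?I i s \<and> s 10 0 = i \<and> s 16 i = ?X i"];
        rule triple_Assign)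
      fix s assume s: "?I i s \<and> s 10 0 = i"
      note e = env_simps[OF conjunct1[OF conjunct1[OF s]]]
      have z_le: "z \<le> W" using z word_z by simp
      show "fits W (reg 10) s \<and>
        fits W (Mod (eprod (map (epair_factor ex (eassignment (reg 11) ?l ?r (Num 0))) pairs_X)) (reg 9)) s \<and>
        (?I i (s(16 := (s 16)(val (reg 10) s := val (Mod (eprod (map (epair_factor ex (eassignment (reg 11) ?l ?r (Num 0))) pairs_X)) (reg 9)) s))) \<and>
         (s(16 := (s 16)(val (reg 10) s := val (Mod (eprod (map (epair_factor ex (eassignment (reg 11) ?l ?r (Num 0))) pairs_X)) (reg 9)) s))) 10 0 = i \<and>
         (s(16 := (s 16)(val (reg 10) s := val (Mod (eprod (map (epair_factor ex (eassignment (reg 11) ?l ?r (Num 0))) pairs_X)) (reg 9)) s))) 16 i = ?X i)"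
        using eprod_entry[of s z pairs_X ex "reg 11" ?l "i div N" ?r "i mod N" "Num 0" 0]
          e z ex N s i W_facts z_le set_pairs_XYZ length_pairs_XYZ
        by (auto simp: entry_X_def)
    next
      fix s assume s: "?I i s \<and> s 10 0 = i \<and> s 16 i = ?X i"
      note e = env_simps[OF conjunct1[OF conjunct1[OF s]]]
      have z_le: "z \<le> W" using z word_z by simp
      let ?e = "Mod (eprod (map (epair_factor ex (eassignment (reg 11) (Num 0) ?l ?r)) pairs_Y)) (reg 9)"
      let ?s = "s(16 := (s 16)(val (Plus (reg 18) (reg 10)) s := val ?e s))"
      show "fits W (Plus (reg 18) (reg 10)) s \<and> fits W ?e s \<and>
        ?s 10 0 = i \<and> ?I (Suc i) (?s(10 := (?s 10)(0 := Suc i)))"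
        using eprod_entry[of s z pairs_Y ex "reg 11" "Num 0" 0 ?l "i div N" ?r "i mod N"]
          e z ex N s i W_facts z_le set_pairs_XYZ length_pairs_XYZ
        by (auto simp: entry_Y_def less_Suc_eq)
    qed
  next
    fix s assume s: "?I (N * N) s" and "s 10 0 = N * N"
    show "env z fl zf jf s \<and> R (s 17) \<and> holds_cells z ex (2 * N * N) s"
    proof (intro conjI)
      show "holds_cells z ex (2 * N * N) s"
        unfolding holds_cells_def
      proof (intro allI impI)
        fix l assume l: "l < 2 * N * N"
        have run: "slp_cells z ex ! l = slp_inputs z ex ! l"
          unfolding slp_cells_def using l by (simp add: slp_run_nth length_slp_inputs)
        have *: "m div N < N \<and> m mod N < N" if "m < N * N" for m
        proof -
          have "0 < N" using that by (cases N) auto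
          then show ?thesis using that by (simp add: less_mult_imp_div_less)
        qed
        have "\<exists>a. slp_inputs z ex ! l = of_int (int a) \<and> s 16 l = a mod M"
        proof (cases "l < N * N")
          case True
          then show ?thesis
            using s *[OF True]
            by (intro exI[of _ "entry_X ex z (l div N) (l mod N)"])
              (auto simp: slp_inputs_def row_major_def nth_append mat_X_def)
        next
          case False
          let ?m = "l - N * N"
          have m: "?m < N * N" using l False by simp
          then show ?thesis
            using s *[OF m] False m
            by (intro exI[of _ "entry_Y ex z (?m div N) (?m mod N)"])
              (auto simp: slp_inputs_def row_major_def nth_append mat_Y_def dest: spec[of _ ?m])
        qed
        then obtain a where a: "slp_inputs z ex ! l = of_int (int a)" "s 16 l = a mod M" by blast
        have "residue_of (int D) (int M) (of_int (int a)) (int (a mod M))"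
          by (rule residue_of_cong[OF residue_of_int])
            (simp add: zmod_int mod_eq_dvd_iff[symmetric] del: of_nat_mod)
        then show "s 16 l < M \<and> residue_of (int D) (int M) (slp_cells z ex ! l) (int (s 16 l))"
          using a run M_pos by simp
      qed
    qed (use s in auto)
  qed (use W_facts in \<open>auto simp: env_simps\<close>)
  then show ?thesis by (simp add: algebra_simps)
qed

end

lemma mod_accumulate_plus:
  assumes "int M dvd int r - g" and "int M dvd int v - S"
  shows "int M dvd int ((r + (Z mod M) * v) mod M) - (g + int Z * S)"
proof -
  have "int ((r + (Z mod M) * v) mod M) mod int M = (int r + (int Z mod int M) * int v) mod int M"
    by (simp add: zmod_int)
  also have "\<dots> = (g + int Z * S) mod int M"
    using assms by (intro mod_add_cong mod_mult_cong) (auto simp: mod_eq_dvd_iff)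
  finally show ?thesis by (simp only: mod_eq_dvd_iff)
qed

lemma mod_accumulate_minus:
  assumes "int M dvd int r - g" and "int M dvd int v - S" and "0 < M"
  shows "int M dvd int ((r + (M - (Z mod M) * v mod M)) mod M) - (g - int Z * S)"
proof -
  have "(Z mod M) * v mod M \<le> M" using assms(3) by (simp add: less_imp_le)
  then have "int ((r + (M - (Z mod M) * v mod M)) mod M) mod int M = (int r + (int M - int Z * int v)) mod int M"
    by (simp add: zmod_int of_nat_diff mod_simps algebra_simps)
  also have "\<dots> = (int r - int Z * int v) mod int M"
    by (simp add: mod_eq_dvd_iff)
  also have "\<dots> = (g - int Z * S) mod int M"
    using assms by (intro mod_diff_cong mod_mult_cong) (auto simp: mod_eq_dvd_iff)
  finally show ?thesis by (simp only: mod_eq_dvd_iff)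
qed

context coloured_pattern
begin

lemma rainbow_copy_cong:
  assumes "\<And>i. i < h \<Longrightarrow> \<phi> i = \<psi> i"
  shows "rainbow_copy \<phi> \<longleftrightarrow> rainbow_copy \<psi>"
proof -
  have "\<phi> (fst p) = \<psi> (fst p) \<and> \<phi> (snd p) = \<psi> (snd p)" if "p \<in> set EH" for p
    using assms fst_snd_EH[OF that] by auto
  then have "(\<forall>(u, v)\<in>set EH. adj (\<phi> u * n + \<phi> v) \<noteq> 0) \<longleftrightarrow> (\<forall>(u, v)\<in>set EH. adj (\<psi> u * n + \<psi> v) \<noteq> 0)"
    and "inj_on (colour \<phi>) (set EH) \<longleftrightarrow> inj_on (colour \<psi>) (set EH)"
    by (auto intro!: inj_on_cong simp: colour_def case_prod_unfold)
  moreover have "inj_on \<phi> {..<h} \<longleftrightarrow> inj_on \<psi> {..<h}"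
    using assms by (intro inj_on_cong) auto
  ultimately show ?thesis unfolding rainbow_copy_def by blast
qed

end

section \<open>Running the straight-line program and summing the monomials\<close>

context matmul_run
begin

lemma word_2M: "M + M \<le> W"
  using word_M le_square[of M] by linarith

lemma cell_step:
  assumes "i < length is"
  shows "refs (is ! i) \<subseteq> {..<2 * N * N + i} \<and>
    slp_cells z ex ! (2 * N * N + i) = instr_val (slp_cells z ex) (is ! i)"
  using slp_run_step[of "slp_inputs z ex" "is" i] assms slp
  unfolding slp_cells_def slp_multiplies_def length_slp_inputs N_def by auto

lemma holds_cells_store:
  assumes "holds_cells z ex m s" "v < M" "residue_of (int D) (int M) (slp_cells z ex ! m) (int v)"
  shows "holds_cells z ex (Suc m) (s(16 := (s 16)(m := v)))"
  using assms by (auto simp: holds_cells_def less_Suc_eq)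

lemma holds_cells_update [simp]: "a \<noteq> 16 \<Longrightarrow> holds_cells z ex m (s(a := x)) = holds_cells z ex m s"
  by (simp add: holds_cells_def)

lemma residue_of_mod: "residue_of d (int M) v (int w) \<Longrightarrow> residue_of d (int M) v (int (w mod M))"
  by (erule residue_of_cong) (simp add: zmod_int mod_eq_dvd_iff[symmetric] del: of_nat_mod)

text \<open>Residues respect the ring operations, so one modular operation per instruction preserves
  the invariant. Opcodes 0 to 3 are told apart by testing the opcode, then the opcode minus 1 and
  minus 2; three tests, one assignment and the loop overhead of 2 make 6 steps.\<close>

lemma simulate:
  "triple W (\<lambda>s. env z fl zf jf s \<and> R (s 17) \<and> holds_cells z ex (2 * N * N) s)
    simulate (2 + length is * 6)
    (\<lambda>s. env z fl zf jf s \<and> R (s 17) \<and> holds_cells z ex (2 * N * N + length is) s)"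
proof -
  let ?I = "\<lambda>i s. env z fl zf jf s \<and> R (s 17) \<and> holds_cells z ex (2 * N * N + i) s"
  let ?a = "\<lambda>a. Get 16 (Get a (reg 10))"
  let ?t = "Plus (Times (Num 2) (reg 18)) (reg 10)"
  have "triple W (\<lambda>s. env z fl zf jf s \<and> R (s 17) \<and> holds_cells z ex (2 * N * N) s)
    simulate (2 + length is * (Suc (Suc (Suc 1)) + 2))
    (\<lambda>s. env z fl zf jf s \<and> R (s 17) \<and> holds_cells z ex (2 * N * N + length is) s)"
    unfolding simulate_def Let_def
  proof (rule triple_For[where I = ?I and L = "length is"])
    fix i assume i: "i < length is"
    let ?P = "\<lambda>s. ?I i s \<and> s 10 0 = i"
    let ?Q = "\<lambda>s. s 10 0 = i \<and> ?I (Suc i) (s(10 := (s 10)(0 := Suc i)))"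
    note step = cell_step[OF i, of z ex]
    have i_le: "i \<le> W" using i W_facts by simp
    have base: "fits W (Get 22 (reg 10)) s \<and> val (Get 22 (reg 10)) s = ops i" if "?P s" for s
      using that i_le word_code[of i] by (auto simp: env_simps)
    have base1: "fits W (Minus (Get 22 (reg 10)) (Num 1)) s \<and> val (Minus (Get 22 (reg 10)) (Num 1)) s = ops i - 1"
      and base2: "fits W (Minus (Get 22 (reg 10)) (Num 2)) s \<and> val (Minus (Get 22 (reg 10)) (Num 2)) s = ops i - 2"
      if "?P s" for s
      using base[OF that] W_facts by simp_all
    have tgt: "fits W ?t s \<and> val ?t s = 2 * N * N + i" if "?P s" for s
    proof -
      have "2 * (N * N) + i \<le> W" using i W_facts by (simp add: mult.assoc)
      then show ?thesis using that i_le W_facts by (auto simp: env_simps mult.assoc)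
    qed
    have store: "triple W Q (Assign 16 ?t e) 1 ?Q"
      if "\<And>s. Q s \<Longrightarrow> ?P s" and "\<And>s. Q s \<Longrightarrow> fits W e s \<and> val e s < M \<and>
        residue_of (int D) (int M) (instr_val (slp_cells z ex) (is ! i)) (int (val e s))" for Q e
    proof (rule triple_Assign)
      fix s assume Q: "Q s"
      note P = that(1)[OF Q]
      have "holds_cells z ex (Suc (2 * N * N + i)) (s(16 := (s 16)(2 * N * N + i := val e s)))"
        using P that(2)[OF Q] step by (intro holds_cells_store) auto
      then show "fits W ?t s \<and> fits W e s \<and> ?Q (s(16 := (s 16)(val ?t s := val e s)))"
        unfolding conjunct2[OF tgt[OF P]]
        using P that(2)[OF Q] conjunct1[OF tgt[OF P]] by (auto simp del: val.simps fits.simps)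
    qed
    have arg: "fits W (?a a) s \<and> val (?a a) s < M \<and>
        residue_of (int D) (int M) (slp_cells z ex ! r) (int (val (?a a) s))"
      if "?P s" "a \<in> {23, 24}" "s a i = r" "r < 2 * N * N + i" for s a r
    proof -
      have "s 16 r < M" "residue_of (int D) (int M) (slp_cells z ex ! r) (int (s 16 r))"
        using that(1,4) unfolding holds_cells_def by auto
      moreover have "r \<le> W" using that(4) i W_facts by simp
      ultimately show ?thesis using that i_le W_facts by auto
    qed
    note instr = code[OF i]
    show "triple W ?P
      (If (Get 22 (reg 10))
        (If (Minus (Get 22 (reg 10)) (Num 1))
          (If (Minus (Get 22 (reg 10)) (Num 2))
            (Assign 16 ?t (Mod (Times (?a 23) (?a 24)) (reg 9)))
            (Assign 16 ?t (Mod (Plus (?a 23) (Minus (reg 9) (?a 24))) (reg 9))))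
          (Assign 16 ?t (Mod (Plus (?a 23) (?a 24)) (reg 9))))
        (Assign 16 ?t (Get 15 (Get 23 (reg 10))))) (Suc (Suc (Suc 1))) ?Q"
    proof (cases "is ! i")
      case (Const r)
      then have c: "ops i = 0" "xs i < length cs" "cs ! xs i = r" using instr by auto
      have "triple W ?P (Assign 16 ?t (Get 15 (Get 23 (reg 10)))) 1 ?Q"
      proof (rule store)
        fix s assume P: "?P s"
        then have "s 23 = xs" "s 15 = cst" by (auto simp: env_simps)
        then show "fits W (Get 15 (Get 23 (reg 10))) s \<and> val (Get 15 (Get 23 (reg 10))) s < M \<and>
            residue_of (int D) (int M) (instr_val (slp_cells z ex) (is ! i)) (int (val (Get 15 (Get 23 (reg 10))) s))"
          using P c Const cst[OF c(2)] i_le W_facts word_code[of i] by auto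
      qed auto
      then have "triple W ?P (If (Get 22 (reg 10)) c1 (Assign 16 ?t (Get 15 (Get 23 (reg 10))))) (Suc 1) ?Q" for c1
        by (rule triple_If_zero) (use base c(1) in \<open>auto simp del: val.simps fits.simps\<close>)
      then show ?thesis by (rule triple_time) simp
    next
      case (Add x y)
      then have c: "ops i = 1" "xs i = x" "ys i = y" and r: "x < 2 * N * N + i" "y < 2 * N * N + i"
        using instr step by auto
      have "triple W ?P (Assign 16 ?t (Mod (Plus (?a 23) (?a 24)) (reg 9))) 1 ?Q"
      proof (rule store)
        fix s assume P: "?P s"
        then have e: "s 23 = xs" "s 24 = ys" "s 9 0 = M" by (auto simp: env_simps)
        note x = arg[OF P, of 23 x] and y = arg[OF P, of 24 y]
        let ?v = "val (?a 23) s" and ?w = "val (?a 24) s"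
        have vw: "?v < M" "?w < M" using x y e c r by (auto simp del: val.simps)
        have fw: "fits W (?a 23) s" "fits W (?a 24) s" using x y e c r by (auto simp del: val.simps fits.simps)
        have res: "residue_of (int D) (int M) (slp_cells z ex ! x) (int ?v)"
          "residue_of (int D) (int M) (slp_cells z ex ! y) (int ?w)"
          using x y e c r by (auto simp del: val.simps)
        have m: "fits W (reg 9) s" "val (reg 9) s = M" using e W_facts by auto
        have "?v + ?w \<le> W" using vw word_2M by linarith
        moreover have "residue_of (int D) (int M) (instr_val (slp_cells z ex) (is ! i)) (int ((?v + ?w) mod M))"
          using residue_of_mod[of _ _ "?v + ?w"] residue_of_add[OF res] Add by simp
        ultimately show "fits W (Mod (Plus (?a 23) (?a 24)) (reg 9)) s \<and> val (Mod (Plus (?a 23) (?a 24)) (reg 9)) s < M \<and>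
            residue_of (int D) (int M) (instr_val (slp_cells z ex) (is ! i)) (int (val (Mod (Plus (?a 23) (?a 24)) (reg 9)) s))"
          using fw m M_pos by (simp del: val.simps(2) fits.simps(2))
      qed auto
      then have "triple W ?P (If (Minus (Get 22 (reg 10)) (Num 1)) c1 (Assign 16 ?t (Mod (Plus (?a 23) (?a 24)) (reg 9)))) (Suc 1) ?Q" for c1
        by (rule triple_If_zero) (use base1 base2 c(1) in \<open>auto simp del: val.simps fits.simps\<close>)
      then have "triple W ?P (If (Get 22 (reg 10)) (If (Minus (Get 22 (reg 10)) (Num 1)) c1 (Assign 16 ?t (Mod (Plus (?a 23) (?a 24)) (reg 9)))) c2) (Suc (Suc 1)) ?Q" for c1 c2
        by (rule triple_If_nonzero) (use base c(1) in \<open>auto simp del: val.simps fits.simps\<close>)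
      then show ?thesis by (rule triple_time) simp
    next
      case (Sub x y)
      then have c: "ops i = 2" "xs i = x" "ys i = y" and r: "x < 2 * N * N + i" "y < 2 * N * N + i"
        using instr step by auto
      have "triple W ?P (Assign 16 ?t (Mod (Plus (?a 23) (Minus (reg 9) (?a 24))) (reg 9))) 1 ?Q"
      proof (rule store)
        fix s assume P: "?P s"
        then have e: "s 23 = xs" "s 24 = ys" "s 9 0 = M" by (auto simp: env_simps)
        note x = arg[OF P, of 23 x] and y = arg[OF P, of 24 y]
        let ?v = "val (?a 23) s" and ?w = "val (?a 24) s"
        have vw: "?v < M" "?w < M" using x y e c r by (auto simp del: val.simps)
        have fw: "fits W (?a 23) s" "fits W (?a 24) s" using x y e c r by (auto simp del: val.simps fits.simps)
        have res: "residue_of (int D) (int M) (slp_cells z ex ! x) (int ?v)"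
          "residue_of (int D) (int M) (slp_cells z ex ! y) (int ?w)"
          using x y e c r by (auto simp del: val.simps)
        have m: "fits W (reg 9) s" "val (reg 9) s = M" using e W_facts by auto
        have "?v + (M - ?w) \<le> W" using vw word_2M by linarith
        \<comment> \<open>Adding \<open>M - ?w\<close> avoids truncation and differs from
          subtracting \<open>?w\<close> by a multiple of \<open>M\<close>.\<close>
        moreover have "residue_of (int D) (int M) (instr_val (slp_cells z ex) (is ! i)) (int ((?v + (M - ?w)) mod M))"
          using residue_of_mod[of _ _ "?v + (M - ?w)"] residue_of_cong[OF residue_of_diff[OF res], of "int (?v + (M - ?w))"] vw Sub
          by (simp add: of_nat_diff)
        ultimately show "fits W (Mod (Plus (?a 23) (Minus (reg 9) (?a 24))) (reg 9)) s \<and> val (Mod (Plus (?a 23) (Minus (reg 9) (?a 24))) (reg 9)) s < M \<and>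
            residue_of (int D) (int M) (instr_val (slp_cells z ex) (is ! i)) (int (val (Mod (Plus (?a 23) (Minus (reg 9) (?a 24))) (reg 9)) s))"
          using fw m M_pos by (simp del: val.simps(2) fits.simps(2))
      qed auto
      then have "triple W ?P (If (Minus (Get 22 (reg 10)) (Num 2)) c1 (Assign 16 ?t (Mod (Plus (?a 23) (Minus (reg 9) (?a 24))) (reg 9)))) (Suc 1) ?Q" for c1
        by (rule triple_If_zero) (use base1 base2 c(1) in \<open>auto simp del: val.simps fits.simps\<close>)
      then have "triple W ?P (If (Minus (Get 22 (reg 10)) (Num 1)) (If (Minus (Get 22 (reg 10)) (Num 2)) c1 (Assign 16 ?t (Mod (Plus (?a 23) (Minus (reg 9) (?a 24))) (reg 9)))) c2) (Suc (Suc 1)) ?Q" for c1 c2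
        by (rule triple_If_nonzero) (use base1 base2 c(1) in \<open>auto simp del: val.simps fits.simps\<close>)
      then show ?thesis
        by (rule triple_If_nonzero) (use base c(1) in \<open>auto simp del: val.simps fits.simps\<close>)
    next
      case (Mul x y)
      then have c: "ops i = 3" "xs i = x" "ys i = y" and r: "x < 2 * N * N + i" "y < 2 * N * N + i"
        using instr step by auto
      have "triple W ?P (Assign 16 ?t (Mod (Times (?a 23) (?a 24)) (reg 9))) 1 ?Q"
      proof (rule store)
        fix s assume P: "?P s"
        then have e: "s 23 = xs" "s 24 = ys" "s 9 0 = M" by (auto simp: env_simps)
        note x = arg[OF P, of 23 x] and y = arg[OF P, of 24 y]
        let ?v = "val (?a 23) s" and ?w = "val (?a 24) s"
        have vw: "?v < M" "?w < M" using x y e c r by (auto simp del: val.simps)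
        have fw: "fits W (?a 23) s" "fits W (?a 24) s" using x y e c r by (auto simp del: val.simps fits.simps)
        have res: "residue_of (int D) (int M) (slp_cells z ex ! x) (int ?v)"
          "residue_of (int D) (int M) (slp_cells z ex ! y) (int ?w)"
          using x y e c r by (auto simp del: val.simps)
        have m: "fits W (reg 9) s" "val (reg 9) s = M" using e W_facts by auto
        have "?v * ?w \<le> W" using mult_le_mono[of ?v M ?w M] vw word_M by simp
        moreover have "residue_of (int D) (int M) (instr_val (slp_cells z ex) (is ! i)) (int ((?v * ?w) mod M))"
          using residue_of_mod[of _ _ "?v * ?w"] residue_of_mult[OF res] Mul by simp
        ultimately show "fits W (Mod (Times (?a 23) (?a 24)) (reg 9)) s \<and> val (Mod (Times (?a 23) (?a 24)) (reg 9)) s < M \<and>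
            residue_of (int D) (int M) (instr_val (slp_cells z ex) (is ! i)) (int (val (Mod (Times (?a 23) (?a 24)) (reg 9)) s))"
          using fw m M_pos by (simp del: val.simps(2) fits.simps(2))
      qed auto
      then have "triple W ?P (If (Minus (Get 22 (reg 10)) (Num 2)) (Assign 16 ?t (Mod (Times (?a 23) (?a 24)) (reg 9))) c1) (Suc 1) ?Q" for c1
        by (rule triple_If_nonzero) (use base1 base2 c(1) in \<open>auto simp del: val.simps fits.simps\<close>)
      then have "triple W ?P (If (Minus (Get 22 (reg 10)) (Num 1)) (If (Minus (Get 22 (reg 10)) (Num 2)) (Assign 16 ?t (Mod (Times (?a 23) (?a 24)) (reg 9))) c1) c2) (Suc (Suc 1)) ?Q" for c1 c2
        by (rule triple_If_nonzero) (use base1 base2 c(1) in \<open>auto simp del: val.simps fits.simps\<close>)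
      then show ?thesis
        by (rule triple_If_nonzero) (use base c(1) in \<open>auto simp del: val.simps fits.simps\<close>)
    qed
  qed (use W_facts in \<open>auto simp: env_simps\<close>)
  then show ?thesis by (simp add: numeral_eq_Suc)
qed

text \<open>The output cell equals an integer, a sum of products of entries; therefore its residue
  determines it modulo \<open>M\<close>, whatever fractions occurred on the way.\<close>

lemma product_cell:
  assumes "holds_cells z ex (2 * N * N + length is) s" "l < N * N"
  shows "out ! l < 2 * N * N + length is \<and> s 16 (out ! l) < M \<and>
    int M dvd int (s 16 (out ! l)) -
      (\<Sum>b<N. int (entry_X ex z (l div N) b) * int (entry_Y ex z b (l mod N)))"
proof -
  have N: "l div N < N" "l mod N < N"
  proof -
    have "0 < N" using assms(2) by (cases N) auto
    then show "l div N < N" "l mod N < N" using assms(2) by (simp_all add: less_mult_imp_div_less)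
  qed
  have out: "out ! l < 2 * N * N + length is"
    using slp assms(2) unfolding slp_multiplies_def N_def by simp
  have "mat_X z ex \<in> carrier_mat N N" "mat_Y z ex \<in> carrier_mat N N"
    by (auto simp: mat_X_def mat_Y_def)
  then have "slp_cells z ex ! (out ! (l div N * N + l mod N)) = (mat_X z ex * mat_Y z ex) $$ (l div N, l mod N)"
    using slp N unfolding slp_multiplies_def slp_cells_def slp_inputs_def N_def[symmetric] by blast
  also have "\<dots> = (\<Sum>b<N. of_nat (entry_X ex z (l div N) b) * of_nat (entry_Y ex z b (l mod N)))"
    using N by (simp add: mat_X_def mat_Y_def scalar_prod_def atLeast0LessThan)
  also have "\<dots> = of_int (\<Sum>b<N. int (entry_X ex z (l div N) b) * int (entry_Y ex z b (l mod N)))"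
    by simp
  finally have "slp_cells z ex ! (out ! l) =
    of_int (\<Sum>b<N. int (entry_X ex z (l div N) b) * int (entry_Y ex z b (l mod N)))"
    by (simp only: div_mult_mod_eq)
  then show ?thesis
    using assms(1) out residue_of_integer[OF _ coprime] unfolding holds_cells_def by metis
qed

definition holds_sums :: "(nat \<Rightarrow> int) \<Rightarrow> (nat \<Rightarrow> nat) \<Rightarrow> bool" where
  "holds_sums g r \<longleftrightarrow> (\<forall>l<N * N. r l < M \<and> int M dvd int (r l) - g l)"

lemma accumulate:
  assumes z: "z < n ^ j" and ex: "\<And>p. snd mo p \<le> 2 * length edge_pairs"
  shows "triple W (\<lambda>s. env z fl zf jf s \<and> holds_sums g (s 17) \<and> holds_cells z (snd mo) (2 * N * N + length is) s)
    (accumulate mo) (2 + N * N * 3)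
    (\<lambda>s. env z fl zf jf s \<and> holds_sums (\<lambda>l. g l + monomial_total z (l div N) (l mod N) mo) (s 17))"
proof -
  obtain sg ex where mo: "mo = (sg, ex)" by fastforce
  have ex': "ex p \<le> 2 * length edge_pairs" for p using assms(2) mo by simp
  let ?g = "\<lambda>l. g l + monomial_total z (l div N) (l mod N) mo"
  let ?I = "\<lambda>i s. env z fl zf jf s \<and> holds_sums (\<lambda>l. if l < i then ?g l else g l) (s 17)
    \<and> holds_cells z ex (2 * N * N + length is) s"
  let ?l = "Div (reg 10) (reg 5)" and ?r = "Mod (reg 10) (reg 5)"
  let ?z = "Mod (eprod (map (epair_factor ex (eassignment (reg 11) ?l (Num 0) ?r)) pairs_Z)) (reg 9)"
  let ?p = "Times ?z (Get 16 (Get 25 (reg 10)))"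
  let ?e = "Mod (Plus (Get 17 (reg 10)) (if sg then ?p else Minus (reg 9) (Mod ?p (reg 9)))) (reg 9)"
  have acc: "accumulate mo = For 10 (reg 18) (Assign 17 (reg 10) ?e)"
    by (simp only: accumulate_def mo prod.case Let_def)
  have "triple W (\<lambda>s. env z fl zf jf s \<and> holds_sums g (s 17) \<and> holds_cells z ex (2 * N * N + length is) s)
    (accumulate mo) (2 + N * N * (1 + 2))
    (\<lambda>s. env z fl zf jf s \<and> holds_sums ?g (s 17))"
    unfolding acc
  proof (rule triple_For[where I = ?I and L = "N * N"])
    fix i assume i: "i < N * N"
    then have N: "0 < N" by (cases N) auto
    show "triple W (\<lambda>s. ?I i s \<and> s 10 0 = i) (Assign 17 (reg 10) ?e) 1
      (\<lambda>s. s 10 0 = i \<and> ?I (Suc i) (s(10 := (s 10)(0 := Suc i))))"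
    proof (rule triple_Assign)
      fix s assume s: "?I i s \<and> s 10 0 = i"
      then have env: "env z fl zf jf s" and cells: "holds_cells z ex (2 * N * N + length is) s"
        and sums: "holds_sums (\<lambda>l. if l < i then ?g l else g l) (s 17)" and i10: "s 10 0 = i" by auto
      note e = env_simps[OF env]
      let ?Z = "entry_Z ex z (i div N) (i mod N)"
      let ?S = "\<Sum>b<N. int (entry_X ex z (i div N) b) * int (entry_Y ex z b (i mod N))"
      let ?v = "s 16 (out ! i)"
      have W: "z \<le> W" "i \<le> W" "outs i \<le> W" "outs i = out ! i"
        using z word_z i W_facts word_code[of i] outs[of i] by (auto simp: N_def)
      note c = product_cell[OF cells i]
      have zz: "fits W ?z s" "val ?z s = ?Z mod M"
        using eprod_entry[of s z pairs_Z ex "reg 11" ?l "i div N" "Num 0" 0 ?r "i mod N"]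
          e z ex' N i10 W W_facts set_pairs_XYZ length_pairs_XYZ by (simp_all add: entry_Z_def)
      have "(?Z mod M) * ?v \<le> M * M" using c M_pos by (intro mult_le_mono) (auto simp: less_imp_le)
      then have pW: "(?Z mod M) * ?v + M \<le> W" using word_M by linarith
      have p: "fits W ?p s" "val ?p s = (?Z mod M) * ?v"
        using zz pW e i10 W W_facts c by (auto simp del: val.simps(7) fits.simps(7) val_eprod)
      have r: "s 17 i < M" "int M dvd int (s 17 i) - g i"
        using sums i unfolding holds_sums_def by auto
      have mt: "monomial_total z (i div N) (i mod N) mo = (if sg then int ?Z * ?S else - (int ?Z * ?S))"
        by (simp add: mo monomial_total_def N_def)
      have "fits W (Mod (Plus (Get 17 (reg 10)) (if sg then p else Minus (reg 9) (Mod p (reg 9)))) (reg 9)) s \<and>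
          val (Mod (Plus (Get 17 (reg 10)) (if sg then p else Minus (reg 9) (Mod p (reg 9)))) (reg 9)) s =
            (s 17 i + (if sg then q else M - q mod M)) mod M"
        if "fits W p s" "val p s = q" "q + M \<le> W" for p q
        using that r e(5) i10 W W_facts word_2M by auto
      from this[OF p pW] have fe: "fits W ?e s"
        and ve: "val ?e s = (s 17 i + (if sg then (?Z mod M) * ?v else M - (?Z mod M) * ?v mod M)) mod M"
        by blast+
      have ee: "fits W ?e s \<and> val ?e s < M \<and> int M dvd int (val ?e s) - ?g i"
        using fe c mt M_pos mod_accumulate_plus[OF r(2), of ?v ?S ?Z] mod_accumulate_minus[OF r(2), of ?v ?S ?Z]
        unfolding ve by simp
      let ?s = "s(17 := (s 17)(i := val ?e s))"
      have "holds_sums (\<lambda>l. if l < Suc i then ?g l else g l) (?s 17)"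
        using sums ee unfolding holds_sums_def by (auto simp: less_Suc_eq simp del: val.simps fits.simps)
      then show "fits W (reg 10) s \<and> fits W ?e s \<and>
        (s(17 := (s 17)(val (reg 10) s := val ?e s))) 10 0 = i \<and>
        ?I (Suc i) ((s(17 := (s 17)(val (reg 10) s := val ?e s)))
          (10 := ((s(17 := (s 17)(val (reg 10) s := val ?e s))) 10)(0 := Suc i)))"
        using ee env cells i10 W by (simp del: val.simps(5-7) fits.simps(5-7) val.simps(3) fits.simps(3))
    qed
  next
    fix s assume "?I (N * N) s"
    then show "env z fl zf jf s \<and> holds_sums ?g (s 17)" by (auto simp: holds_sums_def)
  qed (use W_facts in \<open>auto simp: env_simps\<close>)
  then show ?thesis by (simp add: mo)
qed

abbreviation monomial_time :: nat where
  "monomial_time \<equiv> (2 + N * N * 4) + ((2 + length is * 6) + (2 + N * N * 3))"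

lemma add_monomial:
  assumes z: "z < n ^ j" and mo: "mo \<in> set monomials"
  shows "triple W (\<lambda>s. env z fl zf jf s \<and> holds_sums g (s 17)) (add_monomial mo) monomial_time
    (\<lambda>s. env z fl zf jf s \<and> holds_sums (\<lambda>l. g l + monomial_total z (l div N) (l mod N) mo) (s 17))"
proof -
  have ex: "snd mo p \<le> 2 * length edge_pairs" for p
    using exponent_le[of "fst mo" "snd mo" p] mo by simp
  show ?thesis
    unfolding add_monomial_def
    by (intro triple_Seq[OF load[OF z ex] triple_Seq[OF simulate accumulate[OF z ex]]])
qed

text \<open>Partial sums over the monomials are known only modulo \<open>M\<close> and may stand for
  negative numbers. The complete sum is a total, which lies between 0 and \<open>M - 1\<close>, and
  so equals the stored residue.\<close>

lemma sum_monomials: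
  assumes z: "z < n ^ j"
  shows "triple W (\<lambda>s. env z fl zf jf s \<and> holds_sums (\<lambda>_. 0) (s 17)) (seqs (map add_monomial monomials))
    (length monomials * monomial_time + 1)
    (\<lambda>s. env z fl zf jf s \<and> (\<forall>l<N * N. int (s 17 l) = total z (l div N) (l mod N)))"
proof -
  let ?g = "\<lambda>i l. \<Sum>mo\<leftarrow>take i monomials. monomial_total z (l div N) (l mod N) mo"
  let ?I = "\<lambda>i s. env z fl zf jf s \<and> holds_sums (?g i) (s 17)"
  have "triple W (?I 0) (seqs (map add_monomial monomials))
    (length (map add_monomial monomials) * monomial_time + 1) (?I (length (map add_monomial monomials)))"
  proof (rule triple_seqs)
    fix i assume i: "i < length (map add_monomial monomials)"
    then have "?g (Suc i) = (\<lambda>l. ?g i l + monomial_total z (l div N) (l mod N) (monomials ! i))"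
      by (simp add: take_Suc_conv_app_nth)
    then show "triple W (?I i) (map add_monomial monomials ! i) monomial_time (?I (Suc i))"
      using add_monomial[OF z, of "monomials ! i" fl zf jf "?g i"] i by simp
  qed
  then show ?thesis
  proof (rule triple_conseq)
    fix s assume "?I (length (map add_monomial monomials)) s"
    then have *: "env z fl zf jf s" "holds_sums (\<lambda>l. total z (l div N) (l mod N)) (s 17)"
      by (simp_all add: total_expand)
    have "int (s 17 l) = total z (l div N) (l mod N)" if "l < N * N" for l
    proof -
      have "int (s 17 l) mod int M = total z (l div N) (l mod N) mod int M" "s 17 l < M"
        using *(2) that unfolding holds_sums_def mod_eq_dvd_iff by auto
      then show ?thesis
        using total_less[OF z, of "l div N" "l mod N"] total_nonneg[of z "l div N" "l mod N"] by simp
    qed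
    with * show "env z fl zf jf s \<and> (\<forall>l<N * N. int (s 17 l) = total z (l div N) (l mod N))" by simp
  qed auto
qed

section \<open>Detecting a nonzero total\<close>

definition found :: "nat \<Rightarrow> nat \<Rightarrow> nat \<Rightarrow> nat \<Rightarrow> nat \<Rightarrow> bool" where
  "found m i fl zf jf \<longleftrightarrow>
     fl = 0 \<and> (\<forall>z l. (z < m \<or> z = m \<and> l < i) \<longrightarrow> l < N * N \<longrightarrow> total z (l div N) (l mod N) = 0) \<or>
     fl = 1 \<and> zf < n ^ j \<and> jf < N * N \<and> total zf (jf div N) (jf mod N) \<noteq> 0"

text \<open>Progress is ordered lexicographically: a finished row \<open>m\<close> is the start of
  row \<open>Suc m\<close>.\<close>

lemma found_Suc: "found m (N * N) fl zf jf \<Longrightarrow> found (Suc m) 0 fl zf jf"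
  by (auto simp: found_def less_Suc_eq)

abbreviation block_time :: nat where
  "block_time \<equiv> (2 + N * N * 3) + ((length monomials * monomial_time + 1) + (2 + N * N * 6))"

lemma search_block:
  assumes z: "z < n ^ j" and f: "found z 0 fl zf jf"
  shows "triple W (\<lambda>s. env z fl zf jf s) search_block block_time
    (\<lambda>s. \<exists>fl zf jf. env z fl zf jf s \<and> found (Suc z) 0 fl zf jf)"
  unfolding search_block_def
proof (intro triple_Seq)
  let ?I = "\<lambda>i s. env z fl zf jf s \<and> (\<forall>l<i. s 17 l = 0)"
  have "triple W (\<lambda>s. env z fl zf jf s) (For 10 (reg 18) (Assign 17 (reg 10) (Num 0))) (2 + N * N * (1 + 2))
    (\<lambda>s. env z fl zf jf s \<and> holds_sums (\<lambda>_. 0) (s 17))"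
  proof (rule triple_For[where I = ?I and L = "N * N"])
    fix i assume i: "i < N * N"
    show "triple W (\<lambda>s. ?I i s \<and> s 10 0 = i) (Assign 17 (reg 10) (Num 0)) 1
      (\<lambda>s. s 10 0 = i \<and> ?I (Suc i) (s(10 := (s 10)(0 := Suc i))))"
      by (rule triple_Assign) (use i W_facts in \<open>auto simp: less_Suc_eq\<close>)
  qed (use W_facts M_pos in \<open>auto simp: env_simps holds_sums_def\<close>)
  then show "triple W (\<lambda>s. env z fl zf jf s) (For 10 (reg 18) (Assign 17 (reg 10) (Num 0))) (2 + N * N * 3)
    (\<lambda>s. env z fl zf jf s \<and> holds_sums (\<lambda>_. 0) (s 17))" by simp
next
  show "triple W (\<lambda>s. env z fl zf jf s \<and> holds_sums (\<lambda>_. 0) (s 17)) (seqs (map add_monomial monomials))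
    (length monomials * monomial_time + 1)
    (\<lambda>s. env z fl zf jf s \<and> (\<forall>l<N * N. int (s 17 l) = total z (l div N) (l mod N)))"
    by (rule sum_monomials[OF z])
next
  let ?T = "\<lambda>s. \<forall>l<N * N. int (s 17 l) = total z (l div N) (l mod N)"
  \<comment> \<open>The record is quantified because a hit rewrites it during the loop; the totals
    stay.\<close>
  let ?I = "\<lambda>i s. (\<exists>fl zf jf. env z fl zf jf s \<and> found z i fl zf jf) \<and> ?T s"
  let ?c = "If (Get 17 (reg 10)) (Seq (Assign 3 (Num 0) (Num 1))
    (Seq (Assign 12 (Num 0) (reg 11)) (Assign 13 (Num 0) (reg 10)))) Skip"
  have "triple W (\<lambda>s. env z fl zf jf s \<and> ?T s) (For 10 (reg 18) ?c) (2 + N * N * (Suc (1 + (1 + 1)) + 2))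
    (\<lambda>s. \<exists>fl zf jf. env z fl zf jf s \<and> found (Suc z) 0 fl zf jf)"
  proof (rule triple_For[where I = ?I and L = "N * N"])
    fix i assume i: "i < N * N"
    have iW: "i \<le> W" using i W_facts by simp
    have zW: "z \<le> W" using z word_z by simp
    let ?Q = "\<lambda>s. s 10 0 = i \<and> ?I (Suc i) (s(10 := (s 10)(0 := Suc i)))"
    show "triple W (\<lambda>s. ?I i s \<and> s 10 0 = i) ?c (Suc (1 + (1 + 1))) ?Q"
    proof (rule triple_If)
      fix s assume s: "?I i s \<and> s 10 0 = i"
      then have "int (s 17 i) < int M" using i total_less[OF z] by simp
      then show "fits W (Get 17 (reg 10)) s" using s iW W_facts by simp
    next
      let ?F = "total z (i div N) (i mod N) \<noteq> 0"
      show "triple W (\<lambda>s. (?I i s \<and> s 10 0 = i) \<and> val (Get 17 (reg 10)) s \<noteq> 0)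
        (Seq (Assign 3 (Num 0) (Num 1)) (Seq (Assign 12 (Num 0) (reg 11)) (Assign 13 (Num 0) (reg 10))))
        (1 + (1 + 1)) ?Q"
      proof (intro triple_Seq triple_Assign)
        fix s assume s: "(?I i s \<and> s 10 0 = i) \<and> val (Get 17 (reg 10)) s \<noteq> 0"
        then obtain fl zf jf where e: "env z fl zf jf s" by blast
        have "?F" using s i by (metis of_nat_eq_0_iff val.simps(1,2))
        moreover have "env z 1 zf jf (s(3 := (s 3)(0 := 1)))" using e by (auto simp: env_def input_def)
        ultimately show "fits W (Num 0) s \<and> fits W (Num 1) s \<and>
          (\<lambda>s. (\<exists>zf jf. env z 1 zf jf s) \<and> ?T s \<and> ?F \<and> s 10 0 = i)
            (s(3 := (s 3)(val (Num 0) s := val (Num 1) s)))"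
          using s W_facts by auto
      next
        fix s assume s: "(\<exists>zf jf. env z 1 zf jf s) \<and> ?T s \<and> ?F \<and> s 10 0 = i"
        then obtain zf jf where e: "env z 1 zf jf s" by blast
        then have "env z 1 z jf (s(12 := (s 12)(0 := z)))" "s 11 0 = z" by (auto simp: env_def input_def)
        then show "fits W (Num 0) s \<and> fits W (reg 11) s \<and>
          (\<lambda>s. (\<exists>jf. env z 1 z jf s) \<and> ?T s \<and> ?F \<and> s 10 0 = i)
            (s(12 := (s 12)(val (Num 0) s := val (reg 11) s)))"
          using s W_facts zW by auto
      next
        fix s assume s: "(\<exists>jf. env z 1 z jf s) \<and> ?T s \<and> ?F \<and> s 10 0 = i"
        then obtain jf where e: "env z 1 z jf s" by blast
        let ?s = "s(13 := (s 13)(0 := i))"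
        have "env z 1 z i ?s" using e by (auto simp: env_def input_def)
        moreover have "found z (Suc i) 1 z i" using s z i by (simp add: found_def)
        ultimately have "?Q ?s" using s by auto
        then show "fits W (Num 0) s \<and> fits W (reg 10) s \<and> ?Q (s(13 := (s 13)(val (Num 0) s := val (reg 10) s)))"
          using s W_facts iW by simp
      qed
    next
      have "triple W (\<lambda>s. (?I i s \<and> s 10 0 = i) \<and> val (Get 17 (reg 10)) s = 0) Skip 1 ?Q"
      proof (rule triple_Skip)
        fix s assume s: "(?I i s \<and> s 10 0 = i) \<and> val (Get 17 (reg 10)) s = 0"
        then obtain fl zf jf where e: "env z fl zf jf s" "found z i fl zf jf" by blast
        have "total z (i div N) (i mod N) = 0" using s i by (metis of_nat_0 val.simps(1,2))
        then have "found z (Suc i) fl zf jf" using e(2) by (auto simp: found_def less_Suc_eq)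
        then show "?Q s" using s e(1) by auto
      qed
      then show "triple W (\<lambda>s. (?I i s \<and> s 10 0 = i) \<and> val (Get 17 (reg 10)) s = 0) Skip (1 + (1 + 1)) ?Q"
        by (rule triple_time) simp
    qed
  next
    fix s assume "env z fl zf jf s \<and> ?T s"
    then show "?I 0 (s(10 := (s 10)(0 := 0)))" using f by auto
  next
    fix s assume "?I (N * N) s"
    then show "\<exists>fl zf jf. env z fl zf jf s \<and> found (Suc z) 0 fl zf jf" using found_Suc by blast
  qed (use W_facts in \<open>auto simp: env_simps\<close>)
  then show "triple W (\<lambda>s. env z fl zf jf s \<and> ?T s) (For 10 (reg 18) ?c) (2 + N * N * 6)
    (\<lambda>s. \<exists>fl zf jf. env z fl zf jf s \<and> found (Suc z) 0 fl zf jf)"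
    by (rule triple_time) simp
qed

text \<open>Register 11 is the loop counter and part of \<open>env\<close>, hence the quantified
  \<open>z\<close>: its value before and after the loop is of no interest.\<close>

lemma search_blocks:
  "triple W (\<lambda>s. \<exists>z. env z 0 0 0 s) (For 11 (reg 6) search_block) (2 + n ^ j * (block_time + 2))
    (\<lambda>s. \<exists>z fl zf jf. env z fl zf jf s \<and> found (n ^ j) 0 fl zf jf)"
proof -
  let ?I = "\<lambda>i s. \<exists>z fl zf jf. env z fl zf jf s \<and> found i 0 fl zf jf"
  have set_z: "env i fl zf jf (s(11 := (s 11)(0 := i)))" if "env z fl zf jf s" for z i fl zf jf s
    using that by (auto simp: env_def input_def)
  show ?thesis
  proof (rule triple_For[where I = ?I and L = "n ^ j"])
    fix i assume i: "i < n ^ j"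
    have "triple W (\<lambda>s. \<exists>fl zf jf. env i fl zf jf s \<and> found i 0 fl zf jf) search_block block_time
      (\<lambda>s. \<exists>fl zf jf. env i fl zf jf s \<and> found (Suc i) 0 fl zf jf)"
    proof (intro triple_ex)
      fix fl zf jf
      show "triple W (\<lambda>s. env i fl zf jf s \<and> found i 0 fl zf jf) search_block block_time
        (\<lambda>s. \<exists>fl zf jf. env i fl zf jf s \<and> found (Suc i) 0 fl zf jf)"
      proof (cases "found i 0 fl zf jf")
        case True
        then show ?thesis using search_block[OF i True] by simp
      qed (simp add: triple_def)
    qed
    then show "triple W (\<lambda>s. ?I i s \<and> s 11 0 = i) search_block block_time
      (\<lambda>s. s 11 0 = i \<and> ?I (Suc i) (s(11 := (s 11)(0 := Suc i))))"
      by (rule triple_conseq) (use set_z in \<open>auto simp: env_simps(12), blast+\<close>)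
  next
    fix s assume "\<exists>z. env z 0 0 0 s"
    then show "?I 0 (s(11 := (s 11)(0 := 0)))" using set_z by (auto simp: found_def) blast
  qed (use word_z in \<open>auto simp: env_simps\<close>)
qed

end

section \<open>From a nonzero total to a rainbow copy\<close>

context coloured_pattern
begin

definition result :: "memory \<Rightarrow> bool" where
  "result s \<longleftrightarrow>
     s 3 0 = 0 \<and> (\<forall>\<phi>. (\<forall>i<h. \<phi> i < n) \<longrightarrow> \<not> rainbow_copy \<phi>) \<or>
     s 3 0 = 1 \<and> (\<forall>i<h. s 4 i < n) \<and> rainbow_copy (s 4)"

end

context matmul_run
begin

lemma h_le_W: "h \<le> W"
proof -
  have "h < 2 ^ h" by (rule less_exp)
  also have "\<dots> \<le> B ^ h" using two_le by (rule power_mono) simp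
  also have "\<dots> \<le> W" by (rule power_le_trans[OF W h_le_weight_exponent two_le])
  finally show ?thesis by simp
qed

lemma not_found:
  assumes "found (n ^ j) 0 0 zf jf" and "\<forall>i<h. \<phi> i < n"
  shows "\<not> rainbow_copy \<phi>"
proof
  assume copy: "rainbow_copy \<phi>"
  obtain z a b c where *: "z < n ^ j" "a < N" "b < N" "c < N" "\<forall>i<h. assignment n z a b c i = \<phi> i"
    using assignment_surj[OF assms(2)] unfolding N_def by blast
  \<comment> \<open>The pair of \<open>a\<close> and \<open>c\<close> is examined as entry
    \<open>a * N + c\<close>, which has to be within the scanned range.\<close>
  have "Suc a * N \<le> N * N" using *(2) by (intro mult_right_mono) auto
  then have "a * N + c < N * N" using *(4) by simp
  then have "total z ((a * N + c) div N) ((a * N + c) mod N) = 0"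
    using assms(1) *(1) zero_neq_one unfolding found_def by blast
  then have "total z a c = 0" using *(4) by simp
  moreover have "rainbow_copy (assignment n z a b c)"
    using copy rainbow_copy_cong[of "assignment n z a b c" \<phi>] *(5) by simp
  ultimately show False
    using total_nonzero[of z a c] *(3) unfolding N_def by auto
qed

abbreviation write_time :: nat where
  "write_time \<equiv> Suc (2 + N * (Suc (h * 1 + 1) + 2))"

lemma write_copy:
  "triple W (\<lambda>s. \<exists>z fl zf jf. env z fl zf jf s \<and> found (n ^ j) 0 fl zf jf) write_copy write_time result"
proof (intro triple_ex)
  fix z fl zf jf
  let ?\<epsilon> = "eassignment (reg 12) (Div (reg 13) (reg 5)) (reg 14) (Mod (reg 13) (reg 5))"
  let ?\<phi> = "\<lambda>b. assignment n zf (jf div N) b (jf mod N)"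
  let ?P = "\<lambda>s. env z fl zf jf s \<and> found (n ^ j) 0 fl zf jf"
  let ?G = "\<lambda>s. (\<forall>i<h. s 4 i < n) \<and> rainbow_copy (s 4)"
  show "triple W ?P write_copy write_time result"
    unfolding write_copy_def Let_def
  proof (rule triple_If)
    fix s assume "?P s"
    then show "fits W (reg 3) s" using W_facts by (auto simp: env_simps found_def)
  next
    show "triple W (\<lambda>s. ?P s \<and> val (reg 3) s = 0) Skip (2 + N * (Suc (h * 1 + 1) + 2)) result"
    proof (rule triple_time[OF triple_Skip])
      fix s assume s: "?P s \<and> val (reg 3) s = 0"
      then have "fl = 0" "s 3 0 = 0" by (auto simp: env_simps)
      then show "result s" using s not_found[of zf jf] unfolding result_def by blast
    qed simp
  next
    \<comment> \<open>Several \<open>b\<close> may succeed and each overwrites array 4, but always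
      with a full rainbow copy, so \<open>?G\<close> persists after the first success.\<close>
    let ?I = "\<lambda>i s. ?P s \<and> fl = 1 \<and> ((\<exists>b<i. rainbow_copy (?\<phi> b)) \<longrightarrow> ?G s)"
    let ?c = "If (erainbow ?\<epsilon>) (seqs (map (\<lambda>i. Assign 4 (Num i) (?\<epsilon> i)) [0..<h])) Skip"
    show "triple W (\<lambda>s. ?P s \<and> val (reg 3) s \<noteq> 0) (For 14 (reg 5) ?c)
      (2 + N * (Suc (h * 1 + 1) + 2)) result"
    proof (rule triple_For[where I = ?I and L = N])
      fix s assume "?P s \<and> val (reg 3) s \<noteq> 0"
      then show "?I 0 (s(14 := (s 14)(0 := 0)))" by (auto simp: env_simps found_def)
    next
      fix s assume s: "?I N s"
      then have "zf < n ^ j" "total zf (jf div N) (jf mod N) \<noteq> 0" by (auto simp: found_def)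
      then have "?G s" using s total_nonzero[of zf "jf div N" "jf mod N"] unfolding N_def by auto
      then show "result s" using s by (auto simp: result_def env_simps)
    next
      fix i assume i: "i < N"
      let ?Q = "\<lambda>s. s 14 0 = i \<and> ?I (Suc i) (s(14 := (s 14)(0 := Suc i)))"
      have \<epsilon>: "fits W (?\<epsilon> p) s \<and> val (?\<epsilon> p) s = ?\<phi> i p \<and> ?\<phi> i p < n"
        if "?P s" "fl = 1" "s 14 0 = i" "p < h" for s p
      proof -
        have f: "zf < n ^ j" "jf < N * N" using that by (auto simp: found_def)
        then have "zf \<le> W" "jf \<le> W" "i \<le> W" using i word_z W_facts by auto
        then show ?thesis
          using that eassignment[of s "reg 12" "Div (reg 13) (reg 5)" "reg 14" "Mod (reg 13) (reg 5)" p]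
            assignment_less'[OF f(1), of p] i W_facts env_simps[OF conjunct1[OF that(1)]] by auto
      qed
      have copy: "fits W (erainbow ?\<epsilon>) s \<and> (val (erainbow ?\<epsilon>) s \<noteq> 0 \<longleftrightarrow> rainbow_copy (?\<phi> i))"
        if "?P s" "fl = 1" "s 14 0 = i" for s
        using \<epsilon>[OF that] env_simps(1)[OF conjunct1[OF that(1)]] by (intro erainbow) auto
      show "triple W (\<lambda>s. ?I i s \<and> s 14 0 = i) ?c (Suc (h * 1 + 1)) ?Q"
      proof (rule triple_If)
        fix s assume "?I i s \<and> s 14 0 = i"
        then show "fits W (erainbow ?\<epsilon>) s" using copy by blast
      next
        show "triple W (\<lambda>s. (?I i s \<and> s 14 0 = i) \<and> val (erainbow ?\<epsilon>) s = 0) Skip (h * 1 + 1) ?Q"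
        proof (rule triple_time[OF triple_Skip])
          fix s assume s: "(?I i s \<and> s 14 0 = i) \<and> val (erainbow ?\<epsilon>) s = 0"
          then have "\<not> rainbow_copy (?\<phi> i)" using copy by blast
          then show "?Q s" using s by (auto simp: less_Suc_eq)
        qed simp
      next
        let ?cs = "map (\<lambda>i. Assign 4 (Num i) (?\<epsilon> i)) [0..<h]"
        let ?J = "\<lambda>q s. ?P s \<and> fl = 1 \<and> s 14 0 = i \<and> rainbow_copy (?\<phi> i) \<and> (\<forall>p<q. s 4 p = ?\<phi> i p)"
        have "triple W (?J 0) (seqs ?cs) (length ?cs * 1 + 1) (?J (length ?cs))"
        proof (rule triple_seqs)
          fix q assume "q < length ?cs"
          then have q: "q < h" by simp
          have "triple W (?J q) (Assign 4 (Num q) (?\<epsilon> q)) 1 (?J (Suc q))"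
          proof (rule triple_Assign)
            fix s assume s: "?J q s"
            then have "fits W (?\<epsilon> q) s \<and> val (?\<epsilon> q) s = ?\<phi> i q" using \<epsilon>[of s q] q by blast
            then show "fits W (Num q) s \<and> fits W (?\<epsilon> q) s \<and> ?J (Suc q) (s(4 := (s 4)(val (Num q) s := val (?\<epsilon> q) s)))"
              using s q h_le_W by (auto simp: less_Suc_eq)
          qed
          then show "triple W (?J q) (?cs ! q) 1 (?J (Suc q))" using q by simp
        qed
        then show "triple W (\<lambda>s. (?I i s \<and> s 14 0 = i) \<and> val (erainbow ?\<epsilon>) s \<noteq> 0) (seqs ?cs) (h * 1 + 1) ?Q"
        proof (rule triple_conseq)
          fix s assume "(?I i s \<and> s 14 0 = i) \<and> val (erainbow ?\<epsilon>) s \<noteq> 0"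
          then show "?J 0 s" using copy by auto
        next
          fix s assume s: "?J (length ?cs) s"
          then have eq: "s 4 p = ?\<phi> i p" "?\<phi> i p < n" if "p < h" for p using that \<epsilon>[of s p] by auto
          then have "rainbow_copy (s 4)" using s rainbow_copy_cong[of "s 4" "?\<phi> i"] by simp
          then have "?G s" using eq by simp
          then show "?Q s" using s by auto
        qed simp
      qed
    next
      show "Suc N \<le> W" using W_facts(3) le_square[of N] by linarith
    qed (use W_facts in \<open>auto simp: env_simps\<close>)
  qed
qed

lemma search:
  "triple W (\<lambda>s. \<exists>z. env z 0 0 0 s) search ((2 + n ^ j * (block_time + 2)) + write_time) result"
  unfolding search_def by (rule triple_Seq[OF search_blocks write_copy])

end

section \<open>Preparing the search\<close>

text \<open>Computes -aX modulo \<open>M\<close> for r = a / D, from \<open>X\<close> and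
  \<open>M\<close> in registers 8 and 9. Only the absolute value of \<open>a\<close> is a literal,
  so the text is the same for all inputs; the sign chooses between \<open>M - X\<close> and
  \<open>X\<close>.\<close>

definition econst :: "nat \<Rightarrow> rat \<Rightarrow> expr" where
  "econst D r = (let a = \<lfloor>r * of_nat D\<rfloor> in
     Mod (Times (Num (nat \<bar>a\<bar>)) (if 0 \<le> a then Minus (reg 9) (reg 8) else reg 8)) (reg 9))"

lemma econst:
  assumes "r * of_nat D = of_int a" "s 9 0 = M" "s 8 0 = X" "M = D * X + 1" "0 < D"
    and "nat \<bar>a\<bar> * M \<le> W" "nat \<bar>a\<bar> \<le> W" "M \<le> W"
  shows "fits W (econst D r) s \<and> val (econst D r) s < M \<and>
    residue_of (int D) (int M) r (int (val (econst D r) s))"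
proof -
  have a: "\<lfloor>r * of_nat D\<rfloor> = a" using assms(1) by simp
  \<comment> \<open>Ensures that \<open>M - X\<close> is a true difference.\<close>
  have X: "X \<le> M" using assms(4,5) by (cases D) auto
  define w where "w = nat \<bar>a\<bar> * (if 0 \<le> a then M - X else X)"
  have "w \<le> nat \<bar>a\<bar> * M" unfolding w_def using X by (intro mult_left_mono) auto
  then have "w \<le> W" using assms(6) by simp
  then have v: "fits W (econst D r) s" "val (econst D r) s = w mod M"
    using assms(2,3,7,8) X by (auto simp: econst_def a w_def Let_def)
  have "int M dvd int w + a * int X"
    using X by (auto simp: w_def of_nat_diff algebra_simps)
  moreover have "int M dvd int (w mod M) - int w"
    by (simp add: zmod_int mod_eq_dvd_iff[symmetric] del: of_nat_mod)
  ultimately have "int M dvd (int (w mod M) - int w) + (int w + a * int X)" by (rule dvd_add[rotated])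
  then have "residue_of (int D) (int M) r (int (w mod M))"
    using assms(1,4) by (intro residue_of_const[of r "int D" a "int M" "int X"]) (auto simp: algebra_simps)
  then show ?thesis using v assms(4) by simp
qed

context pattern
begin

text \<open>A total adds n^k weights, each at most B to the power
  \<open>weight_exponent\<close>.\<close>

definition bound_exponent :: nat where "bound_exponent = k + weight_exponent"

text \<open>The loop finds the largest colour, from which \<open>X\<close> and \<open>M\<close>
  follow; the summand 2 makes the base at least 2. Its range of n^j * N^2 cells stays within the
  time of n^j matrix products. The last assignment sets up the input of the relocated listing
  program.\<close>

definition prepare :: "rat list \<Rightarrow> com" where
  "prepare cs = Seq (Assign 5 (Num 0) (epow (reg 0) k)) (Seq (Assign 6 (Num 0) (epow (reg 0) j))
     (Seq (Assign 18 (Num 0) (Times (reg 5) (reg 5)))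
     (Seq (For 10 (Times (reg 6) (reg 18))
        (If (Minus (Get 2 (reg 10)) (reg 7)) (Assign 7 (Num 0) (Get 2 (reg 10))) Skip))
     (Seq (Assign 8 (Num 0) (epow (Plus (Plus (reg 0) (reg 7)) (Num 2)) bound_exponent))
     (Seq (Assign 9 (Num 0) (Plus (Times (Num (common_denom cs)) (reg 8)) (Num 1)))
     (Seq (seqs (map (\<lambda>i. Assign 15 (Num i) (econst (common_denom cs) (cs ! i))) [0..<length cs]))
       (Assign 20 (Num 0) (reg 5))))))))"

end

context coloured_pattern
begin

definition fresh :: "memory \<Rightarrow> bool" where
  "fresh s \<longleftrightarrow> s 0 0 = n \<and> s 1 = adj \<and> s 2 = col \<and> s 3 0 = 0 \<and> s 12 0 = 0 \<and> s 13 0 = 0 \<and>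
     (\<forall>a\<ge>20. \<forall>i. s a i = 0)"

lemma fresh_update [simp]: "a \<in> {5, 6, 7, 8, 9, 10, 15, 18} \<Longrightarrow> fresh (s(a := x)) = fresh s"
  by (auto simp: fresh_def)

text \<open>The base \<open>n + mx + 2\<close> of \<open>X\<close> is known only at run time; the
  word bounds are stated with \<open>2 * m + 2\<close>, which is at least as large.\<close>

lemma prepare:
  fixes m :: nat and cs :: "rat list"
  defines "Q \<equiv> \<lambda>mx s. fresh s \<and> s 5 0 = n ^ k \<and> s 6 0 = n ^ j \<and> s 18 0 = n ^ k * n ^ k \<and> s 7 0 = mx"
    and "X \<equiv> \<lambda>mx. (n + mx + 2) ^ bound_exponent" and "D \<equiv> common_denom cs"
  assumes n: "n \<le> m" and col: "\<And>i. col i \<le> m" and W: "2 * m + 2 \<le> W"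
    and W_pow: "(2 * m + 2) ^ bound_exponent \<le> W" and W_k: "n ^ k \<le> W" and W_j: "n ^ j \<le> W"
    and W_kk: "n ^ k * n ^ k \<le> W" and W_loop: "n ^ j * (n ^ k * n ^ k) < W"
    and W_M: "D * (2 * m + 2) ^ bound_exponent + 1 \<le> W" and W_D: "D \<le> W"
    and W_const: "\<And>r. r \<in> set cs \<Longrightarrow>
      nat \<bar>\<lfloor>r * of_nat D\<rfloor>\<bar> * (D * (2 * m + 2) ^ bound_exponent + 1) \<le> W"
    and W_cs: "length cs \<le> W"
  shows "triple W (\<lambda>s. fresh s \<and> s 7 0 = 0) (prepare cs)
    (1 + (1 + (1 + ((2 + n ^ j * (n ^ k * n ^ k) * (Suc 1 + 2)) + (1 + (1 + ((length cs * 1 + 1) + 1)))))))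
    (\<lambda>s. \<exists>mx\<le>m. (\<forall>i < n ^ j * (n ^ k * n ^ k). col i \<le> mx) \<and>
      s 0 0 = n \<and> s 1 = adj \<and> s 2 = col \<and> s 3 0 = 0 \<and> s 12 0 = 0 \<and> s 13 0 = 0 \<and>
      s 5 0 = n ^ k \<and> s 6 0 = n ^ j \<and> s 18 0 = n ^ k * n ^ k \<and> s 9 0 = D * X mx + 1 \<and>
      (\<forall>i<length cs. s 15 i < D * X mx + 1 \<and>
         residue_of (int D) (int (D * X mx + 1)) (cs ! i) (int (s 15 i))) \<and>
      (\<forall>a. s (20 + a) = size_input (n ^ k) a))"
    (is "triple W ?P _ _ ?R")
proof -
  have nW: "n \<le> W" "2 \<le> W" "m \<le> W" using n W by auto
  have D: "0 < D" unfolding D_def by (rule common_denom_pos)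
  let ?loop = "n ^ j * (n ^ k * n ^ k)"
  let ?max = "\<lambda>mx. mx \<le> m \<and> (\<forall>i<?loop. col i \<le> mx)"
  have XW: "X mx \<le> (2 * m + 2) ^ bound_exponent" if "mx \<le> m" for mx
    unfolding X_def using that n by (intro power_mono) auto
  have pow: "fits W (epow (reg 0) l) s" if "s 0 0 = n" "n ^ l \<le> W" for s l
  proof (cases "n = 0")
    case True
    have "fits W (epow (reg 0) l) s"
      using that True nW by (intro fits_epow[where B = 1]) auto
    then show ?thesis .
  next
    case False
    then show ?thesis using that nW by (intro fits_epow[where B = n]) auto
  qed
  let ?M = "\<lambda>mx. D * X mx + 1"
  have MW: "?M mx \<le> D * (2 * m + 2) ^ bound_exponent + 1" if "mx \<le> m" for mx
    using XW[OF that] by simp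
  let ?Q1 = "\<lambda>s. ?P s \<and> s 5 0 = n ^ k" and ?Q2 = "\<lambda>s. ?P s \<and> s 5 0 = n ^ k \<and> s 6 0 = n ^ j"
  let ?Q4 = "\<lambda>s. \<exists>mx. ?max mx \<and> Q mx s"
  let ?Q5 = "\<lambda>s. \<exists>mx. ?max mx \<and> Q mx s \<and> s 8 0 = X mx"
  let ?Q6 = "\<lambda>s. \<exists>mx. ?max mx \<and> Q mx s \<and> s 8 0 = X mx \<and> s 9 0 = ?M mx"
  let ?C = "\<lambda>q mx s. \<forall>i<q. s 15 i < ?M mx \<and> residue_of (int D) (int (?M mx)) (cs ! i) (int (s 15 i))"
  let ?Q7 = "\<lambda>q s. \<exists>mx. ?max mx \<and> Q mx s \<and> s 8 0 = X mx \<and> s 9 0 = ?M mx \<and> ?C q mx s"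
  show ?thesis
    unfolding prepare_def D_def[symmetric]
  proof (intro triple_Seq)
    show "triple W ?P (Assign 5 (Num 0) (epow (reg 0) k)) 1 ?Q1"
      by (rule triple_Assign) (use pow W_k in \<open>auto simp: fresh_def\<close>)
    show "triple W ?Q1 (Assign 6 (Num 0) (epow (reg 0) j)) 1 ?Q2"
      by (rule triple_Assign) (use pow W_j in \<open>auto simp: fresh_def\<close>)
    show "triple W ?Q2 (Assign 18 (Num 0) (Times (reg 5) (reg 5))) 1 (Q 0)"
      by (rule triple_Assign) (use W_k W_kk in \<open>auto simp: Q_def\<close>)
    show "triple W (Q 0) (For 10 (Times (reg 6) (reg 18))
        (If (Minus (Get 2 (reg 10)) (reg 7)) (Assign 7 (Num 0) (Get 2 (reg 10))) Skip))
      (2 + ?loop * (Suc 1 + 2)) ?Q4"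
    proof (rule triple_For[where I = "\<lambda>i s. \<exists>mx. mx \<le> m \<and> (\<forall>l<i. col l \<le> mx) \<and> Q mx s" and L = ?loop])
      fix i assume i: "i < ?loop"
      let ?I = "\<lambda>i s. \<exists>mx. mx \<le> m \<and> (\<forall>l<i. col l \<le> mx) \<and> Q mx s"
      let ?Q = "\<lambda>s. s 10 0 = i \<and> ?I (Suc i) (s(10 := (s 10)(0 := Suc i)))"
      have colW: "col i \<le> W" using col[of i] nW by simp
      show "triple W (\<lambda>s. ?I i s \<and> s 10 0 = i)
        (If (Minus (Get 2 (reg 10)) (reg 7)) (Assign 7 (Num 0) (Get 2 (reg 10))) Skip) (Suc 1) ?Q"
      proof (rule triple_If)
        fix s assume "?I i s \<and> s 10 0 = i"
        then show "fits W (Minus (Get 2 (reg 10)) (reg 7)) s"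
          using colW i W_loop nW by (auto simp: Q_def fresh_def)
      next
        show "triple W (\<lambda>s. (?I i s \<and> s 10 0 = i) \<and> val (Minus (Get 2 (reg 10)) (reg 7)) s \<noteq> 0)
          (Assign 7 (Num 0) (Get 2 (reg 10))) 1 ?Q"
        proof (rule triple_Assign)
          fix s assume s: "(?I i s \<and> s 10 0 = i) \<and> val (Minus (Get 2 (reg 10)) (reg 7)) s \<noteq> 0"
          then obtain mx where mx: "mx \<le> m" "\<forall>l<i. col l \<le> mx" "Q mx s" by blast
          then have "mx < col i" "s 2 = col" using s by (auto simp: Q_def fresh_def)
          then have "\<forall>l<Suc i. col l \<le> col i" using mx by (auto simp: less_Suc_eq)
          moreover have "Q (col i) (s(7 := (s 7)(0 := col i)))" using mx(3) by (simp add: Q_def)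
          ultimately show "fits W (Num 0) s \<and> fits W (Get 2 (reg 10)) s \<and>
            ?Q (s(7 := (s 7)(val (Num 0) s := val (Get 2 (reg 10)) s)))"
            using s \<open>s 2 = col\<close> col[of i] colW i W_loop nW
            by (auto simp: Q_def intro!: exI[of _ "col i"])
        qed
      next
        show "triple W (\<lambda>s. (?I i s \<and> s 10 0 = i) \<and> val (Minus (Get 2 (reg 10)) (reg 7)) s = 0) Skip 1 ?Q"
        proof (rule triple_Skip)
          fix s assume s: "(?I i s \<and> s 10 0 = i) \<and> val (Minus (Get 2 (reg 10)) (reg 7)) s = 0"
          then obtain mx where mx: "mx \<le> m" "\<forall>l<i. col l \<le> mx" "Q mx s" by blast
          then have "col i \<le> mx" using s by (auto simp: Q_def fresh_def)
          then have "\<forall>l<Suc i. col l \<le> mx" using mx by (auto simp: less_Suc_eq)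
          then show "?Q s" using s mx by (auto simp: Q_def)
        qed
      qed
    qed (use W_loop W_kk W_j in \<open>auto simp: Q_def\<close>)
    show "triple W ?Q4 (Assign 8 (Num 0) (epow (Plus (Plus (reg 0) (reg 7)) (Num 2)) bound_exponent)) 1 ?Q5"
    proof (rule triple_Assign)
      fix s assume "?Q4 s"
      then obtain mx where mx: "?max mx" "Q mx s" by blast
      let ?e = "Plus (Plus (reg 0) (reg 7)) (Num 2)"
      have e: "fits W ?e s" "val ?e s = n + mx + 2"
        using mx n W by (auto simp: Q_def fresh_def)
      then have "fits W (epow ?e bound_exponent) s"
        using mx(1) n W_pow by (intro fits_epow[where B = "2 * m + 2"]) auto
      moreover have "Q mx (s(8 := (s 8)(0 := X mx)))" using mx(2) by (simp add: Q_def)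
      ultimately show "fits W (Num 0) s \<and> fits W (epow ?e bound_exponent) s \<and>
        ?Q5 (s(8 := (s 8)(val (Num 0) s := val (epow ?e bound_exponent) s)))"
        unfolding val_epow e(2) using mx(1) by (auto simp: X_def intro!: exI[of _ mx] simp del: fits.simps(3))
    qed
    show "triple W ?Q5 (Assign 9 (Num 0) (Plus (Times (Num D) (reg 8)) (Num 1))) 1 ?Q6"
    proof (rule triple_Assign)
      fix s assume "?Q5 s"
      then obtain mx where mx: "?max mx" "Q mx s" "s 8 0 = X mx" by blast
      have "Q mx (s(9 := (s 9)(0 := ?M mx)))" using mx(2) by (simp add: Q_def)
      moreover have M: "?M mx \<le> W" using le_trans[OF MW W_M] mx(1) by blast
      moreover have "X mx \<le> W" using le_trans[OF XW W_pow] mx(1) by blast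
      moreover have "D * X mx \<le> W" using M by simp
      ultimately show "fits W (Num 0) s \<and> fits W (Plus (Times (Num D) (reg 8)) (Num 1)) s \<and>
        ?Q6 (s(9 := (s 9)(val (Num 0) s := val (Plus (Times (Num D) (reg 8)) (Num 1)) s)))"
        using mx W_D nW by (auto intro!: exI[of _ mx])
    qed
    let ?cs = "map (\<lambda>i. Assign 15 (Num i) (econst D (cs ! i))) [0..<length cs]"
    have "triple W (?Q7 0) (seqs ?cs) (length ?cs * 1 + 1) (?Q7 (length ?cs))"
    proof (rule triple_seqs)
      fix q assume "q < length ?cs"
      then have q: "q < length cs" by simp
      have "triple W (?Q7 q) (Assign 15 (Num q) (econst D (cs ! q))) 1 (?Q7 (Suc q))"
      proof (rule triple_Assign)
        fix s assume "?Q7 q s"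
        then obtain mx where mx: "?max mx" "Q mx s" "s 8 0 = X mx" "s 9 0 = ?M mx" "?C q mx s" by blast
        obtain a where a: "cs ! q * of_nat D = of_int a"
          unfolding D_def using common_denom q by (meson nth_mem)
        have "nat \<bar>a\<bar> * ?M mx \<le> nat \<bar>a\<bar> * (D * (2 * m + 2) ^ bound_exponent + 1)"
          using MW[of mx] mx(1) by (intro mult_left_mono) auto
        also have "\<dots> \<le> W" using W_const[of "cs ! q"] q a by simp
        finally have aM: "nat \<bar>a\<bar> * ?M mx \<le> W" .
        then have "nat \<bar>a\<bar> \<le> W" by (metis le_add2 le_trans mult.right_neutral mult_le_mono2)
        then have e: "fits W (econst D (cs ! q)) s \<and> val (econst D (cs ! q)) s < ?M mx \<and>
            residue_of (int D) (int (?M mx)) (cs ! q) (int (val (econst D (cs ! q)) s))"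
          using a mx aM D le_trans[OF MW W_M] by (intro econst[of _ _ a _ _ "X mx"]) auto
        have "Q mx (s(15 := (s 15)(q := v)))" for v using mx(2) by (simp add: Q_def)
        then show "fits W (Num q) s \<and> fits W (econst D (cs ! q)) s \<and>
          ?Q7 (Suc q) (s(15 := (s 15)(val (Num q) s := val (econst D (cs ! q)) s)))"
          using mx e q W_cs by (auto simp: less_Suc_eq intro!: exI[of _ mx])
      qed
      then show "triple W (?Q7 q) (?cs ! q) 1 (?Q7 (Suc q))" using q by simp
    qed
    then show "triple W ?Q6 (seqs ?cs) (length cs * 1 + 1) (?Q7 (length cs))" by simp
    show "triple W (?Q7 (length cs)) (Assign 20 (Num 0) (reg 5)) 1 ?R"
    proof (rule triple_Assign)
      fix s assume "?Q7 (length cs) s"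
      then obtain mx where mx: "?max mx" "Q mx s" "s 8 0 = X mx" "s 9 0 = ?M mx" "?C (length cs) mx s" by blast
      let ?s = "s(20 := (s 20)(0 := n ^ k))"
      have "\<forall>a. ?s (20 + a) = size_input (n ^ k) a"
        using mx(2) by (auto simp: Q_def fresh_def size_input_def fun_eq_iff)
      then have "?R ?s" using mx by (intro exI[of _ mx]) (simp add: Q_def fresh_def)
      then show "fits W (Num 0) s \<and> fits W (reg 5) s \<and> ?R (s(20 := (s 20)(val (Num 0) s := val (reg 5) s)))"
        using mx W_k by (simp add: Q_def)
    qed
  qed
qed

end

section \<open>Writing down a multiplication algorithm takes quadratic time\<close>

text \<open>Positions sharing an output cell would carry equal entries in every product. The matrix
  unit at (r, s), written as the unit at (r, 0) times the unit at (0, s), separates any two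
  positions.\<close>

lemma slp_multiplies_distinct:
  assumes "slp_multiplies n is out"
  shows "distinct out"
proof (rule ccontr)
  assume "\<not> distinct out"
  then obtain l l' where l: "l < n * n" "l' < n * n" "l \<noteq> l'" "out ! l = out ! l'"
    using assms unfolding slp_multiplies_def distinct_conv_nth by metis
  have n: "0 < n" using l(1) by (cases n) auto
  have b: "l div n < n" "l mod n < n" "l' div n < n" "l' mod n < n"
    using l n by (simp_all add: less_mult_imp_div_less)
  define A :: "rat mat" where "A = mat n n (\<lambda>(i, j). if i = l div n \<and> j = 0 then 1 else 0)"
  define B :: "rat mat" where "B = mat n n (\<lambda>(i, j). if i = 0 \<and> j = l mod n then 1 else 0)"
  have AB: "A \<in> carrier_mat n n" "B \<in> carrier_mat n n" by (auto simp: A_def B_def)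
  have prod: "(A * B) $$ (i, j) = (if i = l div n \<and> j = l mod n then 1 else 0)" if "i < n" "j < n" for i j
  proof -
    have "(A * B) $$ (i, j) = (\<Sum>b\<in>{0..<n}. A $$ (i, b) * B $$ (b, j))"
      using that AB by (simp add: scalar_prod_def)
    also have "\<dots> = (\<Sum>b\<in>{0..<n}. (if b = 0 then (if i = l div n \<and> j = l mod n then 1 else 0) else 0))"
      using that by (intro sum.cong) (auto simp: A_def B_def)
    finally show ?thesis using n by simp
  qed
  have out: "slp_run (row_major n A @ row_major n B) is ! (out ! (i * n + j)) = (A * B) $$ (i, j)"
    if "i < n" "j < n" for i j
    using assms AB that unfolding slp_multiplies_def by blast
  have "(A * B) $$ (l div n, l mod n) = (A * B) $$ (l' div n, l' mod n)"
    using out[OF b(1,2)] out[OF b(3,4)] l(4) by simp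
  then have "l' div n = l div n \<and> l' mod n = l mod n"
    using prod b by (auto split: if_splits)
  then show False using l(3) by (metis div_mult_mod_eq)
qed

lemma multiplication_program_time:
  assumes "slp_multiplies n is out" "exec W P (size_input n) t s" "slp_stored cs s is out"
  shows "n * n \<le> t + 1"
proof -
  have len: "length out = n * n" using assms(1) unfolding slp_multiplies_def by simp
  let ?L = "{l. l < n * n \<and> out ! l \<noteq> 0}"
  have "inj_on (\<lambda>l. (5::nat, l)) ?L" by (auto intro: inj_onI)
  moreover have "(\<lambda>l. (5, l)) ` ?L \<subseteq> changed (size_input n) s"
    using assms(3) len by (auto simp: changed_def size_input_def slp_stored_def)
  ultimately have "card ?L \<le> t"
    using exec_changed[OF assms(2)] by (meson card_inj_on_le le_trans)
  \<comment> \<open>Memory starts with zeros, so an output located in cell 0 is described without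
    writing; distinctness allows this once.\<close>
  moreover have "card {l. l < n * n \<and> out ! l = 0} \<le> 1"
    using slp_multiplies_distinct[OF assms(1)] len
    by (auto simp: card_le_Suc0_iff_eq One_nat_def) (metis nth_eq_iff_index_eq)
  moreover have "{..<n * n} = ?L \<union> {l. l < n * n \<and> out ! l = 0}" by auto
  then have "n * n \<le> card ?L + card {l. l < n * n \<and> out ! l = 0}"
    using card_Un_le[of ?L "{l. l < n * n \<and> out ! l = 0}"] by (metis card_lessThan)
  ultimately show ?thesis by linarith
qed

section \<open>The complete algorithm\<close>

text \<open>\<open>S\<close> dominates the number of matrix entries, the length of the straight-line
  program and the time to list it. One monomial takes 7 N^2 + 6 l + 6 steps, at most 19 S; the
  constant 60 is a generous bound for the rest.\<close>

lemma total_time_le: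
  fixes S N j' a l h c q p :: nat
  assumes "N * N \<le> S" "l \<le> S" "p \<le> S" "1 \<le> S"
  shows "(1 + (1 + (1 + ((2 + j' * (N * N) * (Suc 1 + 2)) + (1 + (1 + ((c * 1 + 1) + 1))))))) +
    (p + ((2 + j' * (((2 + N * N * 3) + ((q * ((2 + N * N * 4) + ((2 + l * 6) + (2 + N * N * 3))) + 1) + (2 + N * N * 6))) + 2)) +
     Suc (2 + N * (Suc (h * 1 + 1) + 2))))
    \<le> (60 + c + h + 19 * q) * ((j' + 1) * S)"
proof -
  have N: "N \<le> S" using assms(1) le_square[of N] by linarith
  have mt: "(2 + N * N * 4) + ((2 + l * 6) + (2 + N * N * 3)) \<le> 19 * S" using assms by linarith
  then have "q * ((2 + N * N * 4) + ((2 + l * 6) + (2 + N * N * 3))) \<le> q * (19 * S)" by (rule mult_left_mono) simp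
  then have bt: "((2 + N * N * 3) + ((q * ((2 + N * N * 4) + ((2 + l * 6) + (2 + N * N * 3))) + 1) + (2 + N * N * 6))) + 2
    \<le> q * (19 * S) + 16 * S" (is "?bt \<le> _")
    using assms by linarith
  have "j' * ?bt \<le> j' * (q * (19 * S) + 16 * S)" by (rule mult_left_mono[OF bt]) simp
  also have "\<dots> = 19 * q * (j' * S) + 16 * (j' * S)" by (simp add: algebra_simps)
  finally have 1: "j' * ?bt \<le> 19 * q * (j' * S) + 16 * (j' * S)" .
  have 2: "j' * (N * N) * (Suc 1 + 2) \<le> 4 * (j' * S)"
    using mult_left_mono[OF assms(1), of j'] by simp
  have "N * (Suc (h * 1 + 1) + 2) \<le> S * (Suc (h * 1 + 1) + 2)" by (rule mult_right_mono[OF N]) simp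
  also have "\<dots> = h * S + 4 * S" by (simp add: algebra_simps)
  finally have 3: "N * (Suc (h * 1 + 1) + 2) \<le> h * S + 4 * S" .
  have 4: "c \<le> c * S" "1 \<le> S" using assms(4) by auto
  have "(60 + c + h + 19 * q) * ((j' + 1) * S) = 60 * (j' * S) + 60 * S + c * (j' * S) + c * S + h * (j' * S) + h * S
      + 19 * q * (j' * S) + 19 * q * S" by (simp add: algebra_simps)
  then show ?thesis using 1 2 3 4 assms(3) by linarith
qed

context pattern
begin

text \<open>The interface between machine and graphs: \<open>adj\<close> and \<open>col\<close> are
  arbitrary bounded arrays. The program, the word exponent and the constant are chosen before the
  input, as a uniform algorithm requires.\<close>

lemma search_algorithm:
  fixes P :: com and cs :: "rat list" and bP :: nat and T :: "nat \<Rightarrow> real"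
  assumes alg: "\<And>N. \<exists>is out t s. slp_multiplies N is out \<and> real (length is) \<le> T N \<and>
    exec ((N + 2) ^ bP) P (size_input N) t s \<and> real t \<le> T N \<and> slp_stored cs s is out"
  shows "\<exists>Q b C. \<forall>n adj col m s0. n \<le> m \<longrightarrow> (\<forall>i. adj i \<le> 1) \<longrightarrow> (\<forall>i. col i \<le> m) \<longrightarrow>
    (EH \<noteq> [] \<longrightarrow> (\<forall>i\<ge>n ^ j * (n ^ k * n ^ k). col i = 0)) \<longrightarrow>
    coloured_pattern.fresh n adj col s0 \<longrightarrow> s0 7 0 = 0 \<longrightarrow>
    (\<exists>t s. exec ((m + 2) ^ b) Q s0 t s \<and> real t \<le> real C * ((real n ^ j + 1) * (T (n ^ k) + 2)) \<and>
      coloured_pattern.result k j EH n adj col s)"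
proof -
  define D where "D = common_denom cs"
  define K where "K = (\<Sum>r\<leftarrow>cs. nat \<bar>\<lfloor>r * of_nat D\<rfloor>\<bar>)"
  \<comment> \<open>For B = m + 2: D is at most B^D, and 2m + 2 at most B^2; the final 1 absorbs the
    increment in \<open>M\<close>.\<close>
  define eM where "eM = D + 2 * bound_exponent + 1"
  \<comment> \<open>Collects the exponents of all word bounds below. A constant x of the program
    contributes x itself, because x < 2^x.\<close>
  define b where "b = 10 + weight_exponent + 2 * bound_exponent + 3 * eM + K + length cs + D + (k + 2) * (bP + 1) + 3 * k + j"
  define Q where "Q = Seq (prepare cs) (Seq (shift_com 20 P) search)"
  define C where "C = 60 + length cs + h + 19 * length monomials"
  have D: "0 < D" unfolding D_def by (rule common_denom_pos)
  have main: "\<exists>t s. exec ((m + 2) ^ b) Q s0 t s \<and> real t \<le> real C * ((real n ^ j + 1) * (T (n ^ k) + 2)) \<and>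
      coloured_pattern.result k j EH n adj col s"
    if n: "n \<le> m" and adj: "\<And>i. adj i \<le> 1" and col: "\<And>i. col i \<le> m"
      and zero: "EH \<noteq> [] \<Longrightarrow> \<forall>i\<ge>n ^ j * (n ^ k * n ^ k). col i = 0"
      and fresh: "coloured_pattern.fresh n adj col s0" and s07: "s0 7 0 = 0"
    for n m :: nat and adj col :: "nat \<Rightarrow> nat" and s0 :: memory
  proof -
    interpret cp: coloured_pattern k j EH n adj col by unfold_locales
    define B where "B = m + 2"
    define W where "W = B ^ b"
    define N where "N = n ^ k"
    have B: "2 \<le> B" "n \<le> B" "m \<le> B" using n by (auto simp: B_def)
    have le_W: "x \<le> W" if "x \<le> B ^ e" "e \<le> b" for x e
      unfolding W_def using that power_increasing[of e b B] B by linarith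
    have lt_W: "x < W" if "x \<le> B ^ e" "e + 1 \<le> b" for x e
    proof -
      have "B ^ e < B ^ (e + 1)" using B by (simp add: power_strict_increasing)
      also have "\<dots> \<le> W" using that(2) by (intro le_W[OF order_refl])
      finally show ?thesis using that(1) by simp
    qed
    have pow2: "x \<le> B ^ x" for x
    proof -
      have "x < 2 ^ x" by (rule less_exp)
      also have "\<dots> \<le> B ^ x" using B by (intro power_mono) auto
      finally show ?thesis by simp
    qed
    have B2: "2 * m + 2 \<le> B ^ 2" by (simp add: B_def power2_eq_square)
    have X_le: "(2 * m + 2) ^ bound_exponent \<le> B ^ (2 * bound_exponent)"
      unfolding power_mult using B2 by (intro power_mono) auto
    have M_le: "D * (2 * m + 2) ^ bound_exponent + 1 \<le> B ^ eM"
    proof -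
      have "D * (2 * m + 2) ^ bound_exponent \<le> B ^ D * B ^ (2 * bound_exponent)"
        by (intro mult_le_mono pow2 X_le)
      then have "D * (2 * m + 2) ^ bound_exponent \<le> B ^ (D + 2 * bound_exponent)"
        by (simp add: power_add)
      moreover have "1 \<le> B ^ (D + 2 * bound_exponent)" using B by simp
      ultimately have "D * (2 * m + 2) ^ bound_exponent + 1 \<le> 2 * B ^ (D + 2 * bound_exponent)" by linarith
      also have "\<dots> \<le> B * B ^ (D + 2 * bound_exponent)" using B by (intro mult_right_mono) auto
      finally show ?thesis by (simp add: eM_def power_add mult.commute mult.left_commute)
    qed
    have N_le: "N \<le> B ^ k" unfolding N_def using B by (intro power_mono) auto
    have NN_le: "N * N \<le> B ^ (2 * k)"
      using mult_le_mono[OF N_le N_le] by (simp add: power_add[symmetric] mult_2)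
    have nj_le: "n ^ j \<le> B ^ j" using B by (intro power_mono) auto
    have loop_le: "n ^ j * (N * N) \<le> B ^ (j + 2 * k)"
      unfolding power_add by (intro mult_le_mono nj_le NN_le)
    have N2: "N + 2 \<le> B ^ (k + 2)"
    proof -
      have "N + 2 \<le> B ^ k + 2 * B ^ k" using N_le B one_le_power[of B k] by linarith
      also have "\<dots> \<le> B ^ k * (2 * 2)" by simp
      also have "\<dots> \<le> B ^ k * (B * B)" using B by (intro mult_le_mono) auto
      finally show ?thesis by (simp add: power_add power2_eq_square mult.commute mult.left_commute)
    qed
    obtain "is" out tP sP where slp: "slp_multiplies N is out" "real (length is) \<le> T N"
      "exec ((N + 2) ^ bP) P (size_input N) tP sP" "real tP \<le> T N" "slp_stored cs sP is out"
      using alg by blast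
    have NN_T: "N * N \<le> tP + 1" by (rule multiplication_program_time[OF slp(1,3,5)])
    \<comment> \<open>The exponent is raised by 1 because for \<open>bP = 0\<close> the word size of
      \<open>P\<close> would not bound its input \<open>N\<close>.\<close>
    let ?W0 = "(N + 2) ^ (bP + 1)"
    have W0_le: "?W0 \<le> B ^ ((k + 2) * (bP + 1))"
      unfolding power_mult using N2 by (intro power_mono) auto
    have sP: "sP a i \<le> ?W0" for a i
    proof -
      have "exec ?W0 P (size_input N) tP sP"
        by (rule exec_mono[OF slp(3)]) (simp add: power_increasing)
      moreover have "size_input N a i \<le> ?W0" for a i
        using self_le_power[of "N + 2" "bP + 1"] by (simp add: size_input_def)
      ultimately show ?thesis using exec_bounded by blast
    qed
    \<comment> \<open>The length of the straight-line program is polynomially bounded because the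
      listing program stores it in a word.\<close>
    have len: "length is \<le> ?W0" using sP[of 1 0] slp(5) by (simp add: slp_stored_def)
    have sP_W: "sP a i \<le> W" for a i
      by (rule le_W[OF le_trans[OF sP W0_le]]) (simp add: b_def)
    have cells: "2 * N * N + length is < W"
    proof -
      let ?e = "2 * k + (k + 2) * (bP + 1)"
      have "B ^ (2 * k) \<le> B ^ ?e" "B ^ ((k + 2) * (bP + 1)) \<le> B ^ ?e"
        using B by (intro power_increasing; linarith)+
      then have "N * N \<le> B ^ ?e" "length is \<le> B ^ ?e"
        using NN_le len W0_le by linarith+
      then have "2 * (N * N) + length is \<le> (2 * 2) * B ^ ?e" by linarith
      also have "\<dots> \<le> (B * B) * B ^ ?e" using B by (intro mult_le_mono) auto
      also have "\<dots> = B ^ (2 + ?e)" by (simp only: power_add power2_eq_square)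
      finally have "2 * (N * N) + length is < W" by (rule lt_W) (simp add: b_def)
      then show ?thesis by (simp add: mult.assoc)
    qed
    have prep: "triple W (\<lambda>s. cp.fresh s \<and> s 7 0 = 0) (prepare cs)
      (1 + (1 + (1 + ((2 + n ^ j * (n ^ k * n ^ k) * (Suc 1 + 2)) + (1 + (1 + ((length cs * 1 + 1) + 1)))))))
      (\<lambda>s. \<exists>mx\<le>m. (\<forall>i < n ^ j * (n ^ k * n ^ k). col i \<le> mx) \<and>
        s 0 0 = n \<and> s 1 = adj \<and> s 2 = col \<and> s 3 0 = 0 \<and> s 12 0 = 0 \<and> s 13 0 = 0 \<and>
        s 5 0 = n ^ k \<and> s 6 0 = n ^ j \<and> s 18 0 = n ^ k * n ^ k \<and> s 9 0 = common_denom cs * (n + mx + 2) ^ bound_exponent + 1 \<and>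
        (\<forall>i<length cs. s 15 i < common_denom cs * (n + mx + 2) ^ bound_exponent + 1 \<and>
           residue_of (int (common_denom cs)) (int (common_denom cs * (n + mx + 2) ^ bound_exponent + 1)) (cs ! i) (int (s 15 i))) \<and>
        (\<forall>a. s (20 + a) = size_input (n ^ k) a))"
    proof (rule cp.prepare)
      show "n \<le> m" "\<And>i. col i \<le> m" by fact+
      show "2 * m + 2 \<le> W" by (rule le_W[OF B2]) (simp add: b_def)
      show "(2 * m + 2) ^ bound_exponent \<le> W" by (rule le_W[OF X_le]) (simp add: b_def)
      show "n ^ k \<le> W" using le_W[OF N_le] by (simp add: b_def N_def)
      show "n ^ j \<le> W" by (rule le_W[OF nj_le]) (simp add: b_def)
      show "n ^ k * n ^ k \<le> W" using le_W[OF NN_le] by (simp add: b_def N_def)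
      show "n ^ j * (n ^ k * n ^ k) < W" using lt_W[OF loop_le] by (simp add: b_def N_def)
      show "common_denom cs * (2 * m + 2) ^ bound_exponent + 1 \<le> W"
        using le_W[OF M_le] by (simp add: b_def D_def)
      show "common_denom cs \<le> W" using le_W[OF pow2[of D]] by (simp add: b_def D_def)
      show "length cs \<le> W" using le_W[OF pow2[of "length cs"]] by (simp add: b_def)
      fix r assume r: "r \<in> set cs"
      have "nat \<bar>\<lfloor>r * of_nat D\<rfloor>\<bar> \<le> K"
        unfolding K_def using r by (intro member_le_sum_list) auto
      then have "nat \<bar>\<lfloor>r * of_nat D\<rfloor>\<bar> * (D * (2 * m + 2) ^ bound_exponent + 1) \<le> B ^ K * B ^ eM"
        using pow2[of K] M_le by (intro mult_le_mono) auto
      also have "\<dots> = B ^ (K + eM)" by (simp add: power_add)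
      finally have "nat \<bar>\<lfloor>r * of_nat D\<rfloor>\<bar> * (D * (2 * m + 2) ^ bound_exponent + 1) \<le> W"
        by (rule le_W) (simp add: b_def)
      then show "nat \<bar>\<lfloor>r * of_nat (common_denom cs)\<rfloor>\<bar> * (common_denom cs * (2 * m + 2) ^ bound_exponent + 1) \<le> W"
        by (simp add: D_def)
    qed
    obtain t1 s1 mx where s1: "t1 \<le> 1 + (1 + (1 + ((2 + n ^ j * (n ^ k * n ^ k) * (Suc 1 + 2)) + (1 + (1 + ((length cs * 1 + 1) + 1))))))"
      "exec W (prepare cs) s0 t1 s1" and mx: "mx \<le> m" "\<forall>i < n ^ j * (n ^ k * n ^ k). col i \<le> mx"
      and s1': "s1 0 0 = n" "s1 1 = adj" "s1 2 = col" "s1 3 0 = 0" "s1 12 0 = 0" "s1 13 0 = 0"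
        "s1 5 0 = n ^ k" "s1 6 0 = n ^ j" "s1 18 0 = n ^ k * n ^ k" "s1 9 0 = common_denom cs * (n + mx + 2) ^ bound_exponent + 1"
        "\<forall>i<length cs. s1 15 i < common_denom cs * (n + mx + 2) ^ bound_exponent + 1 \<and>
           residue_of (int (common_denom cs)) (int (common_denom cs * (n + mx + 2) ^ bound_exponent + 1)) (cs ! i) (int (s1 15 i))"
        "\<forall>a. s1 (20 + a) = size_input (n ^ k) a"
      using prep fresh s07 unfolding triple_def by blast
    have "exec W P (size_input N) tP sP"
      using slp(3)
    proof (rule exec_mono)
      have "(N + 2) ^ bP \<le> ?W0" by (simp add: power_increasing)
      then show "(N + 2) ^ bP \<le> W" using le_W[OF le_trans[OF _ W0_le]] by (simp add: b_def)
    qed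
    from exec_shift[OF this, of s1 20] s1'(12)
    obtain s2 where s2: "exec W (shift_com 20 P) s1 tP s2" "\<forall>a. s2 (20 + a) = sP a" "\<forall>a<20. s2 a = s1 a"
      unfolding N_def by auto
    define M where "M = D * (n + mx + 2) ^ bound_exponent + 1"
    have M_B: "M \<le> B ^ eM"
    proof -
      have "(n + mx + 2) ^ bound_exponent \<le> (2 * m + 2) ^ bound_exponent"
        using n mx(1) by (intro power_mono) auto
      then have "M \<le> D * (2 * m + 2) ^ bound_exponent + 1" unfolding M_def by simp
      then show ?thesis using M_le by simp
    qed
    interpret mr: matmul_run k j EH n adj col B W M D "is" out cs "s1 15" "sP 2" "sP 3" "sP 4" "sP 5"
    proof unfold_locales
      show "n \<le> B" "2 \<le> B" by fact+
      show "adj i \<le> 1" for i by fact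
      show "\<forall>i. col i \<le> B" using col B le_trans by blast
      show "B ^ weight_exponent \<le> W" by (rule le_W[OF order_refl]) (simp add: b_def)
      show "slp_multiplies (n ^ k) is out" using slp(1) by (simp add: N_def)
      show "instr_code cs (is ! l) (sP 2 l, sP 3 l, sP 4 l)" if "l < length is" for l
        using slp(5) that by (simp add: slp_stored_def)
      show "sP 5 l = out ! l" if "l < n ^ k * n ^ k" for l
        using slp(1,5) that by (simp add: slp_stored_def slp_multiplies_def N_def)
      show "s1 15 x < M \<and> residue_of (int D) (int M) (cs ! x) (int (s1 15 x))" if "x < length cs" for x
        using s1'(11) that unfolding M_def D_def by blast
      have "coprime (int D) (int D * int ((n + mx + 2) ^ bound_exponent) + 1)"
        by (metis coprime_add_one_right coprime_mult_left_iff)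
      then show "coprime (int D) (int M)" unfolding M_def by simp
      show "0 < M" by (simp add: M_def)
      show "cp.total z a c < int M" if "z < n ^ j" for z a c
      proof -
        have "cp.total z a c \<le> int ((n + mx + 2) ^ (k + weight_exponent))"
        proof (rule cp.total_le)
          \<comment> \<open>Without edges the scan may miss colours, but then no colour enters the
            weight. With edges all cells beyond the scan are 0.\<close>
          assume ne: "EH \<noteq> []"
          show "\<forall>i. col i \<le> n + mx + 2"
          proof
            fix i
            show "col i \<le> n + mx + 2"
              using mx(2) zero[OF ne] by (cases "i < n ^ j * (n ^ k * n ^ k)") (auto simp: trans_le_add1 trans_le_add2)
          qed
        qed (use that adj in auto)
        also have "(n + mx + 2) ^ (k + weight_exponent) < M"
          using D unfolding M_def bound_exponent_def by (cases D) auto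
        finally show ?thesis by simp
      qed
      have "M + M * M \<le> 2 * (M * M)" using le_square[of M] by linarith
      also have "\<dots> \<le> B * (B ^ eM * B ^ eM)" using B M_B by (intro mult_le_mono)
      also have "\<dots> = B ^ (1 + 2 * eM)" by (simp add: power_add mult_2)
      finally show "M + M * M \<le> W" by (rule le_W) (simp add: b_def)
      show "2 * n ^ k * n ^ k + length is < W" using cells by (simp add: N_def)
      show "sP 2 l \<le> W \<and> sP 3 l \<le> W \<and> sP 4 l \<le> W \<and> sP 5 l \<le> W" for l using sP_W by blast
      show "n ^ j < W" by (rule lt_W[OF nj_le]) (simp add: b_def)
    qed
    have "mr.env (s2 11 0) 0 0 0 s2"
    proof -
      have low: "s2 0 = s1 0" "s2 1 = s1 1" "s2 2 = s1 2" "s2 3 = s1 3" "s2 5 = s1 5" "s2 6 = s1 6" "s2 9 = s1 9"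
        "s2 12 = s1 12" "s2 13 = s1 13" "s2 15 = s1 15" "s2 18 = s1 18"
        using s2(3) by auto
      have high: "s2 21 = sP 1" "s2 22 = sP 2" "s2 23 = sP 3" "s2 24 = sP 4" "s2 25 = sP 5"
        using s2(2)[rule_format, of 1] s2(2)[rule_format, of 2] s2(2)[rule_format, of 3]
          s2(2)[rule_format, of 4] s2(2)[rule_format, of 5] by auto
      have "sP 1 0 = length is" using slp(5) by (simp add: slp_stored_def)
      then show ?thesis
        unfolding mr.env_def mr.input_def mr.N_def low high using s1' by (simp add: M_def D_def)
    qed
    then obtain t3 s3 where s3: "t3 \<le> (2 + n ^ j * (((2 + mr.N * mr.N * 3) + ((length monomials * ((2 + mr.N * mr.N * 4) + ((2 + length is * 6) + (2 + mr.N * mr.N * 3))) + 1) + (2 + mr.N * mr.N * 6))) + 2)) +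
       Suc (2 + mr.N * (Suc (h * 1 + 1) + 2))" "exec W search s2 t3 s3" "cp.result s3"
      using mr.search unfolding triple_def by blast
    have run: "exec W Q s0 (t1 + (tP + t3)) s3"
      unfolding Q_def by (rule exec.Seq[OF s1(2) exec.Seq[OF s2(1) s3(2)]])
    have mrN: "mr.N = N" by (simp add: mr.N_def N_def)
    define S where "S = max (tP + 1) (length is)"
    have S_T: "real S \<le> T N + 2" using slp(2,4) unfolding S_def by (auto simp: max_def)
    have "t1 + (tP + t3) \<le> (60 + length cs + h + 19 * length monomials) * ((n ^ j + 1) * S)"
      by (rule le_trans[OF add_mono[OF s1(1) add_mono[OF order_refl s3(1)]]],
          unfold mrN N_def[symmetric], rule total_time_le)
        (use NN_T in \<open>auto simp: S_def\<close>)
    then have "real (t1 + (tP + t3)) \<le> real (C * ((n ^ j + 1) * S))"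
      unfolding C_def of_nat_le_iff .
    also have "\<dots> = real C * ((real n ^ j + 1) * real S)" by simp
    also have "\<dots> \<le> real C * ((real n ^ j + 1) * (T N + 2))"
      using S_T by (intro mult_left_mono) auto
    finally show ?thesis
      using run s3(3) unfolding W_def B_def N_def by blast
  qed
  show ?thesis
    by (rule exI[of _ Q], rule exI[of _ b], rule exI[of _ C]) (use main in blast)
qed

end

section \<open>Rainbow subgraphs as vertex assignments\<close>

definition edge_list :: "'h graph \<Rightarrow> 'h list \<Rightarrow> (nat \<times> nat) list" where
  "edge_list H hs = filter (\<lambda>(u, v). {hs ! u, hs ! v} \<in> edges H) (pairs (length hs))"

lemma set_edge_list: "(u, v) \<in> set (edge_list H hs) \<longleftrightarrow> u < v \<and> v < length hs \<and> {hs ! u, hs ! v} \<in> edges H"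
  by (auto simp: edge_list_def set_pairs)

lemma distinct_edge_list: "distinct (edge_list H hs)"
  unfolding edge_list_def pairs_def by (intro distinct_filter distinct_product) auto

lemma edge_list_surj:
  assumes "simple_graph H" "set hs = verts H" "e \<in> edges H"
  obtains u v where "(u, v) \<in> set (edge_list H hs)" "e = {hs ! u, hs ! v}"
proof -
  have "card e = 2" "e \<subseteq> set hs" using assms unfolding simple_graph_def by auto
  then obtain x y where xy: "e = {x, y}" "x \<noteq> y" "x \<in> set hs" "y \<in> set hs"
    by (auto simp: card_2_iff)
  then obtain u v where "u < length hs" "v < length hs" "x = hs ! u" "y = hs ! v"
    by (auto simp: in_set_conv_nth)
  then show ?thesis
    using that[of u v] that[of v u] xy assms(3) by (cases u v rule: linorder_cases) (auto simp: set_edge_list insert_commute)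
qed

lemma edge_list_inj:
  assumes "distinct hs" "(u, v) \<in> set (edge_list H hs)" "(u', v') \<in> set (edge_list H hs)"
    and "{hs ! u, hs ! v} = {hs ! u', hs ! v'}"
  shows "u = u' \<and> v = v'"
  using assms by (auto simp: set_edge_list doubleton_eq_iff nth_eq_iff_index_eq)

lemma graph_input_entries:
  assumes "x < length vs" "y < length vs"
  shows "graph_input vs code G c 1 (x * length vs + y) = (if {vs ! x, vs ! y} \<in> edges G then 1 else 0)"
    and "graph_input vs code G c 2 (x * length vs + y) =
      (if {vs ! x, vs ! y} \<in> edges G then code (c {vs ! x, vs ! y}) else 0)"
proof -
  have "Suc x * length vs \<le> length vs * length vs" using assms by (intro mult_right_mono) auto
  then have "x * length vs + y < length vs * length vs" using assms by simp
  moreover have "length vs \<noteq> 0" using assms by linarith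
  then have "(x * length vs + y) div length vs = x + y div length vs" by (rule div_mult_self3)
  then have "(x * length vs + y) div length vs = x" by (simp only: div_less[OF assms(2)] add_0_right)
  ultimately show "graph_input vs code G c 1 (x * length vs + y) = (if {vs ! x, vs ! y} \<in> edges G then 1 else 0)"
    and "graph_input vs code G c 2 (x * length vs + y) =
      (if {vs ! x, vs ! y} \<in> edges G then code (c {vs ! x, vs ! y}) else 0)"
    using assms by (auto simp: graph_input_def Let_def)
qed

locale rainbow_instance =
  coloured_pattern k j "edge_list H hs" "length vs" "graph_input vs code G c 1" "graph_input vs code G c 2"
  for k j :: nat and H :: "'h graph" and hs :: "'h list" and G :: "'v graph" and c :: "'v set \<Rightarrow> 'c"
    and vs :: "'v list" and code :: "'c \<Rightarrow> nat" +
  assumes H: "simple_graph H" "length hs = 3 * k + j" "distinct hs" "set hs = verts H"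
    and G: "simple_graph G" "distinct vs" "set vs = verts G" "inj_on code (c ` edges G)"
begin

text \<open>\<open>code\<close> is injective on the colours in use, so comparing stored numbers is
  comparing colours.\<close>

lemma rainbow_copy_iff:
  assumes \<phi>: "\<And>i. i < h \<Longrightarrow> \<phi> i < length vs"
  shows "rainbow_copy \<phi> \<longleftrightarrow> inj_on \<phi> {..<h} \<and>
    (\<forall>(u, v)\<in>set (edge_list H hs). {vs ! \<phi> u, vs ! \<phi> v} \<in> edges G) \<and>
    inj_on (\<lambda>(u, v). c {vs ! \<phi> u, vs ! \<phi> v}) (set (edge_list H hs))"
proof -
  have lt: "\<phi> u < length vs \<and> \<phi> v < length vs" if "(u, v) \<in> set (edge_list H hs)" for u v
    using that \<phi> H(2) by (auto simp: set_edge_list)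
  have adj: "(\<forall>(u, v)\<in>set (edge_list H hs). graph_input vs code G c 1 (\<phi> u * length vs + \<phi> v) \<noteq> 0) \<longleftrightarrow>
      (\<forall>(u, v)\<in>set (edge_list H hs). {vs ! \<phi> u, vs ! \<phi> v} \<in> edges G)"
  proof (rule ball_cong[OF refl], clarify)
    fix u v assume "(u, v) \<in> set (edge_list H hs)"
    then show "(graph_input vs code G c 1 (\<phi> u * length vs + \<phi> v) \<noteq> 0) = ({vs ! \<phi> u, vs ! \<phi> v} \<in> edges G)"
      using lt graph_input_entries(1)[of "\<phi> u" vs "\<phi> v" code G c] by simp
  qed
  moreover have "inj_on (colour \<phi>) (set (edge_list H hs)) \<longleftrightarrow>
      inj_on (\<lambda>(u, v). c {vs ! \<phi> u, vs ! \<phi> v}) (set (edge_list H hs))"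
    \<comment> \<open>The colour cell of a non-edge is 0 and says nothing about \<open>c\<close>;
      colours are compared only once all the pairs are known to be edges.\<close>
    if edge: "\<forall>(u, v)\<in>set (edge_list H hs). {vs ! \<phi> u, vs ! \<phi> v} \<in> edges G"
  proof -
    have "colour \<phi> p = (code \<circ> (\<lambda>(u, v). c {vs ! \<phi> u, vs ! \<phi> v})) p" if "p \<in> set (edge_list H hs)" for p
    proof -
      obtain u v where p: "p = (u, v)" by (cases p)
      then have "{vs ! \<phi> u, vs ! \<phi> v} \<in> edges G" using that edge by blast
      then show ?thesis
        using that lt graph_input_entries(2)[of "\<phi> u" vs "\<phi> v" code G c] by (simp add: p colour_def)
    qed
    then have "inj_on (colour \<phi>) (set (edge_list H hs)) \<longleftrightarrow>
        inj_on (code \<circ> (\<lambda>(u, v). c {vs ! \<phi> u, vs ! \<phi> v})) (set (edge_list H hs))"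
      by (rule inj_on_cong)
    also have "\<dots> \<longleftrightarrow> inj_on (\<lambda>(u, v). c {vs ! \<phi> u, vs ! \<phi> v}) (set (edge_list H hs))"
    proof
      assume "inj_on (\<lambda>(u, v). c {vs ! \<phi> u, vs ! \<phi> v}) (set (edge_list H hs))"
      then show "inj_on (code \<circ> (\<lambda>(u, v). c {vs ! \<phi> u, vs ! \<phi> v})) (set (edge_list H hs))"
        by (rule comp_inj_on) (rule inj_on_subset[OF G(4)], use edge in auto)
    qed (rule inj_on_imageI2)
    finally show ?thesis .
  qed
  ultimately show ?thesis unfolding rainbow_copy_def by blast
qed

text \<open>The subgraph is the image of \<open>H\<close> under the map sending
  \<open>hs ! i\<close> to \<open>vs ! \<phi> i\<close>; it takes over only the edges of
  \<open>H\<close>, since it need not be induced.\<close>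

lemma rainbow_copy_imp_subgraph:
  assumes \<phi>: "\<And>i. i < h \<Longrightarrow> \<phi> i < length vs" and copy: "rainbow_copy \<phi>"
  shows "\<exists>S f. H_subgraph H G S \<and> rainbow c S \<and> graph_iso f H S \<and> (\<forall>i<length hs. f (hs ! i) = vs ! \<phi> i)"
proof -
  have inj: "inj_on \<phi> {..<h}" and edge: "\<And>u v. (u, v) \<in> set (edge_list H hs) \<Longrightarrow> {vs ! \<phi> u, vs ! \<phi> v} \<in> edges G"
    and col: "inj_on (\<lambda>(u, v). c {vs ! \<phi> u, vs ! \<phi> v}) (set (edge_list H hs))"
    using rainbow_copy_iff[of \<phi>] \<phi> copy by auto
  define f where "f x = vs ! \<phi> (the_inv_into {..<h} ((!) hs) x)" for x
  have hs_inj: "inj_on ((!) hs) {..<h}" using H(2,3) by (simp add: inj_on_nth)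
  have f: "f (hs ! i) = vs ! \<phi> i" if "i < h" for i
    unfolding f_def using the_inv_into_f_f[OF hs_inj, of i] that by simp
  have f_edge: "f ` {hs ! u, hs ! v} = {vs ! \<phi> u, vs ! \<phi> v}" if "(u, v) \<in> set (edge_list H hs)" for u v
    using that f H(2) by (simp add: set_edge_list)
  define S where "S = \<lparr>verts = f ` verts H, edges = (\<lambda>e. f ` e) ` edges H\<rparr>"
  have f_inj: "inj_on f (verts H)"
  proof (rule inj_onI)
    fix x y assume xy: "x \<in> verts H" "y \<in> verts H" "f x = f y"
    then obtain u v where uv: "u < h" "v < h" "x = hs ! u" "y = hs ! v"
      using H(2,4) by (metis in_set_conv_nth)
    then have "\<phi> u = \<phi> v" using xy(3) f \<phi> G(2) by (simp add: nth_eq_iff_index_eq)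
    then show "x = y" using inj uv by (auto simp: inj_on_def)
  qed
  have edges_S: "edges S \<subseteq> edges G"
  proof
    fix d assume "d \<in> edges S"
    then obtain e where e: "e \<in> edges H" "d = f ` e" by (auto simp: S_def)
    obtain u v where uv: "(u, v) \<in> set (edge_list H hs)" "e = {hs ! u, hs ! v}"
      by (rule edge_list_surj[OF H(1,4) e(1)])
    show "d \<in> edges G" unfolding e(2) uv(2) f_edge[OF uv(1)] by (rule edge[OF uv(1)])
  qed
  have verts_S: "verts S \<subseteq> verts G"
  proof
    fix y assume "y \<in> verts S"
    then obtain x where x: "x \<in> set hs" "y = f x" using H(4) by (auto simp: S_def)
    then obtain u where u: "u < h" "x = hs ! u" using H(2) by (auto simp: in_set_conv_nth)
    then show "y \<in> verts G" using f[OF u(1)] nth_mem[OF \<phi>[OF u(1)]] G(3) x by simp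
  qed
  have "simple_graph S"
    unfolding simple_graph_def
  proof (intro conjI ballI)
    show "finite (verts S)" using verts_S G(1) finite_subset unfolding simple_graph_def by blast
    fix e assume e: "e \<in> edges S"
    then show "card e = 2" using edges_S G(1) unfolding simple_graph_def by blast
    show "e \<subseteq> verts S" using e H(1) by (auto simp: S_def simple_graph_def)
  qed
  then have sub: "subgraph_of S G" unfolding subgraph_of_def using verts_S edges_S by blast
  have iso: "graph_iso f H S"
    unfolding graph_iso_def S_def using f_inj by (simp add: bij_betw_def)
  have "rainbow c S"
    unfolding rainbow_def
  proof (rule inj_onI)
    fix d d' assume d: "d \<in> edges S" "d' \<in> edges S" "c d = c d'"
    then obtain e e' where e: "e \<in> edges H" "e' \<in> edges H" "d = f ` e" "d' = f ` e'" by (auto simp: S_def)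
    obtain u v where uv: "(u, v) \<in> set (edge_list H hs)" "e = {hs ! u, hs ! v}" by (rule edge_list_surj[OF H(1,4) e(1)])
    obtain u' v' where uv': "(u', v') \<in> set (edge_list H hs)" "e' = {hs ! u', hs ! v'}" by (rule edge_list_surj[OF H(1,4) e(2)])
    have "(u, v) = (u', v')"
      using inj_onD[OF col _ uv(1) uv'(1)] d(3) unfolding e uv uv' f_edge[OF uv(1)] f_edge[OF uv'(1)] by simp
    then show "d = d'" using e uv uv' by simp
  qed
  then show ?thesis using sub iso f H(2) unfolding H_subgraph_def by (intro exI[of _ S] exI[of _ f]) auto
qed

lemma subgraph_imp_rainbow_copy:
  assumes "H_subgraph H G S" "rainbow c S"
  shows "\<exists>\<phi>. (\<forall>i<h. \<phi> i < length vs) \<and> rainbow_copy \<phi>"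
proof -
  obtain f where f: "bij_betw f (verts H) (verts S)" "(\<lambda>e. f ` e) ` edges H = edges S"
    and S: "verts S \<subseteq> verts G" "edges S \<subseteq> edges G"
    using assms(1) unfolding H_subgraph_def graph_iso_def subgraph_of_def by blast
  have f_inj: "inj_on f (verts H)" using f(1) by (rule bij_betw_imp_inj_on)
  have hs: "hs ! i \<in> verts H" if "i < h" for i using that H(2,4) nth_mem by metis
  have "\<exists>l<length vs. vs ! l = f (hs ! i)" if "i < h" for i
  proof -
    have "f (hs ! i) \<in> set vs" using hs[OF that] f(1) S(1) G(3) by (auto simp: bij_betw_def)
    then show ?thesis by (simp add: in_set_conv_nth)
  qed
  then obtain \<phi> where \<phi>: "\<And>i. i < h \<Longrightarrow> \<phi> i < length vs" "\<And>i. i < h \<Longrightarrow> vs ! \<phi> i = f (hs ! i)" by metis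
  have edge: "{vs ! \<phi> u, vs ! \<phi> v} = f ` {hs ! u, hs ! v}" "{hs ! u, hs ! v} \<in> edges H"
    if "(u, v) \<in> set (edge_list H hs)" for u v
    using that \<phi> H(2) by (simp_all add: set_edge_list)
  have "inj_on \<phi> {..<h}"
  proof (rule inj_onI)
    fix u v assume uv: "u \<in> {..<h}" "v \<in> {..<h}" "\<phi> u = \<phi> v"
    then have "f (hs ! u) = f (hs ! v)" using \<phi>(2)[of u] \<phi>(2)[of v] by simp
    then have "hs ! u = hs ! v" using inj_onD[OF f_inj] hs uv by auto
    then show "u = v" using uv H(2,3) by (simp add: nth_eq_iff_index_eq)
  qed
  moreover have "\<forall>(u, v)\<in>set (edge_list H hs). {vs ! \<phi> u, vs ! \<phi> v} \<in> edges G"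
  proof clarify
    fix u v assume uv: "(u, v) \<in> set (edge_list H hs)"
    have "f ` {hs ! u, hs ! v} \<in> edges S" using edge(2)[OF uv] f(2) by blast
    then show "{vs ! \<phi> u, vs ! \<phi> v} \<in> edges G" using S(2) unfolding edge(1)[OF uv] by blast
  qed
  moreover have "inj_on (\<lambda>(u, v). c {vs ! \<phi> u, vs ! \<phi> v}) (set (edge_list H hs))"
  proof (rule inj_onI, clarify)
    fix u v u' v'
    assume uv: "(u, v) \<in> set (edge_list H hs)" "(u', v') \<in> set (edge_list H hs)"
      and "c {vs ! \<phi> u, vs ! \<phi> v} = c {vs ! \<phi> u', vs ! \<phi> v'}"
    then have "c (f ` {hs ! u, hs ! v}) = c (f ` {hs ! u', hs ! v'})" by (simp only: edge(1))
    moreover have "f ` {hs ! u, hs ! v} \<in> edges S" "f ` {hs ! u', hs ! v'} \<in> edges S"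
      using edge(2)[OF uv(1)] edge(2)[OF uv(2)] f(2) by blast+
    ultimately have "f ` {hs ! u, hs ! v} = f ` {hs ! u', hs ! v'}"
      using assms(2) unfolding rainbow_def inj_on_def by blast
    moreover have "{hs ! u, hs ! v} \<subseteq> verts H" "{hs ! u', hs ! v'} \<subseteq> verts H"
      using edge(2)[OF uv(1)] edge(2)[OF uv(2)] H(1) unfolding simple_graph_def by blast+
    \<comment> \<open>Injectivity on vertices carries over to the images of edges.\<close>
    ultimately have "{hs ! u, hs ! v} = {hs ! u', hs ! v'}"
      using inj_on_image_eq_iff[OF f_inj] by blast
    then show "u = u' \<and> v = v'" by (rule edge_list_inj[OF H(3) uv])
  qed
  ultimately have "rainbow_copy \<phi>" using rainbow_copy_iff[of \<phi>] \<phi>(1) by blast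
  then show ?thesis using \<phi>(1) by blast
qed

lemma result_imp_finds:
  assumes "result s"
  shows "finds_rainbow_H_subgraph H hs G c vs s"
proof (cases "\<exists>S. H_subgraph H G S \<and> rainbow c S")
  case True
  then have s: "s 3 0 = 1" "\<forall>i<h. s 4 i < length vs" "rainbow_copy (s 4)"
    using assms subgraph_imp_rainbow_copy unfolding result_def by blast+
  then show ?thesis
    using True rainbow_copy_imp_subgraph[of "s 4"] H(2) unfolding finds_rainbow_H_subgraph_def by auto
next
  case False
  then have "s 3 0 = 0"
    using assms rainbow_copy_imp_subgraph[of "s 4"] unfolding result_def by blast
  then show ?thesis using False unfolding finds_rainbow_H_subgraph_def by simp
qed

end

section \<open>Running time\<close>

lemma le_power_self: "0 < k \<Longrightarrow> (n::nat) \<le> n ^ k"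
  using self_le_power[of n k] by (cases "n = 0") auto

lemma running_time:
  fixes T :: "nat \<Rightarrow> real" and \<omega> :: real and k j :: nat
  assumes T: "T \<in> O(\<lambda>n. real n powr \<omega>)" and sq: "\<And>N. real (N * N) \<le> T N + 1"
  shows "(\<lambda>n. C * ((real n ^ j + 1) * (T (n ^ k) + 2)))
    \<in> O(\<lambda>n. real n powr (\<omega> * real k + real j) * ln (real n))"
proof -
  have 1: "(\<lambda>n. real n ^ j + 1) \<in> O(\<lambda>n. real n powr real j)"
  proof (rule bigoI[where c = 2], rule eventually_mono[OF eventually_gt_at_top[of 0]])
    fix n :: nat assume n: "0 < n"
    then have "1 \<le> real n ^ j" by (intro one_le_power) simp
    then show "norm (real n ^ j + 1) \<le> 2 * norm (real n powr real j)"
      using n by (simp add: powr_realpow)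
  qed
  have 2: "(\<lambda>n. T (n ^ k) + 2) \<in> O(\<lambda>n. real n powr (\<omega> * real k))"
  proof (cases "k = 0")
    \<comment> \<open>Here only \<open>T 1\<close> is evaluated, about which the asymptotic bound on
      \<open>T\<close> says nothing; a constant suffices.\<close>
    case True
    show ?thesis
      by (rule bigoI[where c = "\<bar>T 1 + 2\<bar>"], rule eventually_mono[OF eventually_gt_at_top[of 0]])
        (use True in simp)
  next
    case False
    \<comment> \<open>As \<open>T\<close> dominates the square up to 1, it is at least 3 from
      \<open>N = 2\<close> on, which absorbs the added 2.\<close>
    have "(\<lambda>N. T N + 2) \<in> O(T)"
    proof (rule bigoI[where c = 3], rule eventually_mono[OF eventually_ge_at_top[of 2]])
      fix N :: nat assume "2 \<le> N"
      then have "2 * 2 \<le> N * N" by (intro mult_le_mono)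
      then have "4 \<le> real (N * N)" by linarith
      then have "3 \<le> T N" using sq[of N] by linarith
      then show "norm (T N + 2) \<le> 3 * norm (T N)" by simp
    qed
    then have "(\<lambda>N. T N + 2) \<in> O(\<lambda>N. real N powr \<omega>)" using T by (rule landau_o.big_trans)
    moreover have "filterlim (\<lambda>n::nat. n ^ k) at_top at_top"
    proof (rule filterlim_at_top_mono[OF filterlim_ident])
      show "eventually (\<lambda>n::nat. n \<le> n ^ k) at_top"
        using False le_power_self by (intro always_eventually allI) simp
    qed
    ultimately have "(\<lambda>n. T (n ^ k) + 2) \<in> O(\<lambda>n. real (n ^ k) powr \<omega>)"
      by (rule landau_o.big.compose)
    also have "(\<lambda>n. real (n ^ k) powr \<omega>) \<in> O(\<lambda>n. real n powr (\<omega> * real k))"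
    proof (rule bigoI[where c = 1], rule eventually_mono[OF eventually_gt_at_top[of 0]])
      fix n :: nat assume "0 < n"
      then show "norm (real (n ^ k) powr \<omega>) \<le> 1 * norm (real n powr (\<omega> * real k))"
        by (simp add: powr_realpow[symmetric] powr_powr mult.commute)
    qed
    finally show ?thesis .
  qed
  have "(\<lambda>n. (real n ^ j + 1) * (T (n ^ k) + 2)) \<in> O(\<lambda>n. real n powr real j * real n powr (\<omega> * real k))"
    using 1 2 by (rule landau_o.big.mult)
  then have 3: "(\<lambda>n. C * ((real n ^ j + 1) * (T (n ^ k) + 2))) \<in> O(\<lambda>n. real n powr (\<omega> * real k + real j))"
    by (cases "C = 0") (simp_all add: powr_add mult.commute)
  have "(\<lambda>n. real n powr (\<omega> * real k + real j)) \<in> O(\<lambda>n. real n powr (\<omega> * real k + real j) * ln (real n))"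
  \<comment> \<open>From 3 on the logarithm is at least 1, since e is at most 3.\<close>
  proof (rule bigoI[where c = 1], rule eventually_mono[OF eventually_ge_at_top[of 3]])
    fix n :: nat assume n: "3 \<le> n"
    have "exp 1 \<le> (3::real)" by (rule exp_le)
    also have "\<dots> \<le> real n" using n by simp
    finally have "1 \<le> ln (real n)" using n by (simp add: ln_ge_iff)
    then show "norm (real n powr (\<omega> * real k + real j)) \<le> 1 * norm (real n powr (\<omega> * real k + real j) * ln (real n))"
      by (simp add: abs_mult mult_left_mono[of 1 _ "_ powr _", simplified])
  qed
  with 3 show ?thesis by (rule landau_o.big_trans)
qed

theorem theorem1p6:
  fixes H :: "'h graph" and hs :: "'h list" and k j :: nat and \<omega> :: real
  assumes "simple_graph H" and "card (verts H) = 3 * k + j" and "j \<in> {0, 1, 2}"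
    and "distinct hs" and "set hs = verts H"
    and "admissible_matmul_exponent \<omega>"
  shows "\<exists>(P :: com) (b :: nat) (T :: nat \<Rightarrow> real).
    T \<in> O(\<lambda>n. real n powr (\<omega> * real k + real j) * ln (real n)) \<and>
    (\<forall>(G :: 'v graph) (c :: 'v set \<Rightarrow> 'c) (vs :: 'v list) (code :: 'c \<Rightarrow> nat) (m :: nat).
       simple_graph G \<longrightarrow> distinct vs \<longrightarrow> set vs = verts G \<longrightarrow>
       inj_on code (c ` edges G) \<longrightarrow>
       card (verts G) \<le> m \<longrightarrow> (\<forall>e\<in>edges G. code (c e) \<le> m) \<longrightarrow>
       (\<exists>t s. exec ((m + 2) ^ b) P (graph_input vs code G c) t s \<and>
          real t \<le> T (card (verts G)) \<and>
          finds_rainbow_H_subgraph H hs G c vs s))"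
proof -
  have hs: "length hs = 3 * k + j" using assms(2,4,5) distinct_card by metis
  interpret pattern k j "edge_list H hs"
    by unfold_locales (use distinct_edge_list[of H hs] in \<open>auto simp: edge_list_def hs\<close>)
  obtain P cs bP T where T: "T \<in> O(\<lambda>n. real n powr \<omega>)" and
    alg: "\<And>N. \<exists>is out t s. slp_multiplies N is out \<and> real (length is) \<le> T N \<and>
      exec ((N + 2) ^ bP) P (size_input N) t s \<and> real t \<le> T N \<and> slp_stored cs s is out"
    using assms(6) unfolding admissible_matmul_exponent_def by blast
  have sq: "real (N * N) \<le> T N + 1" for N
  proof -
    obtain "is" out t s where "slp_multiplies N is out" "exec ((N + 2) ^ bP) P (size_input N) t s"
      "real t \<le> T N" "slp_stored cs s is out" using alg by blast
    then have "N * N \<le> t + 1" "real t \<le> T N" using multiplication_program_time by blast+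
    then show ?thesis by linarith
  qed
  obtain Q b C where Q: "\<forall>n adj col m s0. n \<le> m \<longrightarrow> (\<forall>i. adj i \<le> 1) \<longrightarrow> (\<forall>i. col i \<le> m) \<longrightarrow>
    (edge_list H hs \<noteq> [] \<longrightarrow> (\<forall>i\<ge>n ^ j * (n ^ k * n ^ k). col i = 0)) \<longrightarrow>
    coloured_pattern.fresh n adj col s0 \<longrightarrow> s0 7 0 = 0 \<longrightarrow>
    (\<exists>t s. exec ((m + 2) ^ b) Q s0 t s \<and> real t \<le> real C * ((real n ^ j + 1) * (T (n ^ k) + 2)) \<and>
      coloured_pattern.result k j (edge_list H hs) n adj col s)"
    using search_algorithm[of T bP P cs] alg by blast
  let ?T = "\<lambda>n. real C * ((real n ^ j + 1) * (T (n ^ k) + 2))"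
  have "\<exists>t s. exec ((m + 2) ^ b) Q (graph_input vs code G c) t s \<and> real t \<le> ?T (card (verts G)) \<and>
      finds_rainbow_H_subgraph H hs G c vs s"
    if G: "simple_graph G" "distinct vs" "set vs = verts G" "inj_on code (c ` edges G)"
      and m: "card (verts G) \<le> m" "\<forall>e\<in>edges G. code (c e) \<le> m"
    for G :: "'v graph" and c :: "'v set \<Rightarrow> 'c" and vs :: "'v list" and code :: "'c \<Rightarrow> nat" and m :: nat
  proof -
    interpret rainbow_instance k j H hs G c vs code
      by unfold_locales (use assms hs G in auto)
    have n: "card (verts G) = length vs" using G(2,3) distinct_card by metis
    let ?n = "length vs" and ?adj = "graph_input vs code G c 1" and ?col = "graph_input vs code G c 2"
    have "?adj i \<le> 1" "?col i \<le> m" for i using m(2) by (auto simp: graph_input_def Let_def)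
    \<comment> \<open>An edge needs two vertices, so \<open>k\<close> is positive or
      \<open>j = 2\<close>; either way the scanned range includes the whole n by n colour
      matrix.\<close>
    moreover have "\<forall>i\<ge>?n ^ j * (?n ^ k * ?n ^ k). ?col i = 0" if ne: "edge_list H hs \<noteq> []"
    proof -
      obtain u v where "(u, v) \<in> set (edge_list H hs)" using ne by (cases "edge_list H hs") auto
      then have "2 \<le> h" using hs by (simp add: set_edge_list)
      then have "?n * ?n \<le> ?n ^ j * (?n ^ k * ?n ^ k)"
      proof (cases "k = 0")
        case True
        then have "j = 2" using \<open>2 \<le> h\<close> assms(3) by auto
        then show ?thesis using True by (simp add: power2_eq_square)
      next
        case False
        then have sq: "?n * ?n \<le> ?n ^ k * ?n ^ k" by (intro mult_le_mono le_power_self) auto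
        show ?thesis
        proof (cases "?n = 0")
          case False
          then have "1 * (?n ^ k * ?n ^ k) \<le> ?n ^ j * (?n ^ k * ?n ^ k)"
            by (intro mult_right_mono one_le_power) linarith+
          then show ?thesis using sq by linarith
        qed simp
      qed
      then show ?thesis by (auto simp: graph_input_def Let_def)
    qed
    moreover have "fresh (graph_input vs code G c)"
      unfolding fresh_def by (auto simp: graph_input_def Let_def)
    moreover have "graph_input vs code G c 7 0 = 0" by (simp add: graph_input_def Let_def)
    ultimately obtain t s where "exec ((m + 2) ^ b) Q (graph_input vs code G c) t s"
      "real t \<le> ?T ?n" "result s"
      using Q[rule_format, of ?n m ?adj ?col "graph_input vs code G c"] m(1) n by auto
    then show ?thesis using result_imp_finds n by auto
  qed
  then show ?thesis
    using running_time[OF T sq, of "real C" j k] by (intro exI[of _ Q] exI[of _ b] exI[of _ ?T]) blast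
qed

end
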